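(* Let $\ell=\ell(k)$ be a function from the positive integers to the positive integers (so $\ell(k)\geq 1$ for all $k$) such that $\ell(k)/k^{6/5}\to 0$ as $k\to\infty$. Then $$\mathrm{ind}(k,\ell(k)) \leq \frac{1}{e} + o_k(1),$$ i.e. there is a function $\varepsilon$ of $k$ with $\varepsilon(k)\to 0$ as $k\to\infty$ such that $\mathrm{ind}(k,\ell(k))\leq 1/e+\varepsilon(k)$ for all $k$.
   Context: All graphs are finite, simple and undirected. For a graph $G$ with at least $k$ vertices, let $X_{G,k}$ be the random variable giving the number of edges of $G$ induced by a subset $A\subseteq V(G)$ chosen uniformly at random among all subsets of $V(G)$ of size $k$. For $n\geq k$ define $$I(n,k,\ell) := \max\{\Pr[X_{G,k}=\ell] : G \text{ is a graph with } n \text{ vertices}\}.$$ For fixed $k,\ell$, the function $I(n,k,\ell)$ is non-increasing in $n$ (by a standard averaging argument), so the limit $$\mathrm{ind}(k,\ell) := \lim_{n\to\infty} I(n,k,\ell)$$ exists. The notation $o_k(1)$ denotes a function of $k$ tending to $0$ as $k\to\infty$. Here $e$ is the base of the natural logarithm. *)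

theory Defs
  imports "HOL-Probability.Probability" "HOL-Library.Ramsey"
begin

definition simple_graph :: "'a set \<Rightarrow> 'a set set \<Rightarrow> bool" where
  "simple_graph V E \<longleftrightarrow> finite V \<and> E \<subseteq> nsets V 2"

definition induced_edges :: "'a set set \<Rightarrow> 'a set \<Rightarrow> 'a set set" where
  "induced_edges E A = {e \<in> E. e \<subseteq> A}"

text \<open>
  The distribution of the random variable \<open>X\<^sub>G\<^sub>,\<^sub>k\<close> for \<open>G = (V, E)\<close>; thus
  \<open>pmf (induced_edge_count_pmf V E k) l\<close> is the probability that \<open>X\<^sub>G\<^sub>,\<^sub>k = l\<close>.
  It is meaningful only for \<open>k \<le> card V\<close>.
\<close>
definition induced_edge_count_pmf :: "'a set \<Rightarrow> 'a set set \<Rightarrow> nat \<Rightarrow> nat pmf" where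
  "induced_edge_count_pmf V E k =
     map_pmf (\<lambda>A. card (induced_edges E A)) (pmf_of_set (nsets V k))"

text \<open>
  The vertex sets range over all \<open>n\<close>-element sets of natural numbers, so every isomorphism type
  of graphs on \<open>n\<close> vertices occurs. The set of probabilities is finite and nonempty whenever
  \<open>k \<le> n\<close> (see \<open>finite_induced_probs\<close> and \<open>induced_probs_nonempty\<close> below), so \<open>Max\<close> is a
  genuine maximum there. For \<open>n < k\<close> the value is unspecified.
\<close>
definition induced_probs :: "nat \<Rightarrow> nat \<Rightarrow> nat \<Rightarrow> real set" where
  "induced_probs n k l =
     {pmf (induced_edge_count_pmf V E k) l | (V :: nat set) E. simple_graph V E \<and> card V = n}"

definition max_induced_prob :: "nat \<Rightarrow> nat \<Rightarrow> nat \<Rightarrow> real" where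
  "max_induced_prob n k l = Max (induced_probs n k l)"

text \<open>The limit exists: see \<open>max_induced_prob_LIMSEQ\<close> below.\<close>
definition edge_inducibility :: "nat \<Rightarrow> nat \<Rightarrow> real" where
  "edge_inducibility k l = lim (\<lambda>n. max_induced_prob n k l)"

subsection \<open>Well-definedness\<close>

lemma pmf_induced_edge_count:
  assumes "finite V" "k \<le> card V"
  shows "pmf (induced_edge_count_pmf V E k) l =
           card {A \<in> nsets V k. card (induced_edges E A) = l} / (card V choose k)"
proof -
  have "card (nsets V k) \<noteq> 0"
    using assms(2) by simp
  then have "nsets V k \<noteq> {}"
    by (metis card.empty)
  then show ?thesis
    using finite_imp_finite_nsets[OF assms(1), of k]
    by (simp add: induced_edge_count_pmf_def pmf_map measure_pmf_of_set vimage_def Int_def)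
qed

lemma finite_induced_probs:
  assumes "k \<le> n"
  shows "finite (induced_probs n k l)"
proof (rule finite_subset)
  show "induced_probs n k l \<subseteq> (\<lambda>c. real c / real (n choose k)) ` {..n choose k}"
  proof
    fix x assume "x \<in> induced_probs n k l"
    then obtain V :: "nat set" and E where VE: "simple_graph V E" "card V = n"
      "x = pmf (induced_edge_count_pmf V E k) l" unfolding induced_probs_def by blast
    then have fin: "finite V" by (simp add: simple_graph_def)
    have "card {A \<in> nsets V k. card (induced_edges E A) = l} \<le> card (nsets V k)"
      by (rule card_mono) (auto simp: finite_imp_finite_nsets fin)
    then show "x \<in> (\<lambda>c. real c / real (n choose k)) ` {..n choose k}"
      using VE assms fin by (auto simp: pmf_induced_edge_count finite_imp_finite_nsets)
  qed
qed auto

lemma induced_probs_nonempty: "induced_probs n k l \<noteq> {}"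
proof -
  have "simple_graph {..<n} {}" "card {..<n} = n" by (auto simp: simple_graph_def)
  then show ?thesis unfolding induced_probs_def by blast
qed

lemma max_induced_prob_ge:
  fixes V :: "nat set"
  assumes "simple_graph V E" "k \<le> card V"
  shows "pmf (induced_edge_count_pmf V E k) l \<le> max_induced_prob (card V) k l"
  unfolding max_induced_prob_def
  by (rule Max_ge[OF finite_induced_probs]) (use assms in \<open>auto simp: induced_probs_def\<close>)

lemma max_induced_prob_attained:
  assumes "k \<le> n"
  obtains V :: "nat set" and E where "simple_graph V E" "card V = n"
    "max_induced_prob n k l = pmf (induced_edge_count_pmf V E k) l"
proof -
  have "max_induced_prob n k l \<in> induced_probs n k l"
    unfolding max_induced_prob_def
    using assms finite_induced_probs induced_probs_nonempty by (intro Max_in) auto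
  then show ?thesis using that unfolding induced_probs_def by blast
qed

lemma max_induced_prob_Suc_le:
  assumes kn: "k \<le> n"
  shows "max_induced_prob (Suc n) k l \<le> max_induced_prob n k l"
proof -
  obtain V :: "nat set" and E where G: "simple_graph V E" and cV: "card V = Suc n"
    and max: "max_induced_prob (Suc n) k l = pmf (induced_edge_count_pmf V E k) l"
    using max_induced_prob_attained[of k "Suc n"] kn by (metis le_SucI)
  have fin: "finite V" using G by (simp add: simple_graph_def)
  define S where "S W = {A \<in> nsets W k. card (induced_edges E A) = l}" for W
  have finS: "finite (S V)" using fin by (simp add: S_def finite_imp_finite_nsets)
  have del: "real (card (S (V - {v}))) \<le> max_induced_prob n k l * (n choose k)" if v: "v \<in> V" for v
  proof -
    let ?E = "E \<inter> nsets (V - {v}) 2"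
    have G': "simple_graph (V - {v}) ?E" using fin by (simp add: simple_graph_def)
    have c: "card (V - {v}) = n" using v fin cV by simp
    have "induced_edges ?E A = induced_edges E A" if "A \<in> nsets (V - {v}) k" for A
      using that G by (auto simp: induced_edges_def simple_graph_def nsets_def)
    then have "{A \<in> nsets (V - {v}) k. card (induced_edges ?E A) = l} = S (V - {v})"
      by (auto simp: S_def)
    then have "real (card (S (V - {v}))) / (n choose k) \<le> max_induced_prob n k l"
      using max_induced_prob_ge[OF G', of k l] pmf_induced_edge_count[of "V - {v}" k ?E l] c kn fin
      by simp
    then show ?thesis using kn by (simp add: divide_le_eq)
  qed
  have "(\<Sum>v\<in>V. card (S (V - {v}))) = (\<Sum>v\<in>V. card {A \<in> S V. v \<notin> A})"
    by (intro sum.cong refl arg_cong[where f = card]) (auto simp: S_def nsets_def)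
  also have "\<dots> = (\<Sum>v\<in>V. \<Sum>A\<in>S V. if v \<notin> A then 1 else 0)"
    using finS by (intro sum.cong refl) (simp add: sum.If_cases Int_def)
  also have "\<dots> = (\<Sum>A\<in>S V. \<Sum>v\<in>V. if v \<notin> A then 1 else 0)"
    by (rule sum.swap)
  also have "\<dots> = (\<Sum>A\<in>S V. Suc n - k)"
  proof (intro sum.cong refl)
    fix A assume "A \<in> S V"
    then have A: "A \<subseteq> V" "finite A" "card A = k" by (auto simp: S_def nsets_def)
    have "V \<inter> {v. v \<notin> A} = V - A" by auto
    then show "(\<Sum>v\<in>V. if v \<notin> A then 1 else 0) = Suc n - k"
      using A fin cV by (simp add: sum.If_cases card_Diff_subset)
  qed
  finally have "(\<Sum>v\<in>V. card (S (V - {v}))) = card (S V) * (Suc n - k)"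
    by simp
  then have "real (card (S V)) * real (Suc n - k) = (\<Sum>v\<in>V. real (card (S (V - {v}))))"
    by (simp only: of_nat_mult[symmetric] of_nat_sum[symmetric])
  also have "\<dots> \<le> (\<Sum>v\<in>V. max_induced_prob n k l * (n choose k))"
    by (intro sum_mono del)
  also have "\<dots> = max_induced_prob n k l * real (Suc n * (n choose k))"
    using cV by (simp add: algebra_simps)
  also have "Suc n * (n choose k) = (Suc n - k) * (Suc n choose k)"
    using binomial_absorb_comp[of "Suc n" k] by simp
  finally have "real (card (S V)) * real (Suc n - k) \<le>
    (max_induced_prob n k l * real (Suc n choose k)) * real (Suc n - k)"
    by (simp only: of_nat_mult mult_ac)
  moreover have "real (Suc n - k) > 0" using kn by simp
  ultimately have "real (card (S V)) \<le> max_induced_prob n k l * (Suc n choose k)"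
    by (rule mult_right_le_imp_le)
  moreover have "real (Suc n choose k) > 0"
    using kn by (simp add: zero_less_binomial del: binomial_Suc_Suc)
  ultimately show ?thesis
    using max pmf_induced_edge_count[of V k E l] fin cV kn
    by (simp add: S_def divide_le_eq)
qed

lemma max_induced_prob_LIMSEQ:
  "(\<lambda>n. max_induced_prob n k l) \<longlonglongrightarrow> edge_inducibility k l"
proof -
  have dec: "decseq (\<lambda>n. max_induced_prob (n + k) k l)"
    by (intro decseq_SucI) (simp add: max_induced_prob_Suc_le)
  have nonneg: "0 \<le> max_induced_prob (n + k) k l" for n
    by (rule max_induced_prob_attained[of k "n + k" l]) auto
  have "convergent (\<lambda>n. max_induced_prob (n + k) k l)"
    using decseq_convergent[OF dec, of 0] nonneg unfolding convergent_def by metis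
  then have "convergent (\<lambda>n. max_induced_prob n k l)"
    by (simp only: convergent_ignore_initial_segment[of "\<lambda>n. max_induced_prob n k l" k])
  then show ?thesis
    unfolding edge_inducibility_def by (simp add: convergent_LIMSEQ_iff)
qed

end

theory Submission
  imports
    Defs
    "HOL-Combinatorics.Multiset_Permutations"
begin

text \<open>
  For \<open>n \<rightarrow> \<infinity>\<close> the \<open>k\<close>-subset may be replaced by \<open>k\<close> independent uniform vertices. Suppose that the
  edge count \<open>X\<close> of the sample takes the value \<open>l\<close> with probability at least some fixed \<open>\<eta> > 0\<close>.

  Comparing two independent choices of half of the sample turns \<open>X = l\<close> into an event on a sum of
  independent terms \<open>D y\<close>, where \<open>D y\<close> is the difference of the degrees of \<open>y\<close> into the two halves.
  By the small ball inequality \<open>D\<close> is constant outside a set of measure \<open>O(1/k)\<close>. Hence all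
  vertices outside a set of ``hubs'' of measure \<open>O(1/k)\<close> have degree \<open>O(n/k)\<close>, and then the non-hubs
  in the sample span only \<open>O(1)\<close> edges. Given the sampled hubs \<open>S\<close>, the count \<open>X\<close> is therefore
  a sum of independent terms up to \<open>O(1)\<close>; if it still hits \<open>l\<close> with probability at least \<open>\<eta>\<close>, then
  almost every vertex has exactly \<open>m\<close> neighbours in \<open>S\<close> and \<open>l = m k + O(1)\<close>, so that \<open>m\<close> does not
  depend on \<open>S\<close>. For \<open>m \<ge> 1\<close> these sets \<open>S\<close> form an antichain not containing the empty set, and for
  \<open>m = 0\<close> the value \<open>l\<close> is bounded, so that the size of the sample may be made random. In
  both cases it remains to bound the probability of a family of sets under a product measure
  with small marginals by \<open>1/e\<close>. This is done by adding the points one at a time.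
\<close>


section \<open>Averages over lists\<close>

text \<open>Why the hubs must sit above a gap in the degrees: a hub set that makes the value
  \<open>l\<close> likely is rigid only up to an exceptional set of measure \<open>C / k\<close> of
  non-hubs, and two nested rigid sets contradict each other only if every hub has degree above about
  twice that error. But \<open>C\<close> depends on the degree bound imposed on the non-hubs, so no
  threshold fixed in advance works. This circularity forces the sequence of scales in
  \<open>lavg_ecount_le\<close>.

  Why bounded \<open>l\<close> is treated apart: the comparison with a random sample size loses
  order \<open>l / k\<close> per deleted vertex, and that size fluctuates by order
  \<open>sqrt k\<close>. This is affordable for small \<open>l\<close> only; for larger
  \<open>l\<close> just the few sampled hubs are compared with a product measure.

  The value \<open>1 / exp 1\<close> is the maximum over \<open>x\<close> of
  \<open>x * exp (- x)\<close>, the probability that a Poisson variable of mean \<open>x\<close>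
  equals 1. The antichain of all singletons, with expected size 1, approaches it.\<close>

primrec lsum :: "'a set \<Rightarrow> nat \<Rightarrow> ('a list \<Rightarrow> 'b::comm_monoid_add) \<Rightarrow> 'b" where
  "lsum V 0 F = F []"
| "lsum V (Suc k) F = (\<Sum>x\<in>V. lsum V k (\<lambda>xs. F (x # xs)))"

text \<open>Entries are drawn with repetition, which keeps them independent. \<open>lsum\<close>
  recurses on the entries so that Fubini and product formulas become inductions, and its codomain is
  general because the Fourier argument sums complex products. The closed form here serves to count
  lists in \<open>lsum_distinct\<close>.\<close>

lemma lsum_eq_sum:
  assumes "finite V"
  shows "lsum V k F = (\<Sum>xs | set xs \<subseteq> V \<and> length xs = k. F xs)"
proof (induction k arbitrary: F)
  case 0
  have "{xs. set xs \<subseteq> V \<and> length xs = 0} = {[]}" by auto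
  then show ?case by simp
next
  case (Suc k)
  have eq: "{xs. set xs \<subseteq> V \<and> length xs = Suc k} =
      (\<lambda>(x, xs). x # xs) ` (V \<times> {xs. set xs \<subseteq> V \<and> length xs = k})"
    by (auto simp: length_Suc_conv image_iff)
  have inj: "inj_on (\<lambda>(x, xs). x # xs) (V \<times> {xs. set xs \<subseteq> V \<and> length xs = k})"
    by (auto simp: inj_on_def)
  show ?case
    unfolding eq sum.reindex[OF inj]
    by (simp add: Suc.IH sum.cartesian_product split_def)
qed

lemma lsum_cong:
  "(\<And>xs. set xs \<subseteq> V \<Longrightarrow> length xs = k \<Longrightarrow> F xs = G xs) \<Longrightarrow> lsum V k F = lsum V k G"
proof (induction k arbitrary: F G)
  case (Suc k)
  show ?case
    unfolding lsum.simps by (intro sum.cong refl Suc.IH Suc.prems) auto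
qed auto

lemma lsum_mono:
  fixes F G :: "'a list \<Rightarrow> real"
  shows "(\<And>xs. set xs \<subseteq> V \<Longrightarrow> length xs = k \<Longrightarrow> F xs \<le> G xs) \<Longrightarrow> lsum V k F \<le> lsum V k G"
proof (induction k arbitrary: F G)
  case (Suc k)
  show ?case
    unfolding lsum.simps by (intro sum_mono Suc.IH Suc.prems) auto
qed auto

lemma lsum_0 [simp]: "lsum V k (\<lambda>_. 0) = 0"
  by (induction k) auto

lemma lsum_const: "lsum V k (\<lambda>_. c::'b::comm_semiring_1) = of_nat (card V) ^ k * c"
  by (induction k) (auto simp: algebra_simps)

lemma lsum_add: "lsum V k (\<lambda>xs. F xs + G xs) = lsum V k F + lsum V k G"
  by (induction k arbitrary: F G) (auto simp: sum.distrib)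

lemma lsum_cmult: "lsum V k (\<lambda>xs. c * F xs) = c * lsum V k (F :: _ \<Rightarrow> 'b::comm_semiring_0)"
  by (induction k arbitrary: F) (auto simp: sum_distrib_left)

lemma lsum_sum: "lsum V k (\<lambda>xs. \<Sum>i\<in>I. F i xs) = (\<Sum>i\<in>I. lsum V k (F i))"
proof (induction k arbitrary: F)
  case (Suc k)
  show ?case unfolding lsum.simps by (simp add: Suc.IH sum.swap[of _ I V])
qed auto

lemma lsum_append:
  "lsum V (a + b) F = lsum V a (\<lambda>xs. lsum V b (\<lambda>ys. F (xs @ ys)))"
  by (induction a arbitrary: F) auto

lemma lsum_swap:
  "lsum V a (\<lambda>xs. lsum W b (\<lambda>ys. F xs ys)) = lsum W b (\<lambda>ys. lsum V a (\<lambda>xs. F xs ys))"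
  by (induction a arbitrary: F) (auto simp: lsum_sum)

lemma lsum_prod_list:
  fixes g :: "'a \<Rightarrow> 'b::comm_semiring_1"
  shows "lsum V k (\<lambda>xs. \<Prod>x\<leftarrow>xs. g x) = (\<Sum>x\<in>V. g x) ^ k"
  by (induction k) (auto simp: lsum_cmult sum_distrib_right)

definition avg :: "'a set \<Rightarrow> ('a \<Rightarrow> real) \<Rightarrow> real" where
  "avg V g = (\<Sum>x\<in>V. g x) / real (card V)"

definition lavg :: "'a set \<Rightarrow> nat \<Rightarrow> ('a list \<Rightarrow> real) \<Rightarrow> real" where
  "lavg V k F = lsum V k F / real (card V) ^ k"

lemma lavg_0 [simp]: "lavg V 0 F = F []"
  by (simp add: lavg_def)

lemma lavg_Suc: "lavg V (Suc k) F = avg V (\<lambda>x. lavg V k (\<lambda>xs. F (x # xs)))"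
  by (simp add: lavg_def avg_def sum_divide_distrib mult.commute)

lemma lavg_cong:
  "(\<And>xs. set xs \<subseteq> V \<Longrightarrow> length xs = k \<Longrightarrow> F xs = G xs) \<Longrightarrow> lavg V k F = lavg V k G"
  unfolding lavg_def by (metis lsum_cong)

lemma lavg_mono:
  "(\<And>xs. set xs \<subseteq> V \<Longrightarrow> length xs = k \<Longrightarrow> F xs \<le> G xs) \<Longrightarrow> lavg V k F \<le> lavg V k G"
  unfolding lavg_def by (intro divide_right_mono lsum_mono) auto

lemma lavg_add: "lavg V k (\<lambda>xs. F xs + G xs) = lavg V k F + lavg V k G"
  by (simp add: lavg_def lsum_add add_divide_distrib)

lemma lavg_cmult: "lavg V k (\<lambda>xs. c * F xs) = c * lavg V k F"
  by (simp add: lavg_def lsum_cmult)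

lemma lavg_diff: "lavg V k (\<lambda>xs. F xs - G xs) = lavg V k F - lavg V k G"
  using lavg_add[of V k F "\<lambda>xs. (-1) * G xs"] lavg_cmult[of V k "-1" G] by simp

lemma lavg_sum: "lavg V k (\<lambda>xs. \<Sum>i\<in>I. F i xs) = (\<Sum>i\<in>I. lavg V k (F i))"
  by (simp add: lavg_def lsum_sum sum_divide_distrib)

lemma lavg_avg: "lavg V k (\<lambda>xs. avg W (\<lambda>y. F y xs)) = avg W (\<lambda>y. lavg V k (F y))"
  using lavg_cmult[of V k "inverse (real (card W))" "\<lambda>xs. \<Sum>y\<in>W. F y xs"]
  by (simp add: avg_def lavg_sum divide_inverse mult.commute)

lemma lavg_const:
  assumes "finite V" "V \<noteq> {}"
  shows "lavg V k (\<lambda>_. c) = c"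
  using assms by (simp add: lavg_def lsum_const)

lemma avg_const:
  assumes "finite V" "V \<noteq> {}"
  shows "avg V (\<lambda>_. c) = c"
  using assms by (simp add: avg_def)

lemma avg_mono: "(\<And>x. x \<in> V \<Longrightarrow> f x \<le> g x) \<Longrightarrow> avg V f \<le> avg V g"
  unfolding avg_def by (intro divide_right_mono sum_mono) auto

lemma avg_cong: "(\<And>x. x \<in> V \<Longrightarrow> f x = g x) \<Longrightarrow> avg V f = avg V g"
  unfolding avg_def by (simp cong: sum.cong)

lemma avg_add: "avg V (\<lambda>x. f x + g x) = avg V f + avg V g"
  by (simp add: avg_def sum.distrib add_divide_distrib)

lemma avg_diff: "avg V (\<lambda>x. f x - g x) = avg V f - avg V g"
  by (simp add: avg_def sum_subtractf diff_divide_distrib)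

lemma avg_cmult: "avg V (\<lambda>x. c * f x) = c * avg V f"
  by (simp add: avg_def sum_distrib_left)

lemma avg_nonneg: "(\<And>x. x \<in> V \<Longrightarrow> 0 \<le> f x) \<Longrightarrow> 0 \<le> avg V f"
  unfolding avg_def by (intro divide_nonneg_nonneg sum_nonneg) auto

lemma lavg_nonneg:
  "(\<And>xs. set xs \<subseteq> V \<Longrightarrow> length xs = k \<Longrightarrow> 0 \<le> F xs) \<Longrightarrow> 0 \<le> lavg V k F"
  using lavg_mono[of V k "\<lambda>_. 0" F] by (simp add: lavg_def)

lemma lavg_append: "lavg V (a + b) F = lavg V a (\<lambda>xs. lavg V b (\<lambda>ys. F (xs @ ys)))"
  using lsum_cmult[of V a "inverse (real (card V) ^ b)" "\<lambda>xs. lsum V b (\<lambda>ys. F (xs @ ys))"]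
  by (simp add: lavg_def lsum_append divide_inverse power_add mult_ac)

lemma lavg_swap:
  "lavg V a (\<lambda>xs. lavg W b (\<lambda>ys. F xs ys)) = lavg W b (\<lambda>ys. lavg V a (\<lambda>xs. F xs ys))"
  using lsum_cmult[of V a "inverse (real (card W) ^ b)" "\<lambda>xs. lsum W b (F xs)"]
    lsum_cmult[of W b "inverse (real (card V) ^ a)" "\<lambda>ys. lsum V a (\<lambda>xs. F xs ys)"]
    lsum_swap[of V a W b F]
  by (simp add: lavg_def divide_inverse mult_ac)

lemma lavg_sum_list:
  assumes "finite V" "V \<noteq> {}"
  shows "lavg V k (\<lambda>xs. \<Sum>x\<leftarrow>xs. g x) = real k * avg V g"
proof (induction k)
  case (Suc k)
  show ?case
    unfolding lavg_Suc using assms by (simp add: lavg_add lavg_const Suc.IH avg_add avg_const algebra_simps)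
qed auto

lemma lavg_square_ge:
  assumes "finite V" "V \<noteq> {}"
  shows "(lavg V k F)\<^sup>2 \<le> lavg V k (\<lambda>xs. (F xs)\<^sup>2)"
proof -
  define m where "m = lavg V k F"
  have "0 \<le> lavg V k (\<lambda>xs. (F xs - m)\<^sup>2)"
    by (rule lavg_nonneg) auto
  also have "(\<lambda>xs. (F xs - m)\<^sup>2) = (\<lambda>xs. ((F xs)\<^sup>2 - 2 * m * F xs) + m\<^sup>2)"
    by (auto simp: power2_eq_square algebra_simps)
  finally show ?thesis
    using assms by (simp add: lavg_add lavg_diff lavg_cmult lavg_const m_def[symmetric] power2_eq_square)
qed

lemma lavg_markov:
  assumes "c > 0" "\<And>xs. set xs \<subseteq> V \<Longrightarrow> length xs = k \<Longrightarrow> 0 \<le> F xs"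
  shows "lavg V k (\<lambda>xs. of_bool (F xs \<ge> c)) \<le> lavg V k F / c"
proof -
  have "lavg V k (\<lambda>xs. of_bool (F xs \<ge> c)) \<le> lavg V k (\<lambda>xs. (1 / c) * F xs)"
    by (rule lavg_mono) (use assms in \<open>auto simp: of_bool_def\<close>)
  then show ?thesis unfolding lavg_cmult by simp
qed

text \<open>Chebyshev: since \<open>0 <= g <= M\<close>, the second moment of one term is at most
  \<open>M\<close> times its mean \<open>m\<close>, so the variance of the sum is at most
  \<open>b * M * m\<close>, against a deviation of \<open>b * m / 2\<close>. The bound is useful
  once the expected sum is large compared with \<open>M\<close>, even if \<open>m\<close> itself is
  small.\<close>

lemma lavg_sum_list_lower_tail:
  assumes V: "finite V" "V \<noteq> {}" and g: "\<And>x. x \<in> V \<Longrightarrow> 0 \<le> g x \<and> g x \<le> M"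
    and pos: "avg V g > 0" "b > 0"
  shows "lavg V b (\<lambda>xs. of_bool ((\<Sum>x\<leftarrow>xs. g x) \<le> real b * avg V g / 2)) \<le> 4 * M / (real b * avg V g)"
proof -
  define m where "m = avg V g"
  define v where "v = avg V (\<lambda>x. (g x - m)\<^sup>2)"
  have zero: "avg V (\<lambda>x. g x - m) = 0"
    using V by (simp add: avg_diff avg_const m_def)
  have lin: "lavg V k (\<lambda>xs. \<Sum>x\<leftarrow>xs. (g x - m)) = 0" for k
    using lavg_sum_list[OF V, of k "\<lambda>x. g x - m"] zero by simp
  have var: "lavg V k (\<lambda>xs. (\<Sum>x\<leftarrow>xs. (g x - m))\<^sup>2) = real k * v" for k
  proof (induction k)
    case (Suc k)
    have "lavg V k (\<lambda>xs. ((g x - m) + (\<Sum>x\<leftarrow>xs. (g x - m)))\<^sup>2) = (g x - m)\<^sup>2 + real k * v" for x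
    proof -
      have "(\<lambda>xs. ((g x - m) + (\<Sum>x\<leftarrow>xs. (g x - m)))\<^sup>2) =
        (\<lambda>xs. ((g x - m)\<^sup>2 + (2 * (g x - m)) * (\<Sum>x\<leftarrow>xs. (g x - m))) + (\<Sum>x\<leftarrow>xs. (g x - m))\<^sup>2)"
        by (auto simp: power2_eq_square algebra_simps)
      then show ?thesis
        using V by (simp add: lavg_add lavg_cmult lin Suc.IH lavg_const)
    qed
    then show ?case
      unfolding lavg_Suc using V by (simp add: avg_add avg_const v_def algebra_simps)
  qed simp
  have "v \<le> avg V (\<lambda>x. M * g x - 2 * m * g x + m\<^sup>2)"
    unfolding v_def
  proof (rule avg_mono)
    fix x assume "x \<in> V"
    then have "g x * g x \<le> M * g x" using g by (intro mult_right_mono) auto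
    then show "(g x - m)\<^sup>2 \<le> M * g x - 2 * m * g x + m\<^sup>2"
      by (simp add: power2_eq_square algebra_simps)
  qed
  also have "\<dots> = M * m - m\<^sup>2"
    using V by (simp add: avg_add avg_diff avg_cmult avg_const m_def[symmetric] power2_eq_square)
  finally have v: "v \<le> M * m" by (smt (verit) zero_le_power2)
  have dev: "(\<Sum>x\<leftarrow>xs. (g x - m)) = (\<Sum>x\<leftarrow>xs. g x) - real (length xs) * m" for xs
    by (simp add: sum_list_subtractf sum_list_triv)
  have c: "(real b * m / 2)\<^sup>2 > 0" using pos by (simp add: m_def)
  have "lavg V b (\<lambda>xs. of_bool ((\<Sum>x\<leftarrow>xs. g x) \<le> real b * m / 2))
      \<le> lavg V b (\<lambda>xs. of_bool ((\<Sum>x\<leftarrow>xs. (g x - m))\<^sup>2 \<ge> (real b * m / 2)\<^sup>2))"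
  proof (rule lavg_mono)
    fix xs :: "'a list" assume xs: "set xs \<subseteq> V" "length xs = b"
    have "(\<Sum>x\<leftarrow>xs. (g x - m))\<^sup>2 \<ge> (real b * m / 2)\<^sup>2" if "(\<Sum>x\<leftarrow>xs. g x) \<le> real b * m / 2"
    proof -
      have "real b * m / 2 \<le> - (\<Sum>x\<leftarrow>xs. (g x - m))" using that dev[of xs] xs by (simp add: mult.commute)
      moreover have "0 \<le> real b * m / 2" using pos by (simp add: m_def)
      ultimately have "(real b * m / 2)\<^sup>2 \<le> (- (\<Sum>x\<leftarrow>xs. (g x - m)))\<^sup>2" by (rule power_mono)
      then show ?thesis by simp
    qed
    then show "of_bool ((\<Sum>x\<leftarrow>xs. g x) \<le> real b * m / 2)
      \<le> (of_bool ((\<Sum>x\<leftarrow>xs. (g x - m))\<^sup>2 \<ge> (real b * m / 2)\<^sup>2) :: real)" by auto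
  qed
  also have "\<dots> \<le> real b * v / (real b * m / 2)\<^sup>2"
    using lavg_markov[OF c, of V b "\<lambda>xs. (\<Sum>x\<leftarrow>xs. (g x - m))\<^sup>2"] var by simp
  also have "\<dots> \<le> real b * (M * m) / (real b * m / 2)\<^sup>2"
    using v c by (intro divide_right_mono mult_left_mono) auto
  also have "\<dots> = 4 * M / (real b * m)"
    using pos by (simp add: m_def power2_eq_square field_simps)
  finally show ?thesis by (simp add: m_def)
qed

section \<open>A small ball inequality\<close>

text \<open>Non-concentration is measured through pairs because both uses expand over pairs: the
  squared modulus of a characteristic function, and the averages over \<open>y\<close> and
  \<open>z\<close> in \<open>hubs_rare\<close>. A dominating value is recovered by
  \<open>noncol_mode\<close>.\<close>

definition noncol :: "'a set \<Rightarrow> ('a \<Rightarrow> int) \<Rightarrow> real" where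
  "noncol V D = avg V (\<lambda>y. avg V (\<lambda>z. of_bool (D y \<noteq> D z)))"

lemma Re_lsum: "Re (lsum V k F) = lsum V k (\<lambda>xs. Re (F xs))"
  by (induction k arbitrary: F) auto

lemma cis_sum_list: "cis (\<Sum>y\<leftarrow>ys. f y) = (\<Prod>y\<leftarrow>ys. cis (f y))"
  by (induction ys) (auto simp: cis_mult[symmetric])

text \<open>The right-hand side is the indicator of \<open>Q\<close> dividing \<open>d\<close>, a
  geometric sum of roots of unity, and this dominates the indicator of \<open>d = 0\<close>. Working
  with an inequality leaves the size of \<open>d\<close> unrestricted, so sums of many terms are
  covered by a modulus that only exceeds single differences.\<close>

lemma sum_roots_of_unity_ge:
  fixes d :: int
  assumes Q: "Q > 0"
  shows "of_bool (d = 0) \<le> (\<Sum>j<Q. Re (cis (2 * pi * real j * real_of_int d / real Q))) / real Q"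
proof (cases "d = 0")
  case True
  then show ?thesis using Q by simp
next
  case False
  define z where "z = cis (2 * pi * real_of_int d / real Q)"
  have pow: "cis (2 * pi * real j * real_of_int d / real Q) = z ^ j" for j :: nat
  proof -
    have "2 * pi * real j * real_of_int d / real Q = real j * (2 * pi * real_of_int d / real Q)" by simp
    then show ?thesis unfolding z_def by (simp only: Complex.DeMoivre)
  qed
  have "z ^ Q = cis (2 * pi * real_of_int d)"
    using Q by (simp add: z_def Complex.DeMoivre)
  also have "\<dots> = 1"
    by (metis cis_multiple_2pi Ints_of_int)
  finally have zQ: "z ^ Q = 1" .
  have "0 \<le> Re (\<Sum>j<Q. z ^ j)"
  proof (cases "z = 1")
    case False
    then show ?thesis using geometric_sum[OF False, of Q] zQ by simp
  qed simp
  then show ?thesis using False by (simp add: pow)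
qed

lemma sum_exp_cos_reindex:
  fixes W :: int
  assumes Q: "prime Q" and W: "W \<noteq> 0" "\<bar>W\<bar> < int Q"
  shows "(\<Sum>j<Q. exp (- s * (1 - cos (2 * pi * real j * real_of_int W / real Q)))) =
         (\<Sum>j<Q. exp (- s * (1 - cos (2 * pi * real j / real Q))))"
proof -
  have Q0: "Q > 0" using Q prime_gt_0_nat by blast
  define \<pi> where "\<pi> j = nat ((int j * W) mod int Q)" for j
  have ndvd: "\<not> int Q dvd W"
    using W zdvd_imp_le[of "int Q" "\<bar>W\<bar>"] by auto
  have inj: "inj_on \<pi> {..<Q}"
  proof (rule inj_onI)
    fix i j assume ij: "i \<in> {..<Q}" "j \<in> {..<Q}" "\<pi> i = \<pi> j"
    then have "(int i * W) mod int Q = (int j * W) mod int Q"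
      using Q0 by (simp add: \<pi>_def nat_eq_iff split: if_splits) 
    then have "int Q dvd int i * W - int j * W" by (simp add: mod_eq_dvd_iff)
    then have "int Q dvd (int i - int j) * W" by (simp add: algebra_simps)
    then have "int Q dvd int i - int j"
      using Q ndvd by (simp add: prime_dvd_mult_iff)
    moreover have "\<bar>int i - int j\<bar> < int Q" using ij by auto
    ultimately have "int i - int j = 0"
      using zdvd_imp_le[of "int Q" "\<bar>int i - int j\<bar>"] by (cases "int i = int j") auto
    then show "i = j" by simp
  qed
  have sub: "\<pi> ` {..<Q} \<subseteq> {..<Q}"
    using Q0 by (auto simp: \<pi>_def nat_less_iff)
  have img: "\<pi> ` {..<Q} = {..<Q}"
    by (rule endo_inj_surj[OF _ sub inj]) simp
  have c: "cos (2 * pi * real j * real_of_int W / real Q) = cos (2 * pi * real (\<pi> j) / real Q)" for j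
  proof -
    define q where "q = (int j * W) div int Q"
    have "int j * W = q * int Q + (int j * W) mod int Q" by (simp add: q_def)
    also have "(int j * W) mod int Q = int (\<pi> j)" using Q0 by (simp add: \<pi>_def)
    finally have "real_of_int (int j * W) = real_of_int (q * int Q + int (\<pi> j))" by simp
    then have e: "real j * real_of_int W = of_int q * real Q + real (\<pi> j)" by simp
    have "2 * pi * real j * real_of_int W / real Q = 2 * pi * (real j * real_of_int W) / real Q"
      by simp
    also have "\<dots> = 2 * pi * real (\<pi> j) / real Q + of_int q * (2 * pi)"
      unfolding e using Q0 by (simp add: field_simps)
    finally show ?thesis using cos_int_2pin[of q] sin_int_2pin[of q] by (simp add: cos_add mult.commute)
  qed
  have "(\<Sum>j<Q. exp (- s * (1 - cos (2 * pi * real j * real_of_int W / real Q)))) =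
        (\<Sum>j<Q. exp (- s * (1 - cos (2 * pi * real (\<pi> j) / real Q))))"
    by (simp only: c)
  also have "\<dots> = (\<Sum>j\<in>\<pi> ` {..<Q}. exp (- s * (1 - cos (2 * pi * real j / real Q))))"
    by (simp add: sum.reindex[OF inj])
  finally show ?thesis by (simp only: img)
qed

text \<open>The residues within \<open>\<rho> * Q\<close> of \<open>0\<close> or of \<open>Q\<close>
  are at most \<open>2 * (\<rho> * Q + 1)\<close> many and contribute at most 1 each, the rounding
  giving \<open>2 / Q\<close>. For all others the cosine is at most
  \<open>cos (2 * pi * \<rho>)\<close>, by monotonicity on the half period and symmetry.\<close>

lemma sum_exp_cos_le:
  assumes Q: "Q > 0" and r: "0 < \<rho>" "\<rho> \<le> 1/2" and s: "s \<ge> 0"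
  shows "(\<Sum>j<Q. exp (- s * (1 - cos (2 * pi * real j / real Q)))) / real Q
      \<le> 2 * \<rho> + 2 / real Q + exp (- s * (1 - cos (2 * pi * \<rho>)))"
proof -
  define E where "E = exp (- s * (1 - cos (2 * pi * \<rho>)))"
  have E: "E > 0" by (simp add: E_def)
  define B where "B = {j. j < Q \<and> real j < \<rho> * real Q} \<union> {j. j < Q \<and> real j > (1 - \<rho>) * real Q}"
  have finB: "finite B" by (simp add: B_def)
  have le: "exp (- s * (1 - cos (2 * pi * real j / real Q))) \<le> of_bool (j \<in> B) + E" if "j < Q" for j
  proof (cases "j \<in> B")
    case True
    have "s * (1 - cos (2 * pi * real j / real Q)) \<ge> 0" using s by simp
    then have "exp (- s * (1 - cos (2 * pi * real j / real Q))) \<le> 1" by simp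
    then have "exp (- s * (1 - cos (2 * pi * real j / real Q))) \<le> 1 + E" using E by linarith
    then show ?thesis using True by simp
  next
    case False
    define x where "x = real j / real Q"
    have x: "\<rho> \<le> x" "x \<le> 1 - \<rho>"
      using False that Q by (auto simp: B_def x_def field_simps not_less)
    have "cos (2 * pi * x) \<le> cos (2 * pi * \<rho>)"
    proof (cases "x \<le> 1/2")
      case True
      then show ?thesis using x r by (intro cos_monotone_0_pi_le) (auto simp: field_simps)
    next
      case False
      have "cos (2 * pi * x) = cos (2 * pi * (1 - x))"
      proof -
        have "2 * pi * (1 - x) = 2 * pi - 2 * pi * x" by (simp add: algebra_simps)
        then show ?thesis by (simp only: cos_2pi_minus)
      qed
      also have "\<dots> \<le> cos (2 * pi * \<rho>)"
      proof (rule cos_monotone_0_pi_le)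
        show "2 * pi * \<rho> \<le> 2 * pi * (1 - x)" using x by (intro mult_left_mono) auto
        have "2 * pi * (1 - x) \<le> 2 * pi * (1 / 2)" using False by (intro mult_left_mono) auto
        then show "2 * pi * (1 - x) \<le> pi" by simp
      qed (use r in simp)
      finally show ?thesis .
    qed
    then have "s * (1 - cos (2 * pi * \<rho>)) \<le> s * (1 - cos (2 * pi * real j / real Q))"
      using s by (intro mult_left_mono) (auto simp: x_def)
    then show ?thesis using False by (simp add: E_def)
  qed
  have cardB: "real (card B) \<le> 2 * (\<rho> * real Q + 1)"
  proof -
    have "0 \<le> \<rho> * real Q" using r by simp
    then have "real (nat \<lceil>\<rho> * real Q\<rceil>) = of_int \<lceil>\<rho> * real Q\<rceil>" by simp
    then have ceil: "real (nat \<lceil>\<rho> * real Q\<rceil>) \<le> \<rho> * real Q + 1" by linarith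
    have "{j. j < Q \<and> real j < \<rho> * real Q} \<subseteq> {..< nat \<lceil>\<rho> * real Q\<rceil>}"
      by (auto simp: less_ceiling_iff) linarith
    then have "card {j. j < Q \<and> real j < \<rho> * real Q} \<le> nat \<lceil>\<rho> * real Q\<rceil>"
      by (metis card_lessThan card_mono finite_lessThan)
    then have 1: "real (card {j. j < Q \<and> real j < \<rho> * real Q}) \<le> \<rho> * real Q + 1"
      using ceil by (meson of_nat_mono order_trans)
    have "{j. j < Q \<and> real j > (1 - \<rho>) * real Q} \<subseteq> (\<lambda>i. Q - i) ` {..< nat \<lceil>\<rho> * real Q\<rceil>}"
    proof
      fix j assume "j \<in> {j. j < Q \<and> real j > (1 - \<rho>) * real Q}"
      then have "j = Q - (Q - j)" "real (Q - j) < \<rho> * real Q"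
        by (auto simp: algebra_simps of_nat_diff)
      moreover from this(2) have "Q - j < nat \<lceil>\<rho> * real Q\<rceil>" by linarith
      ultimately show "j \<in> (\<lambda>i. Q - i) ` {..< nat \<lceil>\<rho> * real Q\<rceil>}" by blast
    qed
    then have "card {j. j < Q \<and> real j > (1 - \<rho>) * real Q} \<le> nat \<lceil>\<rho> * real Q\<rceil>"
      by (metis (no_types, lifting) card_image_le card_lessThan card_mono finite_imageI finite_lessThan le_trans)
    then have 2: "real (card {j. j < Q \<and> real j > (1 - \<rho>) * real Q}) \<le> \<rho> * real Q + 1"
      using ceil by (meson of_nat_mono order_trans)
    have "real (card B) \<le> real (card {j. j < Q \<and> real j < \<rho> * real Q})
      + real (card {j. j < Q \<and> real j > (1 - \<rho>) * real Q})"
      unfolding B_def of_nat_add[symmetric] by (intro of_nat_mono card_Un_le)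
    then show ?thesis using 1 2 by simp
  qed
  have "(\<Sum>j<Q. exp (- s * (1 - cos (2 * pi * real j / real Q)))) \<le> (\<Sum>j<Q. of_bool (j \<in> B) + E)"
    by (intro sum_mono le) auto
  also have "\<dots> = real (card B) + real Q * E"
  proof -
    have "B \<subseteq> {..<Q}" by (auto simp: B_def)
    then show ?thesis by (simp add: sum.distrib of_bool_def sum.If_cases Int_absorb1)
  qed
  also have "\<dots> \<le> 2 * (\<rho> * real Q + 1) + real Q * E" using cardB by simp
  finally have "(\<Sum>j<Q. exp (- s * (1 - cos (2 * pi * real j / real Q)))) / real Q
     \<le> (2 * (\<rho> * real Q + 1) + real Q * E) / real Q"
    by (intro divide_right_mono) auto
  also have "\<dots> = 2 * \<rho> + 2 / real Q + E" using Q by (simp add: field_simps)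
  finally show ?thesis by (simp add: E_def)
qed

text \<open>
  Fourier expansion modulo a prime \<open>Q\<close>. Jensen's inequality reduces the bound on the characteristic
  function to single values \<open>W = D y - D z \<noteq> 0\<close>, and multiplication by \<open>W\<close> permutes the residues.
\<close>
lemma small_ball_fourier:
  assumes V: "finite V" "V \<noteq> {}" and Q: "prime Q" and D: "\<And>y z. y \<in> V \<Longrightarrow> z \<in> V \<Longrightarrow> \<bar>D y - D z\<bar> < int Q"
    and \<sigma>: "noncol V D > 0"
  shows "lavg V b (\<lambda>ys. of_bool ((\<Sum>y\<leftarrow>ys. D y) = c)) \<le>
    (\<Sum>j<Q. exp (- (real b * noncol V D / 2) * (1 - cos (2 * pi * real j / real Q)))) / real Q"
proof -
  define n where "n = real (card V)"
  have n: "n > 0" using V by (simp add: n_def card_gt_0_iff)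
  have Q0: "Q > 0" using Q prime_gt_0_nat by blast
  define \<theta> where "\<theta> j = 2 * pi * real j / real Q" for j
  define \<Phi> where "\<Phi> j = (\<Sum>y\<in>V. cis (\<theta> j * real_of_int (D y)))" for j
  define s where "s = real b * noncol V D / 2"
  define NN where "NN = {(y, z). y \<in> V \<and> z \<in> V \<and> D y \<noteq> D z}"
  have NN: "NN \<subseteq> V \<times> V" "finite NN"
    using V by (auto simp: NN_def intro: finite_subset[of _ "V \<times> V"])
  have \<sigma>_eq: "noncol V D * n\<^sup>2 = real (card NN)"
  proof -
    have "noncol V D * n\<^sup>2 = (\<Sum>y\<in>V. \<Sum>z\<in>V. of_bool (D y \<noteq> D z))"
      using n by (simp add: noncol_def avg_def n_def[symmetric] sum_divide_distrib[symmetric] power2_eq_square)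
    also have "\<dots> = (\<Sum>w\<in>V \<times> V. of_bool (w \<in> NN))"
      by (auto simp: sum.cartesian_product NN_def intro!: sum.cong)
    also have "\<dots> = real (card NN)"
      using V NN by (simp add: of_bool_def sum.If_cases Int_absorb1)
    finally show ?thesis .
  qed
  have NNpos: "real (card NN) > 0" using \<sigma> n by (simp add: \<sigma>_eq[symmetric])
  have Re\<Phi>: "(cmod (\<Phi> j))\<^sup>2 = n\<^sup>2 - (\<Sum>(y,z)\<in>NN. 1 - cos (\<theta> j * real_of_int (D y - D z)))" for j
  proof -
    have "(cmod (\<Phi> j))\<^sup>2 = (\<Sum>y\<in>V. cos (\<theta> j * real_of_int (D y)))\<^sup>2 + (\<Sum>y\<in>V. sin (\<theta> j * real_of_int (D y)))\<^sup>2"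
      by (simp add: cmod_power2 \<Phi>_def)
    also have "\<dots> = (\<Sum>y\<in>V. \<Sum>z\<in>V. cos (\<theta> j * real_of_int (D y - D z)))"
      by (simp add: power2_eq_square sum_product sum.distrib[symmetric] cos_diff right_diff_distrib)
    also have "\<dots> = (\<Sum>w\<in>V \<times> V. 1 - of_bool (w \<in> NN) * (1 - cos (\<theta> j * real_of_int (D (fst w) - D (snd w)))))"
      unfolding sum.cartesian_product by (intro sum.cong) (auto simp: NN_def)
    also have "\<dots> = n\<^sup>2 - (\<Sum>w\<in>V \<times> V. of_bool (w \<in> NN) * (1 - cos (\<theta> j * real_of_int (D (fst w) - D (snd w)))))"
      by (simp add: sum_subtractf n_def power2_eq_square card_cartesian_product)
    also have "(\<Sum>w\<in>V \<times> V. of_bool (w \<in> NN) * (1 - cos (\<theta> j * real_of_int (D (fst w) - D (snd w))))) =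
      (\<Sum>w\<in>NN. 1 - cos (\<theta> j * real_of_int (D (fst w) - D (snd w))))"
      using V NN by (intro sum.mono_neutral_cong_right) auto
    finally show ?thesis by (simp only: split_def)
  qed
  define m where "m j = (\<Sum>(y,z)\<in>NN. 1 - cos (\<theta> j * real_of_int (D y - D z))) / real (card NN)" for j
  have m_eq: "(\<Sum>(y,z)\<in>NN. 1 - cos (\<theta> j * real_of_int (D y - D z))) = m j * (noncol V D * n\<^sup>2)" for j
    using NNpos by (simp add: m_def \<sigma>_eq)
  \<comment> \<open>Only the square of \<open>cmod (\<Phi> j) / n\<close> is a sum over pairs,
    namely \<open>1 - noncol V D * m j\<close>; passing to the square root produces the factor
    \<open>1/2\<close> in \<open>s\<close>.\<close>
  have \<Phi>_le: "(cmod (\<Phi> j) / n) ^ b \<le> exp (- s * m j)" for j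
  proof -
    have "(cmod (\<Phi> j) / n)\<^sup>2 = 1 - noncol V D * m j"
      using n by (simp only: power_divide Re\<Phi> m_eq) (simp add: field_simps)
    also have "\<dots> \<le> exp (- (noncol V D * m j))"
      using exp_ge_add_one_self[of "- (noncol V D * m j)"] by simp
    also have "\<dots> = (exp (- (noncol V D * m j) / 2))\<^sup>2"
      by (simp add: exp_double[symmetric])
    finally have "cmod (\<Phi> j) / n \<le> exp (- (noncol V D * m j) / 2)"
      by (rule power2_le_imp_le) simp
    then have "(cmod (\<Phi> j) / n) ^ b \<le> exp (- (noncol V D * m j) / 2) ^ b"
      using n by (intro power_mono) auto
    also have "\<dots> = exp (- s * m j)"
      by (simp add: exp_of_nat_mult[symmetric] s_def algebra_simps)
    finally show ?thesis .
  qed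
  have jensen: "exp (- s * m j) \<le> (\<Sum>(y,z)\<in>NN. exp (- s * (1 - cos (\<theta> j * real_of_int (D y - D z))))) / real (card NN)" for j
  proof -
    have cvx: "convex_on UNIV (exp :: real \<Rightarrow> real)" by (rule exp_convex)
    have "exp (\<Sum>w\<in>NN. (1 / real (card NN)) *\<^sub>R (- s * (1 - cos (\<theta> j * real_of_int (D (fst w) - D (snd w))))))
      \<le> (\<Sum>w\<in>NN. (1 / real (card NN)) * exp (- s * (1 - cos (\<theta> j * real_of_int (D (fst w) - D (snd w))))))"
      using NN NNpos by (intro convex_on_sum[OF _ _ cvx]) auto
    also have "(\<Sum>w\<in>NN. (1 / real (card NN)) *\<^sub>R (- s * (1 - cos (\<theta> j * real_of_int (D (fst w) - D (snd w)))))) = - s * m j"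
      by (simp add: m_def split_def sum_distrib_left sum_negf sum_divide_distrib)
    finally show ?thesis by (simp add: split_def sum_divide_distrib)
  qed
  have "lsum V b (\<lambda>ys. of_bool ((\<Sum>y\<leftarrow>ys. D y) = c)) \<le>
     lsum V b (\<lambda>ys. \<Sum>j<Q. (1 / real Q) * Re (cis (- \<theta> j * real_of_int c) * (\<Prod>y\<leftarrow>ys. cis (\<theta> j * real_of_int (D y)))))"
  proof (rule lsum_mono)
    fix ys :: "'a list"
    have "cis (2 * pi * real j * real_of_int ((\<Sum>y\<leftarrow>ys. D y) - c) / real Q) =
      cis (- \<theta> j * real_of_int c) * (\<Prod>y\<leftarrow>ys. cis (\<theta> j * real_of_int (D y)))" for j
    proof -
      have "(\<Prod>y\<leftarrow>ys. cis (\<theta> j * real_of_int (D y))) = cis (\<theta> j * real_of_int (\<Sum>y\<leftarrow>ys. D y))"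
      proof -
        have "(\<Sum>y\<leftarrow>ys. \<theta> j * real_of_int (D y)) = \<theta> j * real_of_int (\<Sum>y\<leftarrow>ys. D y)"
          by (induction ys) (auto simp: algebra_simps)
        then show ?thesis unfolding cis_sum_list[symmetric] by simp
      qed
      then show ?thesis by (simp add: cis_mult \<theta>_def algebra_simps diff_divide_distrib)
    qed
    then show "of_bool ((\<Sum>y\<leftarrow>ys. D y) = c) \<le>
      (\<Sum>j<Q. (1 / real Q) * Re (cis (- \<theta> j * real_of_int c) * (\<Prod>y\<leftarrow>ys. cis (\<theta> j * real_of_int (D y)))))"
      using sum_roots_of_unity_ge[OF Q0, of "(\<Sum>y\<leftarrow>ys. D y) - c"]
      by (simp add: sum_divide_distrib)
  qed
  also have "\<dots> = (\<Sum>j<Q. (1 / real Q) * Re (cis (- \<theta> j * real_of_int c) * \<Phi> j ^ b))"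
    by (simp only: lsum_sum lsum_cmult Re_lsum[symmetric] lsum_prod_list \<Phi>_def)
  also have "\<dots> \<le> (\<Sum>j<Q. (1 / real Q) * cmod (\<Phi> j) ^ b)"
  proof (intro sum_mono mult_left_mono)
    fix j show "Re (cis (- \<theta> j * real_of_int c) * \<Phi> j ^ b) \<le> cmod (\<Phi> j) ^ b"
      using complex_Re_le_cmod[of "cis (- \<theta> j * real_of_int c) * \<Phi> j ^ b"]
      by (simp add: norm_mult norm_power)
  qed simp
  finally have "lavg V b (\<lambda>ys. of_bool ((\<Sum>y\<leftarrow>ys. D y) = c)) \<le> (\<Sum>j<Q. (1 / real Q) * cmod (\<Phi> j) ^ b) / n ^ b"
    unfolding lavg_def n_def[symmetric] using n by (intro divide_right_mono) auto
  also have "\<dots> = (\<Sum>j<Q. (1 / real Q) * (cmod (\<Phi> j) / n) ^ b)"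
    by (simp add: sum_divide_distrib power_divide)
  also have "\<dots> \<le> (\<Sum>j<Q. (1 / real Q) * ((\<Sum>(y,z)\<in>NN. exp (- s * (1 - cos (\<theta> j * real_of_int (D y - D z))))) / real (card NN)))"
    by (intro sum_mono mult_left_mono order.trans[OF \<Phi>_le jensen]) auto
  also have "\<dots> = (\<Sum>(y,z)\<in>NN. \<Sum>j<Q. exp (- s * (1 - cos (\<theta> j * real_of_int (D y - D z))))) / (real (card NN) * real Q)"
    by (simp add: sum_distrib_left[symmetric] sum_divide_distrib[symmetric] split_def sum.swap[of _ NN])
  also have "(\<Sum>(y,z)\<in>NN. \<Sum>j<Q. exp (- s * (1 - cos (\<theta> j * real_of_int (D y - D z))))) =
     (\<Sum>(y,z)\<in>NN. \<Sum>j<Q. exp (- s * (1 - cos (\<theta> j))))"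
  proof (intro sum.cong refl, clarify)
    fix y z assume "(y, z) \<in> NN"
    then have "D y - D z \<noteq> 0" "\<bar>D y - D z\<bar> < int Q" using D by (auto simp: NN_def)
    from sum_exp_cos_reindex[OF Q this, of s]
    show "(\<Sum>j<Q. exp (- s * (1 - cos (\<theta> j * real_of_int (D y - D z))))) = (\<Sum>j<Q. exp (- s * (1 - cos (\<theta> j))))"
      by (simp add: \<theta>_def)
  qed
  also have "\<dots> / (real (card NN) * real Q) = (\<Sum>j<Q. exp (- s * (1 - cos (\<theta> j)))) / real Q"
    using NNpos by (simp add: split_def)
  finally show ?thesis by (simp add: s_def \<theta>_def)
qed

text \<open>Qualitatively the Kolmogorov-Rogozin inequality for atoms, read backwards.
  \<open>C\<close> depends on \<open>\<eta>\<close> alone because the prime may be taken as large as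
  the values of \<open>D\<close> demand, which only decreases the term \<open>2 / Q\<close>; the
  exponential term must then be at least \<open>\<eta> / 2\<close>, and this bounds
  \<open>b * noncol V D\<close>.\<close>

theorem small_ball:
  assumes \<eta>: "\<eta> > 0"
  obtains C :: real where "C > 0"
    "\<And>(V :: 'a set) D b c. finite V \<Longrightarrow> V \<noteq> {} \<Longrightarrow>
       \<eta> \<le> lavg V b (\<lambda>ys. of_bool ((\<Sum>y\<leftarrow>ys. D y) = c)) \<Longrightarrow> real b * noncol V D \<le> C"
proof -
  \<comment> \<open>With \<open>2 / Q <= \<rho>\<close> this gives
    \<open>2 * \<rho> + 2 / Q <= 3 * \<eta> / 16\<close>, so more than \<open>\<eta> / 2\<close> is
    left for the exponential. The minimum with 1 keeps \<open>\<rho>\<close> inside the range where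
    the cosine decreases.\<close>
  define \<rho> where "\<rho> = min \<eta> 1 / 16"
  have \<rho>: "0 < \<rho>" "\<rho> \<le> 1/4" "\<rho> \<le> \<eta> / 16" using \<eta> by (auto simp: \<rho>_def)
  define \<kappa> where "\<kappa> = 1 - cos (2 * pi * \<rho>)"
  have "cos (2 * pi * \<rho>) < cos 0"
    using \<rho> by (intro cos_monotone_0_pi) (auto simp: field_simps)
  then have \<kappa>: "\<kappa> > 0" by (simp add: \<kappa>_def)
  define C where "C = max 1 (2 * ln (2 / \<eta>) / \<kappa>)"
  show ?thesis
  proof (rule that[of C])
    show "C > 0" by (simp add: C_def)
    fix V :: "'a set" and D :: "'a \<Rightarrow> int" and b c
    assume V: "finite V" "V \<noteq> {}"
      and le: "\<eta> \<le> lavg V b (\<lambda>ys. of_bool ((\<Sum>y\<leftarrow>ys. D y) = c))"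
    show "real b * noncol V D \<le> C"
    proof (cases "noncol V D > 0")
      case False
      then have "real b * noncol V D \<le> 0" by (simp add: mult_nonneg_nonpos)
      then show ?thesis by (simp add: C_def)
    next
      case True
      \<comment> \<open>\<open>Q\<close> has to exceed all differences of values of
        \<open>D\<close>, so that no nonzero difference vanishes modulo \<open>Q\<close>, and also
        \<open>2 / \<rho>\<close>.\<close>
      define X where "X = nat (Max ((\<lambda>(y,z). \<bar>D y - D z\<bar>) ` (V \<times> V))) + nat \<lceil>2 / \<rho>\<rceil>"
      obtain Q where Q: "prime Q" "Q > X" using bigger_prime by blast
      have D: "\<bar>D y - D z\<bar> < int Q" if "y \<in> V" "z \<in> V" for y z
      proof -
        have "\<bar>D y - D z\<bar> \<le> Max ((\<lambda>(y,z). \<bar>D y - D z\<bar>) ` (V \<times> V))"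
          using that V by (intro Max_ge) auto
        then show ?thesis using Q by (simp add: X_def)
      qed
      have "2 / \<rho> \<le> real (nat \<lceil>2 / \<rho>\<rceil>)" by linarith
      also have "\<dots> \<le> real Q" using Q unfolding X_def by linarith
      finally have Q2: "2 / real Q \<le> \<rho>"
        using \<rho> Q prime_gt_0_nat[OF Q(1)] by (simp add: field_simps)
      define s where "s = real b * noncol V D / 2"
      have s: "s \<ge> 0" using True by (simp add: s_def)
      have "\<eta> \<le> 2 * \<rho> + 2 / real Q + exp (- s * \<kappa>)"
        using le small_ball_fourier[OF V Q(1) D True, of b c]
          sum_exp_cos_le[OF prime_gt_0_nat[OF Q(1)], of \<rho> s] \<rho> s
        by (simp add: s_def \<kappa>_def)
      then have "\<eta> / 2 \<le> exp (- s * \<kappa>)" using Q2 \<rho> by linarith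
      then have "ln (\<eta> / 2) \<le> - s * \<kappa>" using \<eta> by (metis exp_gt_zero half_gt_zero ln_exp ln_mono)
      then have "s * \<kappa> \<le> ln (2 / \<eta>)" using \<eta> by (simp add: ln_div)
      then have "s \<le> ln (2 / \<eta>) / \<kappa>" using \<kappa> by (simp add: pos_le_divide_eq)
      then have "real b * noncol V D \<le> 2 * ln (2 / \<eta>) / \<kappa>" by (simp add: s_def mult.commute)
      then show ?thesis by (simp add: C_def)
    qed
  qed
qed

section \<open>Decoupling and the degrees of typical vertices\<close>

lemma avg_swap: "avg V (\<lambda>x. avg W (\<lambda>y. f x y)) = avg W (\<lambda>y. avg V (\<lambda>x. f x y))"
  by (simp add: avg_def sum_divide_distrib[symmetric] sum.swap[of _ W V] mult.commute)

lemma avg_le_const: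
  assumes "finite V" "V \<noteq> {}" "\<And>x. x \<in> V \<Longrightarrow> f x \<le> c"
  shows "avg V f \<le> c"
  using avg_mono[of V f "\<lambda>_. c"] assms by (simp add: avg_const)

lemma avg_ge_const:
  assumes "finite V" "V \<noteq> {}" "\<And>x. x \<in> V \<Longrightarrow> c \<le> f x"
  shows "c \<le> avg V f"
  using avg_mono[of V "\<lambda>_. c" f] assms by (simp add: avg_const)

lemma exists_le_avg:
  assumes "finite V" "V \<noteq> {}"
  obtains y where "y \<in> V" "f y \<le> avg V f"
proof -
  have "\<exists>y\<in>V. f y \<le> avg V f"
  proof (rule ccontr)
    assume "\<not> ?thesis"
    then have "(\<Sum>y\<in>V. avg V f) < (\<Sum>y\<in>V. f y)"
      using assms by (intro sum_strict_mono) auto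
    then show False using assms by (simp add: avg_def)
  qed
  then show ?thesis using that by blast
qed

lemma noncol_nonneg: "0 \<le> noncol V D"
  unfolding noncol_def by (intro avg_nonneg) auto

lemma noncol_mode:
  assumes "finite V" "V \<noteq> {}"
  obtains c where "c \<in> D ` V" "avg V (\<lambda>x. of_bool (D x \<noteq> c)) \<le> noncol V D"
proof -
  obtain y where "y \<in> V" "avg V (\<lambda>z. of_bool (D y \<noteq> D z)) \<le> noncol V D"
    unfolding noncol_def using exists_le_avg[OF assms, of "\<lambda>y. avg V (\<lambda>z. of_bool (D y \<noteq> D z))"] by blast
  then show ?thesis using that[of "D y"] by (simp add: eq_commute)
qed

lemma lavg_le_const:
  assumes "finite V" "V \<noteq> {}" "\<And>xs. set xs \<subseteq> V \<Longrightarrow> length xs = k \<Longrightarrow> F xs \<le> c"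
  shows "lavg V k F \<le> c"
  using lavg_mono[of V k F "\<lambda>_. c"] assms by (simp add: lavg_const)

text \<open>By Cauchy-Schwarz over \<open>ys\<close>, two independent choices \<open>xs\<close>,
  \<open>xs'\<close> solve the equation for the same \<open>ys\<close> with probability at least
  \<open>\<eta> ^ 2\<close>. Subtracting the two equations cancels \<open>X2\<close>, and
  \<open>X1\<close> only shifts the target. What remains prescribes the value of a sum of
  independent terms \<open>g xs y - g xs' y\<close>, to which \<open>small_ball\<close> applies at
  level \<open>\<eta> ^ 2 / 2\<close>; the other half of \<open>\<eta> ^ 2\<close> pays for the
  pairs where it fails. In the applications \<open>X1\<close> and \<open>X2\<close> hold the edges
  inside the two parts of the sample.\<close>

lemma decoupling:
  assumes \<eta>: "\<eta> > 0"
  obtains C :: real where "C > 0"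
    "\<And>(V :: 'a set) a b (X1 :: 'a list \<Rightarrow> int) X2 g c. finite V \<Longrightarrow> V \<noteq> {} \<Longrightarrow>
       \<eta> \<le> lavg V a (\<lambda>xs. lavg V b (\<lambda>ys. of_bool (X1 xs + (\<Sum>y\<leftarrow>ys. g xs y) + X2 ys = c))) \<Longrightarrow>
       \<eta>\<^sup>2 / 2 \<le> lavg V a (\<lambda>xs. lavg V a (\<lambda>xs'. of_bool (real b * noncol V (\<lambda>y. g xs y - g xs' y) \<le> C)))"
proof -
  have "\<eta>\<^sup>2 / 2 > 0" using \<eta> by simp
  then obtain C :: real where C: "C > 0"
    and ball: "\<And>(V :: 'a set) D b c. finite V \<Longrightarrow> V \<noteq> {} \<Longrightarrow>
       \<eta>\<^sup>2 / 2 \<le> lavg V b (\<lambda>ys. of_bool ((\<Sum>y\<leftarrow>ys. D y) = c)) \<Longrightarrow> real b * noncol V D \<le> C"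
    using small_ball by metis
  show ?thesis
  proof (rule that[OF C])
    fix V :: "'a set" and a b c and X1 X2 :: "'a list \<Rightarrow> int" and g
    assume V: "finite V" "V \<noteq> {}"
    define I where "I xs ys = (of_bool (X1 xs + (\<Sum>y\<leftarrow>ys. g xs y) + X2 ys = c) :: real)" for xs ys
    assume "\<eta> \<le> lavg V a (\<lambda>xs. lavg V b (\<lambda>ys. of_bool (X1 xs + (\<Sum>y\<leftarrow>ys. g xs y) + X2 ys = c)))"
    then have "\<eta> \<le> lavg V b (\<lambda>ys. lavg V a (\<lambda>xs. I xs ys))"
      unfolding I_def by (subst lavg_swap)
    then have "\<eta>\<^sup>2 \<le> (lavg V b (\<lambda>ys. lavg V a (\<lambda>xs. I xs ys)))\<^sup>2"
      using \<eta> by (intro power_mono) auto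
    also have "\<dots> \<le> lavg V b (\<lambda>ys. (lavg V a (\<lambda>xs. I xs ys))\<^sup>2)"
      by (rule lavg_square_ge[OF V])
    also have "\<dots> = lavg V b (\<lambda>ys. lavg V a (\<lambda>xs. lavg V a (\<lambda>xs'. I xs ys * I xs' ys)))"
    proof -
      have "(lavg V a (\<lambda>xs. I xs ys))\<^sup>2 = lavg V a (\<lambda>xs. lavg V a (\<lambda>xs'. I xs ys * I xs' ys))" for ys
        by (simp add: lavg_cmult power2_eq_square mult.commute[of "I _ ys" "lavg V a _"])
      then show ?thesis by simp
    qed
    also have "\<dots> = lavg V a (\<lambda>xs. lavg V b (\<lambda>ys. lavg V a (\<lambda>xs'. I xs ys * I xs' ys)))"
      by (rule lavg_swap)
    also have "\<dots> = lavg V a (\<lambda>xs. lavg V a (\<lambda>xs'. lavg V b (\<lambda>ys. I xs ys * I xs' ys)))"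
      by (subst lavg_swap) (rule refl)
    also have "\<dots> \<le> lavg V a (\<lambda>xs. lavg V a (\<lambda>xs'.
      of_bool (real b * noncol V (\<lambda>y. g xs y - g xs' y) \<le> C) + \<eta>\<^sup>2 / 2))"
    proof (intro lavg_mono)
      fix xs xs' :: "'a list"
      define c' where "c' = X1 xs' - X1 xs"
      have "lavg V b (\<lambda>ys. I xs ys * I xs' ys) \<le> lavg V b (\<lambda>ys. of_bool ((\<Sum>y\<leftarrow>ys. g xs y - g xs' y) = c'))"
        by (rule lavg_mono) (auto simp: I_def sum_list_subtractf c'_def)
      moreover have "\<dots> \<le> 1" by (rule lavg_le_const[OF V]) auto
      moreover have "\<eta>\<^sup>2 / 2 > lavg V b (\<lambda>ys. of_bool ((\<Sum>y\<leftarrow>ys. g xs y - g xs' y) = c'))"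
        if "\<not> real b * noncol V (\<lambda>y. g xs y - g xs' y) \<le> C"
        using ball[OF V, of b "\<lambda>y. g xs y - g xs' y" c'] that by linarith
      ultimately show "lavg V b (\<lambda>ys. I xs ys * I xs' ys) \<le>
        of_bool (real b * noncol V (\<lambda>y. g xs y - g xs' y) \<le> C) + \<eta>\<^sup>2 / 2"
        using \<open>\<eta>\<^sup>2 / 2 > 0\<close> unfolding of_bool_def by (split if_split) linarith
    qed
    finally show "\<eta>\<^sup>2 / 2 \<le> lavg V a (\<lambda>xs. lavg V a (\<lambda>xs'. of_bool (real b * noncol V (\<lambda>y. g xs y - g xs' y) \<le> C)))"
      using V by (simp add: lavg_add lavg_const)
  qed
qed

section \<open>Degrees and edge counts of sampled lists\<close>

definition ldeg :: "('a \<Rightarrow> 'a \<Rightarrow> bool) \<Rightarrow> 'a list \<Rightarrow> 'a \<Rightarrow> int" where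
  "ldeg r xs y = (\<Sum>x\<leftarrow>xs. of_bool (r y x))"

text \<open>Edges are counted over pairs of positions, so a repeated vertex counts repeatedly; this
  makes the count split exactly under concatenation. For distinct lists it is the induced edge
  count, see \<open>ecount_eq_induced_edges\<close>. The values are integers because differences of
  degrees are taken.\<close>

primrec ecount :: "('a \<Rightarrow> 'a \<Rightarrow> bool) \<Rightarrow> 'a list \<Rightarrow> int" where
  "ecount r [] = 0"
| "ecount r (x # xs) = ldeg r xs x + ecount r xs"

lemma ldeg_Nil [simp]: "ldeg r [] y = 0"
  by (simp add: ldeg_def)

lemma ldeg_Cons [simp]: "ldeg r (x # xs) y = of_bool (r y x) + ldeg r xs y"
  by (simp add: ldeg_def)

lemma ldeg_append [simp]: "ldeg r (xs @ ys) y = ldeg r xs y + ldeg r ys y"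
  by (simp add: ldeg_def)

lemma ldeg_nonneg: "0 \<le> ldeg r xs y"
  by (induction xs) auto

lemma ecount_nonneg: "0 \<le> ecount r xs"
  by (induction xs) (auto simp: ldeg_nonneg)

lemma ecount_append:
  assumes "symp r"
  shows "ecount r (xs @ ys) = ecount r xs + (\<Sum>y\<leftarrow>ys. ldeg r xs y) + ecount r ys"
proof (induction xs)
  case (Cons x xs)
  have "ldeg r ys x = (\<Sum>y\<leftarrow>ys. of_bool (r y x))"
    unfolding ldeg_def by (intro arg_cong[of _ _ sum_list] map_cong refl arg_cong[of _ _ of_bool])
      (use assms in \<open>auto dest: sympD\<close>)
  then show ?case using Cons by (simp add: sum_list_addf)
qed simp

definition ndeg :: "('a \<Rightarrow> 'a \<Rightarrow> bool) \<Rightarrow> 'a set \<Rightarrow> 'a \<Rightarrow> real" where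
  "ndeg r V y = avg V (\<lambda>x. of_bool (r y x))"

lemma ndeg_nonneg: "0 \<le> ndeg r V y"
  unfolding ndeg_def by (intro avg_nonneg) auto

lemma ndeg_le_one:
  assumes "finite V" "V \<noteq> {}"
  shows "ndeg r V y \<le> 1"
  unfolding ndeg_def by (rule avg_le_const[OF assms]) auto

text \<open>A denser graph would have too many edges between the two halves of the sample. If the
  density exceeds \<open>1/100\<close>, at least \<open>1/200\<close> of the vertices have degree at
  least \<open>1/200\<close>. By the lower tail bound most of these have more than
  \<open>a / 400\<close> neighbours in the first half, and then the second half contains more than
  \<open>b / 800\<close> such vertices.\<close>

lemma avg_ndeg_le:
  fixes r :: "'a \<Rightarrow> 'a \<Rightarrow> bool"
  assumes V: "finite V" "V \<noteq> {}" and r: "symp r" and k: "k \<ge> 2"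
    and l: "real_of_int l \<le> (real k)\<^sup>2 / 2000000"
    and P: "1000000 / real k < lavg V k (\<lambda>xs. of_bool (ecount r xs = l))"
  shows "avg V (ndeg r V) \<le> 1 / 100"
proof (rule ccontr)
  assume "\<not> ?thesis"
  then have p: "avg V (ndeg r V) > 1 / 100" by simp
  define a where "a = k div 2"
  define b where "b = k - a"
  have kab: "k = a + b" by (simp add: a_def b_def)
  have "k \<le> 3 * a" using k unfolding a_def by presburger
  then have "real k \<le> real (3 * a)" by (rule of_nat_mono)
  then have a: "real a \<ge> real k / 3" "a > 0" using k by auto
  have b: "real b \<ge> real k / 2" "b > 0" using k by (auto simp: a_def b_def)
  define Z where "Z = {y. ndeg r V y \<ge> 1 / 200}"
  have "avg V (ndeg r V) \<le> avg V (\<lambda>y. of_bool (y \<in> Z) + 1 / 200)"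
  proof (rule avg_mono)
    fix y show "ndeg r V y \<le> of_bool (y \<in> Z) + 1 / 200"
      using ndeg_le_one[OF V, of r y] by (cases "y \<in> Z") (auto simp: Z_def)
  qed
  then have Z: "avg V (\<lambda>y. of_bool (y \<in> Z)) \<ge> 1 / 200"
    using p V by (simp add: avg_add avg_const)
  define G where "G xs = avg V (\<lambda>y. of_bool (y \<in> Z \<and> real_of_int (ldeg r xs y) \<le> real a / 400))" for xs
  have real_ldeg: "real_of_int (ldeg r xs y) = (\<Sum>x\<leftarrow>xs. of_bool (r y x))" for xs y
    by (induction xs) auto
  have G0: "0 \<le> G xs" for xs unfolding G_def by (intro avg_nonneg) auto
  have "lavg V a G = avg V (\<lambda>y. lavg V a (\<lambda>xs. of_bool (y \<in> Z \<and> real_of_int (ldeg r xs y) \<le> real a / 400)))"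
    unfolding G_def by (rule lavg_avg)
  also have "\<dots> \<le> 800 / real a"
  proof (rule avg_le_const[OF V])
    fix y assume "y \<in> V"
    show "lavg V a (\<lambda>xs. of_bool (y \<in> Z \<and> real_of_int (ldeg r xs y) \<le> real a / 400)) \<le> 800 / real a"
    proof (cases "y \<in> Z")
      case True
      then have nd: "ndeg r V y \<ge> 1 / 200" by (simp add: Z_def)
      have "lavg V a (\<lambda>xs. of_bool (y \<in> Z \<and> real_of_int (ldeg r xs y) \<le> real a / 400)) \<le>
        lavg V a (\<lambda>xs. of_bool ((\<Sum>x\<leftarrow>xs. of_bool (r y x)) \<le> real a * avg V (\<lambda>x. of_bool (r y x)) / 2))"
      proof (rule lavg_mono)
        fix xs
        have "real a * (1 / 200) \<le> real a * ndeg r V y" using nd by (intro mult_left_mono) auto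
        then show "of_bool (y \<in> Z \<and> real_of_int (ldeg r xs y) \<le> real a / 400)
          \<le> (of_bool ((\<Sum>x\<leftarrow>xs. of_bool (r y x)) \<le> real a * avg V (\<lambda>x. of_bool (r y x)) / 2) :: real)"
          unfolding ndeg_def[symmetric] real_ldeg[symmetric] by auto
      qed
      also have "\<dots> \<le> 4 * 1 / (real a * avg V (\<lambda>x. of_bool (r y x)))"
        by (rule lavg_sum_list_lower_tail[OF V]) (use nd a in \<open>auto simp: ndeg_def\<close>)
      also have "\<dots> \<le> 4 * 1 / (real a * (1 / 200))"
        unfolding ndeg_def[symmetric] using nd a by (intro divide_left_mono mult_left_mono mult_pos_pos) auto
      finally show ?thesis by simp
    next
      case False
      then show ?thesis by (simp add: lavg_const[OF V])
    qed
  qed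
  finally have EG: "lavg V a G \<le> 800 / real a" .
  have inner: "lavg V b (\<lambda>ys. of_bool (ecount r (xs @ ys) = l)) \<le> of_bool (G xs \<ge> 1 / 400) + 1600 / real b" for xs
  proof (cases "G xs \<ge> 1 / 400")
    case True
    have "lavg V b (\<lambda>ys. of_bool (ecount r (xs @ ys) = l)) \<le> 1" by (rule lavg_le_const[OF V]) auto
    then show ?thesis using True b by (simp add: add_increasing2)
  next
    case False
    define g where "g y = (of_bool (real_of_int (ldeg r xs y) > real a / 400) :: real)" for y
    have "avg V (\<lambda>y. of_bool (y \<in> Z)) \<le> avg V (\<lambda>y. of_bool (y \<in> Z \<and> real_of_int (ldeg r xs y) \<le> real a / 400) + g y)"
      by (rule avg_mono) (auto simp: g_def)
    then have W: "avg V g \<ge> 1 / 400" using Z False by (simp add: avg_add G_def)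
    have "lavg V b (\<lambda>ys. of_bool (ecount r (xs @ ys) = l)) \<le> lavg V b (\<lambda>ys. of_bool ((\<Sum>y\<leftarrow>ys. g y) \<le> real b * avg V g / 2))"
    proof (rule lavg_mono)
      fix ys
      have le: "real a / 400 * (\<Sum>y\<leftarrow>ys. g y) \<le> real_of_int (\<Sum>y\<leftarrow>ys. ldeg r xs y)"
      proof (induction ys)
        case (Cons y ys)
        have "real a / 400 * g y \<le> real_of_int (ldeg r xs y)"
          using ldeg_nonneg[of r xs y] by (auto simp: g_def)
        then show ?case using Cons by (simp add: distrib_left)
      qed simp
      have "(\<Sum>y\<leftarrow>ys. g y) \<le> real b * avg V g / 2" if "ecount r (xs @ ys) = l"
      proof (rule ccontr)
        assume "\<not> (\<Sum>y\<leftarrow>ys. g y) \<le> real b * avg V g / 2"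
        moreover have "real b * (1 / 400) \<le> real b * avg V g" using W by (intro mult_left_mono) auto
        ultimately have "(\<Sum>y\<leftarrow>ys. g y) > real b / 800" by simp
        then have "real a / 400 * (real b / 800) < real a / 400 * (\<Sum>y\<leftarrow>ys. g y)"
          using a by (intro mult_strict_left_mono) auto
        also have "\<dots> \<le> real_of_int l"
          using le that ecount_append[OF r, of xs ys] ecount_nonneg[of r xs] ecount_nonneg[of r ys] by linarith
        also have "\<dots> \<le> (real k)\<^sup>2 / 2000000" by (rule l)
        \<comment> \<open>Here \<open>400 * 800 / 2000000 = 4/25\<close>, while \<open>a * b\<close>
          is at least \<open>k ^ 2 / 6\<close>. The constant 2000000 only has to exceed
          \<open>6 * 400 * 800\<close>.\<close>
        finally have "real a * real b < (real k)\<^sup>2 * (4/25)" by simp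
        moreover have "(real k / 3) * (real k / 2) \<le> real a * real b"
          using a b by (intro mult_mono) auto
        moreover have "real k * real k > 0" using k by simp
        ultimately show False unfolding power2_eq_square by simp
      qed
      then show "of_bool (ecount r (xs @ ys) = l) \<le> (of_bool ((\<Sum>y\<leftarrow>ys. g y) \<le> real b * avg V g / 2) :: real)"
        by auto
    qed
    also have "\<dots> \<le> 4 * 1 / (real b * avg V g)"
    proof (rule lavg_sum_list_lower_tail[OF V])
      show "0 < avg V g" using W by linarith
    qed (use b in \<open>auto simp: g_def\<close>)
    also have "\<dots> \<le> 4 * 1 / (real b * (1 / 400))"
      using W b by (intro divide_left_mono mult_left_mono mult_pos_pos) auto
    finally show ?thesis using False by simp
  qed
  have "lavg V k (\<lambda>xs. of_bool (ecount r xs = l)) = lavg V a (\<lambda>xs. lavg V b (\<lambda>ys. of_bool (ecount r (xs @ ys) = l)))"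
    unfolding kab by (rule lavg_append)
  also have "\<dots> \<le> lavg V a (\<lambda>xs. of_bool (G xs \<ge> 1 / 400) + 1600 / real b)"
    by (intro lavg_mono inner)
  also have "\<dots> \<le> lavg V a G / (1 / 400) + 1600 / real b"
    using lavg_markov[of "1/400" V a G] G0 V by (simp add: lavg_add lavg_const)
  also have "\<dots> \<le> (800 / real a) / (1 / 400) + 1600 / real b"
    using EG by (intro add_right_mono divide_right_mono) auto
  also have "\<dots> \<le> (800 / (real k / 3)) / (1 / 400) + 1600 / (real k / 2)"
    using a b k by (intro add_mono divide_right_mono divide_left_mono) auto
  \<comment> \<open>The left-hand side equals \<open>963200 / k\<close>, from
    \<open>3 * 800 * 400 + 2 * 1600\<close>.\<close>
  also have "\<dots> \<le> 1000000 / real k" using k by (simp add: field_simps)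
  finally show False using P by simp
qed


text \<open>The small ball inequality is used twice. Through decoupling, the degree difference of
  two first halves is almost constant on \<open>V\<close> with positive probability. For fixed
  \<open>y\<close>, \<open>z\<close> it is then applied to the first half: agreement at
  \<open>y\<close> and \<open>z\<close> is unlikely unless the neighbourhoods of \<open>y\<close>
  and \<open>z\<close> are related in a trivial way. So almost all vertices have nearly the
  neighbourhood of one typical vertex \<open>y0\<close>, and double counting shows that such a
  common neighbourhood must be small.\<close>

lemma hubs_rare:
  assumes \<eta>: "\<eta> > 0"
  obtains K :: real where "K \<ge> 1"
    "\<And>(V :: 'a set) r k l. finite V \<Longrightarrow> V \<noteq> {} \<Longrightarrow> symp r \<Longrightarrow> K \<le> real k \<Longrightarrow>
       avg V (ndeg r V) \<le> 1 / 100 \<Longrightarrow> \<eta> \<le> lavg V k (\<lambda>xs. of_bool (ecount r xs = l)) \<Longrightarrow>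
       avg V (\<lambda>z. of_bool (ndeg r V z > K / real k)) \<le> K / real k"
proof (rule decoupling[OF \<eta>, where 'a = 'a], goal_cases)
  case (1 C1)
  note C1 = 1(2) and dec = 1(3)
  \<comment> \<open>A bad pair agrees with probability at most \<open>\<eta> ^ 2 / 16\<close>,
    whereas near constancy has probability at least \<open>\<eta> ^ 2 / 2\<close>. This ratio lets
    \<open>\<beta>\<close> be absorbed: \<open>(\<beta> - c) / 2 <= \<beta> / 16\<close> implies
    \<open>\<beta> <= 2 * c\<close>.\<close>
  define \<eta>' where "\<eta>' = \<eta>\<^sup>2 / 16"
  have \<eta>': "\<eta>' > 0" using \<eta> by (simp add: \<eta>'_def)
  obtain C2 :: real where C2: "C2 > 0"
    and ball: "\<And>(V :: 'a set) D b c. finite V \<Longrightarrow> V \<noteq> {} \<Longrightarrow>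
       \<eta>' \<le> lavg V b (\<lambda>ys. of_bool ((\<Sum>y\<leftarrow>ys. D y) = c)) \<Longrightarrow> real b * noncol V D \<le> C2"
    using small_ball[OF \<eta>'] by metis
  define B where "B = 4 * C1"
  define K0 where "K0 = 3 * C2"
  define M where "M = 4 * (K0 + B)"
  define K where "K = 2 + 8 * B + 8 * K0 + 2 * (M + K0)"
  have pos: "B > 0" "K0 > 0" "M > 0" using C1 C2 by (auto simp: B_def K0_def M_def)
  show ?thesis
  proof (rule that[of K])
    show "K \<ge> 1" using pos by (simp add: K_def)
    fix V :: "'a set" and r and k :: nat and l :: int
    assume V: "finite V" "V \<noteq> {}" and r: "symp r" and kK: "K \<le> real k"
      and p: "avg V (ndeg r V) \<le> 1 / 100"
      and P: "\<eta> \<le> lavg V k (\<lambda>xs. of_bool (ecount r xs = l))"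
    have k2: "k \<ge> 2" using kK pos by (simp add: K_def)
    then have k0: "real k > 0" by simp
    define a where "a = k div 2"
    define b where "b = k - a"
    have kab: "k = a + b" by (simp add: a_def b_def)
    have "k \<le> 3 * a" using k2 unfolding a_def by presburger
    then have "real k \<le> real (3 * a)" by (rule of_nat_mono)
    then have a: "real a \<ge> real k / 3" "a > 0" using k2 by auto
    have b: "real b \<ge> real k / 2" "b > 0" using k2 by (auto simp: a_def b_def)
    define D where "D xs xs' y = ldeg r xs y - ldeg r xs' y" for xs xs' y
    define u where "u y z x = (of_bool (r y x) - of_bool (r z x) :: int)" for y z x
    \<comment> \<open>For a bad pair, \<open>D xs xs'\<close> rarely agrees at \<open>y\<close> and \<open>z\<close>, so bad pairs are rare. For any other
    pair, \<open>u y z\<close> is almost constant, so the neighbourhoods of \<open>y\<close> and \<open>z\<close> almost coincide or one of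
    them is almost empty and the other one almost everything.\<close>
    define bad where "bad y z \<longleftrightarrow> real a * noncol V (u y z) > C2" for y z
    define \<beta> where "\<beta> = avg V (\<lambda>y. avg V (\<lambda>z. of_bool (bad y z)))"
    have dcp: "\<eta>\<^sup>2 / 2 \<le> lavg V a (\<lambda>xs. lavg V a (\<lambda>xs'. of_bool (real b * noncol V (D xs xs') \<le> C1)))"
      unfolding D_def
    proof (rule dec[OF V])
      show "\<eta> \<le> lavg V a (\<lambda>xs. lavg V b (\<lambda>ys. of_bool (ecount r xs + (\<Sum>y\<leftarrow>ys. ldeg r xs y) + ecount r ys = l)))"
        using P unfolding kab lavg_append ecount_append[OF r] .
    qed
    have agree: "lavg V a (\<lambda>xs. lavg V a (\<lambda>xs'. of_bool (D xs xs' y = D xs xs' z))) \<le> \<eta>'" if "bad y z" for y z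
    proof -
      have "lavg V a (\<lambda>xs. of_bool (D xs xs' y = D xs xs' z)) \<le> \<eta>'" for xs'
      proof -
        define c where "c = ldeg r xs' y - ldeg r xs' z"
        have uy: "(\<Sum>x\<leftarrow>xs. u y z x) = ldeg r xs y - ldeg r xs z" for xs
          by (simp add: u_def ldeg_def sum_list_subtractf)
        have "lavg V a (\<lambda>xs. of_bool (D xs xs' y = D xs xs' z)) = lavg V a (\<lambda>xs. of_bool ((\<Sum>x\<leftarrow>xs. u y z x) = c))"
          unfolding uy by (rule lavg_cong) (auto simp: D_def c_def)
        then show ?thesis
          using ball[OF V, of a "u y z" c] that unfolding bad_def by linarith
      qed
      then have "lavg V a (\<lambda>xs'. lavg V a (\<lambda>xs. of_bool (D xs xs' y = D xs xs' z))) \<le> \<eta>'"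
        by (rule lavg_le_const[OF V])
      then show ?thesis by (subst lavg_swap)
    qed
    define G where "G xs xs' = avg V (\<lambda>y. avg V (\<lambda>z. of_bool (bad y z \<and> D xs xs' y = D xs xs' z)))" for xs xs'
    have "lavg V a (\<lambda>xs. lavg V a (\<lambda>xs'. G xs xs')) =
        avg V (\<lambda>y. avg V (\<lambda>z. lavg V a (\<lambda>xs. lavg V a (\<lambda>xs'. of_bool (bad y z \<and> D xs xs' y = D xs xs' z)))))"
      unfolding G_def by (simp only: lavg_avg)
    also have "\<dots> \<le> avg V (\<lambda>y. avg V (\<lambda>z. \<eta>' * of_bool (bad y z)))"
    proof (intro avg_mono)
      fix y z
      show "lavg V a (\<lambda>xs. lavg V a (\<lambda>xs'. of_bool (bad y z \<and> D xs xs' y = D xs xs' z))) \<le> \<eta>' * of_bool (bad y z)"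
        using agree[of y z] by (cases "bad y z") (auto simp: lavg_const[OF V])
    qed
    also have "\<dots> = \<eta>' * \<beta>" by (simp add: avg_cmult \<beta>_def)
    finally have EG: "lavg V a (\<lambda>xs. lavg V a (\<lambda>xs'. G xs xs')) \<le> \<eta>' * \<beta>" .
    \<comment> \<open>If \<open>D xs xs'\<close> is almost constant, the pairs where it differs have
      measure at most \<open>C1 / b\<close>, so almost all bad pairs must agree.\<close>
    have pw: "(\<beta> - C1 / real b) * of_bool (real b * noncol V (D xs xs') \<le> C1) \<le> G xs xs'" for xs xs'
    proof (cases "real b * noncol V (D xs xs') \<le> C1")
      case True
      have "\<beta> \<le> avg V (\<lambda>y. avg V (\<lambda>z. of_bool (bad y z \<and> D xs xs' y = D xs xs' z) + of_bool (D xs xs' y \<noteq> D xs xs' z)))"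
        unfolding \<beta>_def by (intro avg_mono) auto
      also have "\<dots> = G xs xs' + noncol V (D xs xs')"
        by (simp add: G_def noncol_def avg_add)
      also have "noncol V (D xs xs') \<le> C1 / real b" using True b by (simp add: field_simps)
      finally show ?thesis using True by simp
    next
      case False
      have "0 \<le> G xs xs'" unfolding G_def by (intro avg_nonneg) auto
      then show ?thesis using False by simp
    qed
    have \<beta>: "\<beta> \<le> B / real k"
    proof (cases "\<beta> \<le> C1 / real b")
      case True
      also have "C1 / real b \<le> C1 / (real k / 2)" using b k0 C1 by (intro divide_left_mono) auto
      also have "\<dots> \<le> B / real k" using k0 C1 by (simp add: B_def field_simps)
      finally show ?thesis .
    next
      case False
      have "(\<beta> - C1 / real b) * (\<eta>\<^sup>2 / 2) \<le>
        (\<beta> - C1 / real b) * lavg V a (\<lambda>xs. lavg V a (\<lambda>xs'. of_bool (real b * noncol V (D xs xs') \<le> C1)))"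
        using dcp False by (intro mult_left_mono) auto
      also have "\<dots> = lavg V a (\<lambda>xs. lavg V a (\<lambda>xs'. (\<beta> - C1 / real b) * of_bool (real b * noncol V (D xs xs') \<le> C1)))"
        by (simp only: lavg_cmult)
      also have "\<dots> \<le> lavg V a (\<lambda>xs. lavg V a (\<lambda>xs'. G xs xs'))"
        by (intro lavg_mono pw)
      also note EG
      finally have "\<eta>\<^sup>2 * ((\<beta> - C1 / real b) / 2) \<le> \<eta>\<^sup>2 * (\<beta> / 16)" by (simp add: \<eta>'_def mult_ac)
      moreover have "0 < \<eta>\<^sup>2" using \<eta> by simp
      ultimately have "(\<beta> - C1 / real b) / 2 \<le> \<beta> / 16" by (rule mult_left_le_imp_le)
      moreover have "\<beta> \<le> 2 * c" if "(\<beta> - c) / 2 \<le> \<beta> / 16" "c > 0" for c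
        using that by simp
      moreover have "C1 / real b > 0" using C1 b by simp
      ultimately have "\<beta> \<le> 2 * (C1 / real b)" by blast
      also have "\<dots> \<le> 2 * (C1 / (real k / 2))" using b k0 C1 by (intro mult_left_mono divide_left_mono) auto
      also have "\<dots> = B / real k" using k0 by (simp add: B_def)
      finally show ?thesis .
    qed
    define \<kappa> where "\<kappa> = K0 / real k"
    have small: "\<kappa> \<le> 1/8" "B / real k \<le> 1/8" "0 < \<kappa>" "0 < B / real k"
      using kK k0 pos by (auto simp: \<kappa>_def K_def field_simps)
    have B2: "2 * B / real k = 2 * (B / real k)" by simp
    then have small': "2 * B / real k \<le> 1/4" using small(2) by linarith
    have notbad: "noncol V (u y z) \<le> \<kappa>" if "\<not> bad y z" for y z
    proof -
      have "(real k / 3) * noncol V (u y z) \<le> real a * noncol V (u y z)"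
        using a noncol_nonneg[of V "u y z"] by (intro mult_right_mono) auto
      also have "\<dots> \<le> C2" using that by (simp add: bad_def)
      finally show ?thesis using k0 by (simp add: \<kappa>_def K0_def field_simps)
    qed
    \<comment> \<open>Both requirements are put into one weighted sum whose mean is at most
      \<open>4/100 + 1/2 <= 1\<close>, so a single averaging argument satisfies them
      together.\<close>
    obtain y0 where y0: "ndeg r V y0 \<le> 1/4" "avg V (\<lambda>z. of_bool (bad y0 z)) \<le> 2 * B / real k"
    proof -
      obtain y where y: "4 * ndeg r V y + real k / (2 * B) * avg V (\<lambda>z. of_bool (bad y z)) \<le>
          avg V (\<lambda>y. 4 * ndeg r V y + real k / (2 * B) * avg V (\<lambda>z. of_bool (bad y z)))"
        using exists_le_avg[OF V, of "\<lambda>y. 4 * ndeg r V y + real k / (2 * B) * avg V (\<lambda>z. of_bool (bad y z))"] by blast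
      also have "\<dots> = 4 * avg V (ndeg r V) + real k / (2 * B) * \<beta>"
        by (simp only: avg_add avg_cmult \<beta>_def)
      also have "\<dots> \<le> 4 * (1/100) + real k / (2 * B) * (B / real k)"
        using p \<beta> pos k0 by (intro add_mono mult_left_mono) auto
      also have "\<dots> \<le> 1" using pos k0 by simp
      finally have s: "4 * ndeg r V y + real k / (2 * B) * avg V (\<lambda>z. of_bool (bad y z)) \<le> 1" .
      have nn: "0 \<le> avg V (\<lambda>z. of_bool (bad y z))" by (intro avg_nonneg) auto
      then have nn2: "0 \<le> real k / (2 * B) * avg V (\<lambda>z. of_bool (bad y z))" using pos by simp
      show ?thesis
      proof (rule that)
        show "ndeg r V y \<le> 1/4" using s nn2 by simp
        have "real k / (2 * B) * avg V (\<lambda>z. of_bool (bad y z)) \<le> 1" using s ndeg_nonneg[of r V y] by linarith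
        then show "avg V (\<lambda>z. of_bool (bad y z)) \<le> 2 * B / real k" using pos k0 by (simp add: field_simps)
      qed
    qed
    define n0 where "n0 = ndeg r V y0"
    define close where "close z \<longleftrightarrow> avg V (\<lambda>x. of_bool (r y0 x \<noteq> r z x)) \<le> \<kappa>" for z
    define far where "far z \<longleftrightarrow> n0 \<le> \<kappa> \<and> ndeg r V z \<ge> 1 - \<kappa>" for z
    have one: "avg V (\<lambda>x. 1) = 1" by (rule avg_const[OF V])
    \<comment> \<open>\<open>u y0 z\<close> takes the values 0, 1 and -1 only. A dominating 0 makes
      \<open>z\<close> close and a dominating -1 makes it far; a dominating 1 would give
      \<open>y0\<close> degree at least \<open>1 - \<kappa>\<close>, against the choice of
      \<open>y0\<close>.\<close>
    have trichotomy: "bad y0 z \<or> close z \<or> far z" for z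
    proof (rule ccontr)
      assume neg: "\<not> ?thesis"
      obtain c where c: "c \<in> u y0 z ` V" "avg V (\<lambda>x. of_bool (u y0 z x \<noteq> c)) \<le> noncol V (u y0 z)"
        using noncol_mode[OF V] by blast
      then have le: "avg V (\<lambda>x. of_bool (u y0 z x \<noteq> c)) \<le> \<kappa>" using notbad neg by force
      consider "c = 0" | "c = 1" | "c = -1" using c(1) by (auto simp: u_def of_bool_def split: if_splits)
      then show False
      proof cases
        case 1
        have "avg V (\<lambda>x. of_bool (r y0 x \<noteq> r z x)) = avg V (\<lambda>x. of_bool (u y0 z x \<noteq> c))"
          by (rule avg_cong) (auto simp: u_def 1)
        then show False using le neg by (simp add: close_def)
      next
        case 2
        have "1 \<le> avg V (\<lambda>x. of_bool (r y0 x) + of_bool (u y0 z x \<noteq> c))"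
          by (rule avg_ge_const[OF V]) (auto simp: u_def 2)
        then show False using le y0 small by (simp add: avg_add ndeg_def)
      next
        case 3
        have "avg V (\<lambda>x. of_bool (r y0 x)) \<le> avg V (\<lambda>x. of_bool (u y0 z x \<noteq> c))"
          by (rule avg_mono) (auto simp: u_def 3)
        then have "n0 \<le> \<kappa>" using le by (simp add: n0_def ndeg_def)
        moreover have "1 \<le> avg V (\<lambda>x. of_bool (r z x) + of_bool (u y0 z x \<noteq> c))"
          by (rule avg_ge_const[OF V]) (auto simp: u_def 3)
        then have "1 - \<kappa> \<le> ndeg r V z" using le by (simp add: avg_add ndeg_def)
        ultimately show False using neg by (simp add: far_def)
      qed
    qed
    have close_deg: "ndeg r V z \<le> n0 + \<kappa>" if "close z" for z
    proof -
      have "ndeg r V z \<le> avg V (\<lambda>x. of_bool (r y0 x) + of_bool (r y0 x \<noteq> r z x))"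
        unfolding ndeg_def by (rule avg_mono) auto
      then show ?thesis using that by (simp add: avg_add n0_def ndeg_def close_def)
    qed
    have n0: "n0 \<le> M / real k"
    proof (cases "n0 \<le> \<kappa>")
      case True
      have "\<kappa> \<le> M / real k" unfolding \<kappa>_def M_def using pos by (intro divide_right_mono) auto
      then show ?thesis using True by simp
    next
      case False
      have cl: "bad y0 z \<or> close z" for z using trichotomy[of z] False by (auto simp: far_def)
      \<comment> \<open>\<open>J\<close> is the measure of pairs of a neighbour \<open>z\<close> of
        \<open>y0\<close> and a non-neighbour \<open>y\<close> of \<open>z\<close>. A close
        \<open>y\<close> sees almost all neighbours of \<open>y0\<close>, which bounds
        \<open>J\<close> above by \<open>\<kappa> + n0 / 4\<close>. A close \<open>z\<close> has
        degree at most \<open>1/2\<close>, hence many non-neighbours, which bounds \<open>J\<close>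
        below by about \<open>n0 / 2\<close>. So \<open>n0\<close> is of order
        \<open>\<kappa> + B / k\<close>.\<close>
      define J where "J = avg V (\<lambda>z. of_bool (r y0 z) * (1 - ndeg r V z))"
      have "J = avg V (\<lambda>z. avg V (\<lambda>y. of_bool (r y0 z \<and> \<not> r y z)))"
        unfolding J_def
      proof (rule avg_cong)
        fix z
        have "1 - ndeg r V z = avg V (\<lambda>y. 1 - of_bool (r z y))" by (simp only: avg_diff one ndeg_def)
        also have "\<dots> = avg V (\<lambda>y. of_bool (\<not> r y z))"
          using r by (intro avg_cong) (auto dest: sympD)
        finally show "of_bool (r y0 z) * (1 - ndeg r V z) = avg V (\<lambda>y. of_bool (r y0 z \<and> \<not> r y z))"
          by (auto simp: avg_const[OF V])
      qed
      also have "\<dots> = avg V (\<lambda>y. avg V (\<lambda>z. of_bool (r y0 z \<and> \<not> r y z)))"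
        by (rule avg_swap)
      also have "\<dots> \<le> avg V (\<lambda>y. \<kappa> + n0 * of_bool (bad y0 y))"
      proof (rule avg_mono)
        fix y
        have "avg V (\<lambda>z. of_bool (r y0 z \<and> \<not> r y z)) \<le> n0"
          unfolding n0_def ndeg_def by (rule avg_mono) auto
        moreover have "avg V (\<lambda>z. of_bool (r y0 z \<and> \<not> r y z)) \<le> avg V (\<lambda>x. of_bool (r y0 x \<noteq> r y x))"
          by (rule avg_mono) auto
        ultimately show "avg V (\<lambda>z. of_bool (r y0 z \<and> \<not> r y z)) \<le> \<kappa> + n0 * of_bool (bad y0 y)"
          using cl[of y] small by (auto simp: close_def)
      qed
      also have "\<dots> = \<kappa> + n0 * avg V (\<lambda>y. of_bool (bad y0 y))"
        by (simp add: avg_add avg_cmult avg_const[OF V])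
      also have "\<dots> \<le> \<kappa> + n0 * (2 * B / real k)"
        using y0 ndeg_nonneg[of r V y0] by (intro add_left_mono mult_left_mono) (auto simp: n0_def)
      also have "\<dots> \<le> \<kappa> + n0 * (1/4)"
        using small' ndeg_nonneg[of r V y0] by (intro add_left_mono mult_left_mono) (auto simp: n0_def)
      finally have J: "J \<le> \<kappa> + n0 / 4" by simp
      have "avg V (\<lambda>z. (of_bool (r y0 z) - of_bool (bad y0 z)) * (1/2)) \<le> J"
        unfolding J_def
      proof (rule avg_mono)
        fix z
        have "ndeg r V z \<le> 1/2" if "\<not> bad y0 z"
          using cl[of z] close_deg[of z] that y0 small by (simp add: n0_def)
        then show "(of_bool (r y0 z) - of_bool (bad y0 z)) * (1/2) \<le> of_bool (r y0 z) * (1 - ndeg r V z)"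
          using ndeg_le_one[OF V, of r z] by (cases "bad y0 z") auto
      qed
      also have "avg V (\<lambda>z. (of_bool (r y0 z) - of_bool (bad y0 z)) * (1/2)) =
          1/2 * (n0 - avg V (\<lambda>z. of_bool (bad y0 z)))"
        by (subst mult.commute) (simp only: avg_cmult avg_diff n0_def ndeg_def)
      finally have J': "1/2 * (n0 - avg V (\<lambda>z. of_bool (bad y0 z))) \<le> J" .
      have arith: "n / 4 \<le> q + x" if "1/2 * (n - m) \<le> j" "j \<le> q + n / 4" "m \<le> 2 * x" for n m j q x :: real
        using that by (simp add: field_simps)
      have "n0 / 4 \<le> \<kappa> + B / real k"
        by (rule arith[OF J' J]) (use y0(2) in simp)
      moreover have "M / real k = 4 * (\<kappa> + B / real k)"
        using k0 by (simp add: M_def \<kappa>_def field_simps)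
      ultimately show ?thesis by (simp only: mult.commute[of 4]) simp
    qed
    \<comment> \<open>First the average degree gives the crude bound \<open>1/8\<close>, so that
      close vertices form the majority. Then edges between far and close vertices are counted: a far
      vertex has close neighbours of measure at least \<open>1/2\<close>, but a close one has degree
      at most \<open>n0 + \<kappa>\<close>.\<close>
    define \<phi> where "\<phi> = avg V (\<lambda>z. of_bool (far z))"
    have \<phi>0: "0 \<le> \<phi>" unfolding \<phi>_def by (intro avg_nonneg) auto
    have "avg V (\<lambda>z. 3/4 * of_bool (far z)) \<le> avg V (ndeg r V)"
      by (rule avg_mono) (use small ndeg_nonneg in \<open>auto simp: far_def\<close>)
    then have "3/4 * \<phi> \<le> avg V (ndeg r V)" by (simp only: avg_cmult \<phi>_def)
    then have \<phi>small: "\<phi> \<le> 1/8" using p by simp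
    have covered: "1 \<le> avg V (\<lambda>z. of_bool (close z)) + \<phi> + 2 * B / real k"
    proof -
      have "1 \<le> avg V (\<lambda>z. of_bool (close z) + of_bool (far z) + of_bool (bad y0 z))"
        by (rule avg_ge_const[OF V]) (use trichotomy in auto)
      then show ?thesis using y0(2) by (simp add: avg_add \<phi>_def)
    qed
    have "\<phi> * (1/2) \<le> avg V (\<lambda>z. of_bool (far z) * avg V (\<lambda>y. of_bool (r z y \<and> close y)))"
    proof -
      have "avg V (\<lambda>z. (1/2) * of_bool (far z)) \<le> avg V (\<lambda>z. of_bool (far z) * avg V (\<lambda>y. of_bool (r z y \<and> close y)))"
      proof (rule avg_mono)
        fix z
        have "ndeg r V z + avg V (\<lambda>y. of_bool (close y)) - 1 \<le> avg V (\<lambda>y. of_bool (r z y \<and> close y))"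
        proof -
          have "avg V (\<lambda>y. of_bool (r z y) + of_bool (close y) - 1) \<le> avg V (\<lambda>y. of_bool (r z y \<and> close y))"
            by (rule avg_mono) auto
          then show ?thesis by (simp add: avg_add avg_diff one ndeg_def)
        qed
        then show "(1/2) * of_bool (far z) \<le> of_bool (far z) * avg V (\<lambda>y. of_bool (r z y \<and> close y))"
          using covered \<phi>small small by (auto simp: far_def)
      qed
      then have "1/2 * \<phi> \<le> avg V (\<lambda>z. of_bool (far z) * avg V (\<lambda>y. of_bool (r z y \<and> close y)))"
        unfolding avg_cmult \<phi>_def .
      then show ?thesis by (simp only: mult.commute[of \<phi>])
    qed
    also have "\<dots> = avg V (\<lambda>z. avg V (\<lambda>y. of_bool (far z) * of_bool (r z y \<and> close y)))"
      by (simp only: avg_cmult)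
    also have "\<dots> = avg V (\<lambda>y. avg V (\<lambda>z. of_bool (far z) * of_bool (r z y \<and> close y)))"
      by (rule avg_swap)
    also have "\<dots> \<le> avg V (\<lambda>y. n0 + \<kappa>)"
    proof (rule avg_mono)
      fix y
      show "avg V (\<lambda>z. of_bool (far z) * of_bool (r z y \<and> close y)) \<le> n0 + \<kappa>"
      proof (cases "close y")
        case True
        have "avg V (\<lambda>z. of_bool (far z) * of_bool (r z y \<and> close y)) \<le> ndeg r V y"
          unfolding ndeg_def by (rule avg_mono) (use r in \<open>auto dest: sympD\<close>)
        then show ?thesis using close_deg[OF True] by simp
      next
        case False
        then show ?thesis using ndeg_nonneg[of r V y0] small by (simp add: avg_const[OF V] n0_def)
      qed
    qed
    also have "\<dots> = n0 + \<kappa>" by (rule avg_const[OF V])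
    finally have \<phi>: "\<phi> \<le> 2 * (n0 + \<kappa>)" by simp
    have bound: "n0 + \<kappa> \<le> (M + K0) / real k" using n0 by (simp add: \<kappa>_def add_divide_distrib)
    also have "\<dots> \<le> K / real k" using pos by (intro divide_right_mono) (auto simp: K_def)
    finally have thr: "n0 + \<kappa> \<le> K / real k" .
    have "avg V (\<lambda>z. of_bool (ndeg r V z > K / real k)) \<le> avg V (\<lambda>z. of_bool (bad y0 z) + of_bool (far z))"
    proof (rule avg_mono)
      fix z
      show "of_bool (ndeg r V z > K / real k) \<le> (of_bool (bad y0 z) + of_bool (far z) :: real)"
        using trichotomy[of z] close_deg[of z] thr by auto
    qed
    also have "\<dots> \<le> 2 * B / real k + 2 * ((M + K0) / real k)"
      unfolding avg_add \<phi>_def[symmetric]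
      using \<phi> bound by (intro add_mono y0(2)) (rule order.trans[OF _ mult_left_mono]; simp)
    also have "\<dots> = (2 * B + 2 * (M + K0)) / real k" by (simp add: add_divide_distrib)
    also have "\<dots> \<le> K / real k" using pos by (intro divide_right_mono) (auto simp: K_def)
    finally show "avg V (\<lambda>z. of_bool (ndeg r V z > K / real k)) \<le> K / real k" .
  qed
qed

section \<open>The graph spanned by the non-hubs\<close>

lemma lavg_pos_exists:
  assumes "lavg V k (\<lambda>xs. of_bool (P xs)) > 0"
  obtains xs where "set xs \<subseteq> V" "length xs = k" "P xs"
proof -
  have "\<exists>xs. set xs \<subseteq> V \<and> length xs = k \<and> P xs"
  proof (rule ccontr)
    assume "\<not> ?thesis"
    then have "lavg V k (\<lambda>xs. of_bool (P xs)) \<le> lavg V k (\<lambda>_. 0)"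
      by (intro lavg_mono) auto
    then show False using assms by (simp add: lavg_def)
  qed
  then show ?thesis using that by blast
qed

lemma lavg_ldeg:
  assumes V: "finite V" "V \<noteq> {}"
  shows "lavg V a (\<lambda>xs. real_of_int (ldeg r xs y)) = real a * ndeg r V y"
proof -
  have "real_of_int (ldeg r xs y) = (\<Sum>x\<leftarrow>xs. of_bool (r y x))" for xs
    by (induction xs) auto
  then show ?thesis by (simp add: lavg_sum_list[OF V] ndeg_def)
qed

text \<open>The second factorial moment of a binomial variable.\<close>

lemma lavg_ldeg_pairs:
  assumes V: "finite V" "V \<noteq> {}"
  shows "lavg V a (\<lambda>xs. real_of_int (ldeg r xs y) * (real_of_int (ldeg r xs y) - 1)) =
     real a * (real a - 1) * (ndeg r V y)\<^sup>2"
proof (induction a)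
  case (Suc a)
  have "lavg V a (\<lambda>xs. real_of_int (ldeg r (x # xs) y) * (real_of_int (ldeg r (x # xs) y) - 1)) =
    2 * of_bool (r y x) * (real a * ndeg r V y) + real a * (real a - 1) * (ndeg r V y)\<^sup>2" for x
  proof -
    have "lavg V a (\<lambda>xs. real_of_int (ldeg r (x # xs) y) * (real_of_int (ldeg r (x # xs) y) - 1)) =
      lavg V a (\<lambda>xs. (2 * of_bool (r y x)) * real_of_int (ldeg r xs y) +
        real_of_int (ldeg r xs y) * (real_of_int (ldeg r xs y) - 1))"
      by (rule lavg_cong) (auto simp: algebra_simps)
    then show ?thesis by (simp only: lavg_add lavg_cmult lavg_ldeg[OF V] Suc.IH)
  qed
  then have "lavg V (Suc a) (\<lambda>xs. real_of_int (ldeg r xs y) * (real_of_int (ldeg r xs y) - 1)) =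
    avg V (\<lambda>x. (2 * (real a * ndeg r V y)) * of_bool (r y x) + real a * (real a - 1) * (ndeg r V y)\<^sup>2)"
    unfolding lavg_Suc by (simp add: mult_ac)
  also have "\<dots> = (2 * (real a * ndeg r V y)) * ndeg r V y + real a * (real a - 1) * (ndeg r V y)\<^sup>2"
    by (simp only: avg_add avg_cmult avg_const[OF V] ndeg_def)
  finally show ?case by (simp add: power2_eq_square algebra_simps)
qed simp

lemma avg_ldeg:
  assumes V: "finite V" "V \<noteq> {}" and r: "symp r"
  shows "avg V (\<lambda>y. real_of_int (ldeg r xs y)) = (\<Sum>x\<leftarrow>xs. ndeg r V x)"
proof (induction xs)
  case Nil
  then show ?case by (simp add: avg_def)
next
  case (Cons x xs)
  have "avg V (\<lambda>y. of_bool (r y x)) = ndeg r V x"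
    unfolding ndeg_def by (rule avg_cong) (use r in \<open>auto dest: sympD\<close>)
  then show ?case using Cons by (simp add: avg_add)
qed

lemma lavg_ecount:
  assumes V: "finite V" "V \<noteq> {}"
  shows "lavg V k (\<lambda>xs. real_of_int (ecount r xs)) = real k * (real k - 1) / 2 * avg V (ndeg r V)"
proof (induction k)
  case (Suc k)
  have "lavg V (Suc k) (\<lambda>xs. real_of_int (ecount r xs)) =
    avg V (\<lambda>x. real k * ndeg r V x + real k * (real k - 1) / 2 * avg V (ndeg r V))"
    unfolding lavg_Suc by (simp only: ecount.simps of_int_add lavg_add lavg_ldeg[OF V] Suc.IH)
  also have "\<dots> = real k * avg V (ndeg r V) + real k * (real k - 1) / 2 * avg V (ndeg r V)"
    by (simp only: avg_add avg_cmult avg_const[OF V])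
  finally show ?case by (simp add: field_simps)
qed simp

text \<open>A first part of only \<open>\<epsilon> * k\<close> entries is split off, so short that
  vertices with two or more neighbours in \<open>xs\<close> and \<open>xs'\<close> together are
  negligible. The degree difference then vanishes on at least half of \<open>V\<close> and is
  nonzero on a set of measure at least \<open>c\<close>, a fixed multiple of \<open>a\<close> times
  the density. Decoupling bounds its \<open>noncol\<close> by \<open>C1 / b\<close>, and since
  \<open>a\<close> and \<open>b\<close> are both of order \<open>k\<close>, the density is
  \<open>O(1 / k ^ 2)\<close>. The weights \<open>w\<close>, which carry the edges to the hubs,
  cancel in the difference.\<close>

lemma sparse_of_bounded_degree:
  assumes \<eta>: "\<eta> > 0" and \<Omega>: "\<Omega> > 0"
  obtains C N :: real where "C > 0" "N > 0"
    "\<And>(V :: 'a set) r w k l. finite V \<Longrightarrow> V \<noteq> {} \<Longrightarrow> symp r \<Longrightarrow> N \<le> real k \<Longrightarrow>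
       (\<And>y. y \<in> V \<Longrightarrow> ndeg r V y \<le> \<Omega> / real k) \<Longrightarrow>
       \<eta> \<le> lavg V k (\<lambda>xs. of_bool (ecount r xs + (\<Sum>x\<leftarrow>xs. w x) = l)) \<Longrightarrow>
       avg V (ndeg r V) \<le> C / (real k)\<^sup>2"
proof (rule decoupling[OF \<eta>, where 'a = 'a], goal_cases)
  case (1 C1)
  note C1 = 1(2) and dec = 1(3)
  \<comment> \<open>The three bounds give, in turn, \<open>a <= k / 2\<close>, a total degree of at
    most \<open>1/4\<close> for each sampled list, and a mean of at most
    \<open>c * \<eta> ^ 2 / 8\<close> for the error term \<open>T\<close>.\<close>
  define \<epsilon> where "\<epsilon> = min (1 / 2) (min (1 / (4 * \<Omega>)) (\<eta>\<^sup>2 / (48 * \<Omega>)))"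
  have \<epsilon>: "0 < \<epsilon>" "\<epsilon> \<le> 1 / 2" "\<epsilon> \<le> 1 / (4 * \<Omega>)" "\<epsilon> \<le> \<eta>\<^sup>2 / (48 * \<Omega>)"
    using \<eta> \<Omega> by (auto simp: \<epsilon>_def)
  have \<epsilon>\<Omega>: "2 * (\<epsilon> * \<Omega>) \<le> 1 / 2" "6 * (\<epsilon> * \<Omega>) \<le> \<eta>\<^sup>2 / 8"
    using \<epsilon>(3,4) \<Omega> by (auto simp: field_simps)
  \<comment> \<open>The first value makes the lower tail of \<open>S\<close> at most
    \<open>\<eta> ^ 2 / 8\<close>; the second is what the final comparison yields when the density
    exceeds the first.\<close>
  define C where "C = max (64 * \<Omega> / (\<epsilon> * \<eta>\<^sup>2)) (32 * C1 / \<epsilon>)"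
  define N where "N = 2 / \<epsilon>"
  show ?thesis
  proof (rule that[of C N])
    have "32 * C1 / \<epsilon> > 0" using C1 \<epsilon> by simp
    then show "C > 0" by (simp add: C_def)
    show "N > 0" using \<epsilon> by (simp add: N_def)
    fix V :: "'a set" and r w and k :: nat and l :: int
    assume V: "finite V" "V \<noteq> {}" and r: "symp r" and k: "N \<le> real k"
      and deg: "\<And>y. y \<in> V \<Longrightarrow> ndeg r V y \<le> \<Omega> / real k"
      and P: "\<eta> \<le> lavg V k (\<lambda>xs. of_bool (ecount r xs + (\<Sum>x\<leftarrow>xs. w x) = l))"
    have k\<epsilon>: "\<epsilon> * real k \<ge> 2" using k \<epsilon> by (simp add: N_def field_simps)
    then have k0: "real k > 0" using \<epsilon> by (cases "k = 0") auto
    define a where "a = nat \<lfloor>\<epsilon> * real k\<rfloor>"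
    define b where "b = k - a"
    have "real a = of_int \<lfloor>\<epsilon> * real k\<rfloor>" unfolding a_def using k\<epsilon> by simp
    then have a: "real a \<le> \<epsilon> * real k" "real a \<ge> \<epsilon> * real k / 2" using k\<epsilon> by linarith+
    have "\<epsilon> * real k \<le> 1 / 2 * real k" using \<epsilon> by (intro mult_right_mono) auto
    then have ak: "real a \<le> real k / 2" using a by linarith
    then have kab: "k = a + b" and b: "real b \<ge> real k / 2" by (auto simp: b_def of_nat_diff)
    have a0: "real a > 0" using a k\<epsilon> by linarith
    have b0: "real b > 0" using b k0 by linarith
    define p where "p = avg V (ndeg r V)"
    have p0: "0 \<le> p" unfolding p_def by (intro avg_nonneg ndeg_nonneg)
    show "avg V (ndeg r V) \<le> C / (real k)\<^sup>2"
    proof (cases "p \<le> 64 * \<Omega> / (\<epsilon> * \<eta>\<^sup>2) / (real k)\<^sup>2")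
      case True
      also have "64 * \<Omega> / (\<epsilon> * \<eta>\<^sup>2) / (real k)\<^sup>2 \<le> C / (real k)\<^sup>2"
        by (intro divide_right_mono) (auto simp: C_def)
      finally show ?thesis by (simp add: p_def)
    next
      case False
      then have big: "p > 64 * \<Omega> / (\<epsilon> * \<eta>\<^sup>2) / (real k)\<^sup>2" by simp
      moreover have "64 * \<Omega> / (\<epsilon> * \<eta>\<^sup>2) / (real k)\<^sup>2 > 0" using \<Omega> \<epsilon> \<eta> k0 by simp
      ultimately have pp: "p > 0" by linarith
      define c where "c = real a * p / 4"
      have c: "c > 0" using a0 pp by (simp add: c_def)
      define S where "S xs = (\<Sum>x\<leftarrow>xs. ndeg r V x)" for xs
      define R where "R xs y = real_of_int (ldeg r xs y)" for xs y
      \<comment> \<open>The loss in the Bonferroni inequality below: pairs of entries of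
        \<open>xs\<close> with a common neighbour \<open>y\<close>, plus pairs with one entry in
        \<open>xs\<close> and one in \<open>xs'\<close>.\<close>
      define T where "T xs xs' = avg V (\<lambda>y. 1/2 * (R xs y * (R xs y - 1)) + R xs y * R xs' y)" for xs xs'
      have tail: "lavg V a (\<lambda>xs. of_bool (S xs \<le> 2 * c)) \<le> \<eta>\<^sup>2 / 8"
      proof -
        have "lavg V a (\<lambda>xs. of_bool (S xs \<le> 2 * c)) = lavg V a (\<lambda>xs. of_bool ((\<Sum>x\<leftarrow>xs. ndeg r V x) \<le> real a * avg V (ndeg r V) / 2))"
          by (simp add: S_def c_def p_def)
        also have "\<dots> \<le> 4 * (\<Omega> / real k) / (real a * avg V (ndeg r V))"
          by (rule lavg_sum_list_lower_tail[OF V]) (use deg ndeg_nonneg[of r V] pp a0 in \<open>auto simp: p_def\<close>)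
        also have "\<dots> \<le> 4 * (\<Omega> / real k) / ((\<epsilon> * real k / 2) * (64 * \<Omega> / (\<epsilon> * \<eta>\<^sup>2) / (real k)\<^sup>2))"
          unfolding p_def[symmetric] using a a0 big pp \<Omega> k0 \<epsilon> \<eta>
          by (intro divide_left_mono mult_mono mult_pos_pos divide_pos_pos) auto
        also have "\<dots> = \<eta>\<^sup>2 / 8" using \<Omega> k0 \<epsilon> \<eta> by (simp add: power2_eq_square field_simps)
        finally show ?thesis .
      qed
      have ET: "lavg V a (\<lambda>xs. lavg V a (\<lambda>xs'. T xs xs')) \<le> c * (\<eta>\<^sup>2 / 8)"
      proof -
        have "lavg V a (\<lambda>xs. lavg V a (\<lambda>xs'. T xs xs')) =
          avg V (\<lambda>y. lavg V a (\<lambda>xs. lavg V a (\<lambda>xs'. 1/2 * (R xs y * (R xs y - 1)) + R xs y * R xs' y)))"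
          unfolding T_def by (simp only: lavg_avg)
        also have "\<dots> = avg V (\<lambda>y. 1/2 * (real a * (real a - 1) * (ndeg r V y)\<^sup>2) + (real a * ndeg r V y) * (real a * ndeg r V y))"
        proof (rule avg_cong)
          fix y
          have "lavg V a (\<lambda>xs'. 1/2 * (R xs y * (R xs y - 1)) + R xs y * R xs' y) =
            1/2 * (R xs y * (R xs y - 1)) + (real a * ndeg r V y) * R xs y" for xs
            unfolding R_def lavg_add lavg_cmult lavg_const[OF V] lavg_ldeg[OF V] by (simp only: mult.commute)
          then show "lavg V a (\<lambda>xs. lavg V a (\<lambda>xs'. 1/2 * (R xs y * (R xs y - 1)) + R xs y * R xs' y)) =
            1/2 * (real a * (real a - 1) * (ndeg r V y)\<^sup>2) + (real a * ndeg r V y) * (real a * ndeg r V y)"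
            unfolding R_def by (simp only: lavg_add lavg_cmult lavg_ldeg_pairs[OF V] lavg_ldeg[OF V])
        qed
        also have "\<dots> \<le> avg V (\<lambda>y. (3/2 * (real a)\<^sup>2 * (\<Omega> / real k)) * ndeg r V y)"
        proof (rule avg_mono)
          fix y assume y: "y \<in> V"
          have "1/2 * (real a * (real a - 1) * (ndeg r V y)\<^sup>2) + (real a * ndeg r V y) * (real a * ndeg r V y)
             \<le> 3/2 * (real a)\<^sup>2 * (ndeg r V y * ndeg r V y)"
            by (simp add: power2_eq_square algebra_simps)
          also have "\<dots> \<le> 3/2 * (real a)\<^sup>2 * (\<Omega> / real k * ndeg r V y)"
            using deg[OF y] ndeg_nonneg[of r V y] by (intro mult_left_mono mult_right_mono) auto
          finally show "1/2 * (real a * (real a - 1) * (ndeg r V y)\<^sup>2) + (real a * ndeg r V y) * (real a * ndeg r V y)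
             \<le> (3/2 * (real a)\<^sup>2 * (\<Omega> / real k)) * ndeg r V y" by (simp add: mult_ac)
        qed
        also have "\<dots> = c * (6 * (real a / real k * \<Omega>))"
          unfolding avg_cmult p_def[symmetric] c_def by (simp add: power2_eq_square)
        also have "\<dots> \<le> c * (6 * (\<epsilon> * \<Omega>))"
          using a k0 \<Omega> c by (intro mult_left_mono mult_right_mono) (auto simp: field_simps)
        also have "\<dots> \<le> c * (\<eta>\<^sup>2 / 8)" using \<epsilon>\<Omega>(2) c by (intro mult_left_mono) auto
        finally show ?thesis .
      qed
      have R: "0 \<le> R xs y" for xs y using ldeg_nonneg by (simp add: R_def)
      have T0: "0 \<le> T xs xs'" for xs xs'
        unfolding T_def
      proof (rule avg_nonneg)
        fix y
        have "0 \<le> R xs y * (R xs y - 1)"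
        proof (cases "ldeg r xs y = 0")
          case False
          then have "1 \<le> R xs y" using ldeg_nonneg[of r xs y] by (simp add: R_def)
          then show ?thesis by simp
        qed (simp add: R_def)
        then show "0 \<le> 1/2 * (R xs y * (R xs y - 1)) + R xs y * R xs' y"
          using R[of xs y] R[of xs' y] by simp
      qed
      have key: "c \<le> 4 * C1 / real k"
        if xs: "set xs \<subseteq> V" "length xs = a" "set xs' \<subseteq> V" "length xs' = a"
          and \<sigma>: "real b * noncol V (\<lambda>y. ldeg r xs y - ldeg r xs' y) \<le> C1"
          and S: "S xs > 2 * c" and T: "T xs xs' \<le> c" for xs xs'
      proof -
        define D where "D y = ldeg r xs y - ldeg r xs' y" for y
        have SR: "avg V (R zs) = S zs" for zs
          unfolding R_def S_def by (rule avg_ldeg[OF V r])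
        have Sle: "S zs \<le> 1/4" if "set zs \<subseteq> V" "length zs = a" for zs
        proof -
          have "S zs \<le> (\<Sum>x\<leftarrow>zs. \<Omega> / real k)"
            unfolding S_def using that deg by (intro sum_list_mono) auto
          also have "\<dots> = real a * (\<Omega> / real k)" using that by (simp add: sum_list_triv)
          also have "\<dots> \<le> (\<epsilon> * real k) * (\<Omega> / real k)" using a \<Omega> k0 by (intro mult_right_mono) auto
          also have "\<dots> \<le> 1/4" using \<epsilon>\<Omega>(1) k0 by simp
          finally show ?thesis .
        qed
        have "1 - S xs - S xs' \<le> avg V (\<lambda>z. of_bool (D z = 0))"
        proof -
          have "avg V (\<lambda>z. 1 - R xs z - R xs' z) \<le> avg V (\<lambda>z. of_bool (D z = 0))"
          proof (rule avg_mono)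
            fix z
            show "1 - R xs z - R xs' z \<le> of_bool (D z = 0)"
              using ldeg_nonneg[of r xs z] ldeg_nonneg[of r xs' z] by (auto simp: D_def R_def)
          qed
          then show ?thesis by (simp only: avg_diff avg_const[OF V] SR)
        qed
        then have half: "1/2 \<le> avg V (\<lambda>z. of_bool (D z = 0))"
          using Sle[of xs] Sle[of xs'] xs by linarith
        have "S xs - T xs xs' \<le> avg V (\<lambda>y. of_bool (D y \<noteq> 0))"
        proof -
          have "avg V (\<lambda>y. R xs y - (1/2 * (R xs y * (R xs y - 1)) + R xs y * R xs' y)) \<le> avg V (\<lambda>y. of_bool (D y \<noteq> 0))"
          proof (rule avg_mono)
            fix y
            \<comment> \<open>A Bonferroni inequality, multiplied by \<open>2\<close> to stay in the integers.\<close>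
            have bonf: "2 * i - i * (i - 1) - 2 * i * j \<le> 2 * of_bool (i \<noteq> j)" if "0 \<le> i" "0 \<le> j" for i j :: int
            proof (cases "i = 0")
              case False
              then have i: "i \<ge> 1" using that by simp
              show ?thesis
              proof (cases "j = 0")
                case True
                have "(i - 1) * (i - 2) \<ge> 0"
                  using i by (cases "i = 1") auto
                then show ?thesis using True False by (simp add: algebra_simps)
              next
                case False
                then have "i * 1 \<le> i * j" using i that by (intro mult_left_mono) auto
                moreover have "0 \<le> i * (i - 1)" using i by simp
                moreover have "(0::int) \<le> 2 * of_bool (i \<noteq> j)" by simp
                ultimately show ?thesis by linarith
              qed
            qed simp
            define i j where "i = ldeg r xs y" and "j = ldeg r xs' y"
            have "real_of_int (2 * i - i * (i - 1) - 2 * i * j) \<le> real_of_int (2 * of_bool (i \<noteq> j))"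
              using bonf[of i j] ldeg_nonneg[of r xs y] ldeg_nonneg[of r xs' y] unfolding i_def j_def of_int_le_iff by blast
            then show "R xs y - (1/2 * (R xs y * (R xs y - 1)) + R xs y * R xs' y) \<le> of_bool (D y \<noteq> 0)"
              by (simp add: R_def D_def i_def j_def)
          qed
          then show ?thesis by (simp only: avg_diff SR T_def)
        qed
        then have "c \<le> avg V (\<lambda>y. of_bool (D y \<noteq> 0))" using S T by linarith
        then have "c * (1/2) \<le> avg V (\<lambda>y. of_bool (D y \<noteq> 0)) * avg V (\<lambda>z. of_bool (D z = 0))"
          using half c by (intro mult_mono) auto
        also have "\<dots> = avg V (\<lambda>y. avg V (\<lambda>z. of_bool (D y \<noteq> 0) * of_bool (D z = 0)))"
          by (simp only: avg_cmult mult.commute[of _ "avg V (\<lambda>z. of_bool (D z = 0))"])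
        also have "\<dots> \<le> noncol V D"
          unfolding noncol_def by (intro avg_mono) auto
        finally have "real b * (c / 2) \<le> real b * noncol V D" using b0 by (intro mult_left_mono) auto
        also have "\<dots> \<le> C1" using \<sigma> unfolding D_def .
        finally have "real b * (c / 2) \<le> C1" .
        moreover have "real k / 2 * (c / 2) \<le> real b * (c / 2)" using b c by (intro mult_right_mono) auto
        ultimately have "real k * c \<le> 4 * C1" by (simp add: mult.commute)
        then show ?thesis using k0 by (simp add: pos_le_divide_eq mult.commute)
      qed
      have "\<eta>\<^sup>2 / 2 \<le> lavg V a (\<lambda>xs. lavg V a (\<lambda>xs'. of_bool (real b * noncol V (\<lambda>y. (ldeg r xs y + w y) - (ldeg r xs' y + w y)) \<le> C1)))"
      proof (rule dec[OF V])
        show "\<eta> \<le> lavg V a (\<lambda>xs. lavg V b (\<lambda>ys. of_bool ((ecount r xs + (\<Sum>x\<leftarrow>xs. w x)) +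
            (\<Sum>y\<leftarrow>ys. ldeg r xs y + w y) + (ecount r ys) = l)))"
          using P unfolding kab lavg_append ecount_append[OF r] by (simp add: sum_list_addf algebra_simps)
      qed
      also have "\<dots> = lavg V a (\<lambda>xs. lavg V a (\<lambda>xs'. of_bool (real b * noncol V (\<lambda>y. ldeg r xs y - ldeg r xs' y) \<le> C1)))"
        by simp
      also have "\<dots> \<le> lavg V a (\<lambda>xs. lavg V a (\<lambda>xs'. of_bool (S xs \<le> 2 * c) + (1 / c) * T xs xs' + of_bool (c \<le> 4 * C1 / real k)))"
      proof (intro lavg_mono)
        fix xs xs' :: "'a list"
        assume xs: "set xs \<subseteq> V" "length xs = a" "set xs' \<subseteq> V" "length xs' = a"
        have "1 \<le> (1 / c) * T xs xs'" if "T xs xs' > c" using that c by (simp add: field_simps)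
        moreover have "0 \<le> (1 / c) * T xs xs'" using T0[of xs xs'] c by simp
        ultimately show "of_bool (real b * noncol V (\<lambda>y. ldeg r xs y - ldeg r xs' y) \<le> C1) \<le>
          of_bool (S xs \<le> 2 * c) + (1 / c) * T xs xs' + of_bool (c \<le> 4 * C1 / real k)"
          using key[OF xs] by (cases "S xs \<le> 2 * c"; cases "T xs xs' \<le> c"; cases "c \<le> 4 * C1 / real k") auto
      qed
      also have "\<dots> \<le> \<eta>\<^sup>2 / 8 + (1 / c) * (c * (\<eta>\<^sup>2 / 8)) + of_bool (c \<le> 4 * C1 / real k)"
        unfolding lavg_add lavg_cmult lavg_const[OF V]
        using tail ET c by (intro add_mono mult_left_mono) auto
      also have "\<dots> = \<eta>\<^sup>2 / 4 + of_bool (c \<le> 4 * C1 / real k)" using c by simp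
      finally have "c \<le> 4 * C1 / real k" using \<eta> by (cases "c \<le> 4 * C1 / real k") auto
      then have "real a * p \<le> 16 * C1 / real k" by (simp add: c_def)
      moreover have "(\<epsilon> * real k / 2) * p \<le> real a * p" using a pp by (intro mult_right_mono) auto
      ultimately have "(\<epsilon> * real k / 2) * p \<le> 16 * C1 / real k" by linarith
      then have "p \<le> (32 * C1 / \<epsilon>) / (real k)\<^sup>2" using k0 \<epsilon> by (simp add: field_simps power2_eq_square)
      also have "\<dots> \<le> C / (real k)\<^sup>2" by (intro divide_right_mono) (auto simp: C_def)
      finally show ?thesis by (simp add: p_def)
    qed
  qed
qed


text \<open>With \<open>hs\<close> fixed, the non-hubs span fewer than \<open>E\<close> edges
  outside an event of probability \<open>\<eta> / 4\<close>, by Markov. So for one of the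
  \<open>E\<close> possible values \<open>e\<close> the sum of \<open>ldeg r hs\<close> over the
  sample hits a prescribed value with probability at least \<open>\<eta> / (2 * E)\<close>, and the
  small ball inequality makes \<open>ldeg r hs\<close> almost constant, equal to some
  \<open>m\<close>.\<close>

lemma rigid_of_likely:
  fixes C0 :: real and hmax :: nat
  assumes \<eta>: "\<eta> > 0" and C0: "C0 > 0"
  obtains C2 C3 :: real where "C2 > 0" "C3 > 0"
    "\<And>(L :: 'a set) r hs k l. finite L \<Longrightarrow> L \<noteq> {} \<Longrightarrow> symp r \<Longrightarrow> k > 0 \<Longrightarrow> length hs \<le> hmax \<Longrightarrow>
       avg L (ndeg r L) \<le> C0 / (real k)\<^sup>2 \<Longrightarrow>
       \<eta> \<le> lavg L k (\<lambda>ls. of_bool (ecount r (hs @ ls) = l)) \<Longrightarrow>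
       \<exists>m. 0 \<le> m \<and> m \<le> int hmax \<and> avg L (\<lambda>y. of_bool (ldeg r hs y \<noteq> m)) \<le> C2 / real k \<and>
           \<bar>real_of_int l - real_of_int m * real k\<bar> \<le> C3"
proof -
  define E where "E = nat \<lceil>2 * C0 / \<eta>\<rceil> + 1"
  have "2 * C0 / \<eta> \<le> real (nat \<lceil>2 * C0 / \<eta>\<rceil>)" by (rule real_nat_ceiling_ge)
  then have E: "real E \<ge> 2 * C0 / \<eta>" "E > 0" by (auto simp: E_def)
  define \<eta>' where "\<eta>' = \<eta> / (2 * real E)"
  have \<eta>': "\<eta>' > 0" using \<eta> E by (simp add: \<eta>'_def)
  obtain C2 :: real where C2: "C2 > 0"
    and ball: "\<And>(V :: 'a set) D b c. finite V \<Longrightarrow> V \<noteq> {} \<Longrightarrow>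
       \<eta>' \<le> lavg V b (\<lambda>ys. of_bool ((\<Sum>y\<leftarrow>ys. D y) = c)) \<Longrightarrow> real b * noncol V D \<le> C2"
    using small_ball[OF \<eta>'] by metis
  define Z where "Z = 4 * C2 / \<eta>"
  have Z: "Z > 0" using C2 \<eta> by (simp add: Z_def)
  define C3 where "C3 = (real hmax)\<^sup>2 + real E + real hmax * Z + 1"
  show ?thesis
  proof (rule that[OF C2, of C3])
    show "C3 > 0" using Z by (simp add: C3_def add_nonneg_pos)
    fix L :: "'a set" and r hs and k :: nat and l :: int
    assume L: "finite L" "L \<noteq> {}" and r: "symp r" and k: "k > 0" and hs: "length hs \<le> hmax"
      and p: "avg L (ndeg r L) \<le> C0 / (real k)\<^sup>2"
      and P: "\<eta> \<le> lavg L k (\<lambda>ls. of_bool (ecount r (hs @ ls) = l))"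
    have p0: "0 \<le> avg L (ndeg r L)" by (intro avg_nonneg ndeg_nonneg)
    define w where "w y = ldeg r hs y" for y
    have ldeg_le: "ldeg r xs y \<le> int (length xs)" for xs y
      by (induction xs) auto
    have w: "0 \<le> w y" "w y \<le> int hmax" for y
      using ldeg_nonneg[of r hs y] ldeg_le[of hs y] hs by (auto simp: w_def)
    have split: "ecount r (hs @ ls) = ecount r hs + (\<Sum>y\<leftarrow>ls. w y) + ecount r ls" for ls
      by (simp add: ecount_append[OF r] w_def)
    have "lavg L k (\<lambda>ls. real_of_int (ecount r ls)) \<le> C0 / 2"
    proof -
      have "lavg L k (\<lambda>ls. real_of_int (ecount r ls)) = (real k * (real k - 1)) * avg L (ndeg r L) / 2"
        by (simp add: lavg_ecount[OF L])
      also have "\<dots> \<le> (real k)\<^sup>2 * (C0 / (real k)\<^sup>2) / 2"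
        using p p0 by (intro divide_right_mono mult_mono) (auto simp: power2_eq_square algebra_simps)
      finally show ?thesis using k by simp
    qed
    moreover have "lavg L k (\<lambda>ls. of_bool (real_of_int (ecount r ls) \<ge> real E)) \<le> lavg L k (\<lambda>ls. real_of_int (ecount r ls)) / real E"
      by (rule lavg_markov) (use E ecount_nonneg[of r] in auto)
    ultimately have "lavg L k (\<lambda>ls. of_bool (real_of_int (ecount r ls) \<ge> real E)) \<le> (C0 / 2) / real E"
      using E by (meson divide_right_mono of_nat_0_le_iff order_trans)
    also have "\<dots> \<le> \<eta> / 4" using E \<eta> by (simp add: field_simps)
    finally have Ebig: "lavg L k (\<lambda>ls. of_bool (real_of_int (ecount r ls) \<ge> real E)) \<le> \<eta> / 4" .
    have "\<eta> \<le> lavg L k (\<lambda>ls. of_bool (real_of_int (ecount r ls) \<ge> real E) +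
        (\<Sum>e<E. of_bool ((\<Sum>y\<leftarrow>ls. w y) = l - ecount r hs - int e)))"
    proof (rule order.trans[OF P lavg_mono])
      fix ls
      show "of_bool (ecount r (hs @ ls) = l) \<le> of_bool (real_of_int (ecount r ls) \<ge> real E) +
        (\<Sum>e<E. (of_bool ((\<Sum>y\<leftarrow>ls. w y) = l - ecount r hs - int e) :: real))"
      proof (cases "ecount r (hs @ ls) = l \<and> ecount r ls < int E")
        case True
        define e where "e = nat (ecount r ls)"
        have e: "e < E" "int e = ecount r ls" using True ecount_nonneg[of r ls] by (auto simp: e_def)
        have "1 = (of_bool ((\<Sum>y\<leftarrow>ls. w y) = l - ecount r hs - int e) :: real)"
          using True split[of ls] e by simp
        also have "\<dots> \<le> (\<Sum>e<E. of_bool ((\<Sum>y\<leftarrow>ls. w y) = l - ecount r hs - int e))"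
          using e by (intro member_le_sum) auto
        finally show ?thesis using True by simp
      next
        case False
        have "0 \<le> (\<Sum>e<E. (of_bool ((\<Sum>y\<leftarrow>ls. w y) = l - ecount r hs - int e) :: real))"
          by (intro sum_nonneg) auto
        then show ?thesis using False by auto
      qed
    qed
    then have "\<eta> / 2 \<le> (\<Sum>e<E. lavg L k (\<lambda>ls. of_bool ((\<Sum>y\<leftarrow>ls. w y) = l - ecount r hs - int e)))"
      using Ebig \<eta> unfolding lavg_add lavg_sum by linarith
    moreover have "(\<Sum>e<E. lavg L k (\<lambda>ls. of_bool ((\<Sum>y\<leftarrow>ls. w y) = l - ecount r hs - int e))) < \<eta> / 2"
      if "\<And>e. lavg L k (\<lambda>ls. of_bool ((\<Sum>y\<leftarrow>ls. w y) = l - ecount r hs - int e)) < \<eta>'"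
    proof -
      have "(\<Sum>e<E. lavg L k (\<lambda>ls. of_bool ((\<Sum>y\<leftarrow>ls. w y) = l - ecount r hs - int e))) < (\<Sum>e<E. \<eta>')"
        using E that by (intro sum_strict_mono) auto
      also have "\<dots> = \<eta> / 2" using E by (simp add: \<eta>'_def)
      finally show ?thesis .
    qed
    ultimately obtain e where "\<eta>' \<le> lavg L k (\<lambda>ls. of_bool ((\<Sum>y\<leftarrow>ls. w y) = l - ecount r hs - int e))"
      by (meson not_le)
    from ball[OF L this] have nc: "real k * noncol L w \<le> C2" .
    obtain m where m: "m \<in> w ` L" "avg L (\<lambda>x. of_bool (w x \<noteq> m)) \<le> noncol L w"
      using noncol_mode[OF L] by blast
    have m0: "0 \<le> m" "m \<le> int hmax" using m(1) w by auto
    have kavg: "real k * avg L (\<lambda>x. of_bool (w x \<noteq> m)) \<le> C2"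
      using m(2) nc by (meson mult_left_mono of_nat_0_le_iff order_trans)
    define q where "q ls = (\<Sum>y\<leftarrow>ls. (of_bool (w y \<noteq> m) :: real))" for ls
    have q0: "0 \<le> q ls" for ls by (induction ls) (auto simp: q_def)
    have qbig: "lavg L k (\<lambda>ls. of_bool (q ls \<ge> Z)) \<le> \<eta> / 4"
    proof -
      have "lavg L k (\<lambda>ls. of_bool (q ls \<ge> Z)) \<le> lavg L k q / Z"
        by (rule lavg_markov) (use Z q0 in auto)
      also have "lavg L k q = real k * avg L (\<lambda>x. of_bool (w x \<noteq> m))"
        unfolding q_def by (rule lavg_sum_list[OF L])
      also have "\<dots> / Z \<le> C2 / Z" using kavg Z by (intro divide_right_mono) auto
      also have "\<dots> = \<eta> / 4" using C2 \<eta> by (simp add: Z_def)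
      finally show ?thesis .
    qed
    \<comment> \<open>Since \<open>l\<close> does not depend on the sample, one sample with few
      inner edges and few entries of exceptional degree is enough to estimate
      \<open>l - m * k\<close>. It exists because both exceptional events have probability at most
      \<open>\<eta> / 4\<close>.\<close>
    have "\<eta> \<le> lavg L k (\<lambda>ls. of_bool (real_of_int (ecount r ls) \<ge> real E) + of_bool (q ls \<ge> Z) +
       of_bool (ecount r (hs @ ls) = l \<and> real_of_int (ecount r ls) < real E \<and> q ls < Z))"
      by (rule order.trans[OF P lavg_mono]) auto
    then have "0 < lavg L k (\<lambda>ls. of_bool (ecount r (hs @ ls) = l \<and> real_of_int (ecount r ls) < real E \<and> q ls < Z))"
      using Ebig qbig \<eta> by (simp add: lavg_add)
    then obtain ls where ls: "length ls = k" "ecount r (hs @ ls) = l" "real_of_int (ecount r ls) < real E" "q ls < Z"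
      by (rule lavg_pos_exists) blast
    have dev: "\<bar>real_of_int (\<Sum>y\<leftarrow>zs. w y) - real_of_int m * real (length zs)\<bar> \<le> real hmax * q zs" for zs
    proof (induction zs)
      case (Cons z zs)
      have "\<bar>real_of_int (w z) - real_of_int m\<bar> \<le> real hmax * of_bool (w z \<noteq> m)"
      proof -
        have "\<bar>w z - m\<bar> \<le> int hmax" using w[of z] m0 by linarith
        then have "real_of_int \<bar>w z - m\<bar> \<le> real_of_int (int hmax)" by (simp only: of_int_le_iff)
        then show ?thesis by (cases "w z = m") auto
      qed
      then show ?case using Cons by (simp add: q_def algebra_simps)
    qed (simp add: q_def)
    have ec: "ecount r zs \<le> int (length zs) * int (length zs)" for zs
    proof (induction zs)
      case (Cons z zs)
      then show ?case using ldeg_le[of zs z] by (simp add: algebra_simps)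
    qed simp
    have "real_of_int (ecount r hs) \<le> (real hmax)\<^sup>2"
    proof -
      have "ecount r hs \<le> int hmax * int hmax"
        using ec[of hs] hs by (meson mult_mono of_nat_0_le_iff of_nat_mono order_trans)
      then have "real_of_int (ecount r hs) \<le> real_of_int (int hmax * int hmax)" by (simp only: of_int_le_iff)
      then show ?thesis by (simp add: power2_eq_square)
    qed
    moreover have "real hmax * q ls \<le> real hmax * Z" using ls by (intro mult_left_mono) auto
    moreover have "real_of_int l = real_of_int (ecount r hs) + real_of_int (\<Sum>y\<leftarrow>ls. w y) + real_of_int (ecount r ls)"
      using split[of ls] ls by simp
    moreover have "0 \<le> real_of_int (ecount r hs)" "0 \<le> real_of_int (ecount r ls)"
      using ecount_nonneg[of r] by auto
    ultimately have "\<bar>real_of_int l - real_of_int m * real k\<bar> \<le> C3"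
      using dev[of ls, unfolded ls(1)] ls(3) unfolding C3_def by linarith
    moreover have "avg L (\<lambda>y. of_bool (ldeg r hs y \<noteq> m)) \<le> C2 / real k"
      using kavg k by (simp add: w_def field_simps)
    ultimately show "\<exists>m. 0 \<le> m \<and> m \<le> int hmax \<and> avg L (\<lambda>y. of_bool (ldeg r hs y \<noteq> m)) \<le> C2 / real k \<and>
           \<bar>real_of_int l - real_of_int m * real k\<bar> \<le> C3"
      using m0 by blast
  qed
qed

section \<open>Product measures and bounded edge counts\<close>

text \<open>The law of a random subset keeping each point independently with probability
  \<open>p\<close>, as a plain finite sum so that \<open>bern_insert\<close> can split off a single
  point.\<close>

definition bern :: "real \<Rightarrow> 'a set \<Rightarrow> ('a set \<Rightarrow> bool) \<Rightarrow> real" where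
  "bern p V P = (\<Sum>A\<in>Pow V. of_bool (P A) * p ^ card A * (1 - p) ^ (card V - card A))"

lemma bern_empty [simp]: "bern p {} P = of_bool (P {})"
  by (simp add: bern_def)

lemma bern_insert:
  assumes "finite V" "z \<notin> V"
  shows "bern p (insert z V) P = (1 - p) * bern p V P + p * bern p V (\<lambda>A. P (insert z A))"
proof -
  let ?f = "\<lambda>A. of_bool (P A) * p ^ card A * (1 - p) ^ (card (insert z V) - card A)"
  have "bern p (insert z V) P = (\<Sum>A\<in>Pow V. ?f A) + (\<Sum>A\<in>insert z ` Pow V. ?f A)"
    unfolding bern_def Pow_insert using assms by (intro sum.union_disjoint) auto
  also have "(\<Sum>A\<in>Pow V. ?f A) = (1 - p) * bern p V P"
    unfolding bern_def sum_distrib_left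
  proof (rule sum.cong[OF refl])
    fix A assume "A \<in> Pow V"
    then have "card A \<le> card V" using assms by (auto intro: card_mono)
    then show "?f A = (1 - p) * (of_bool (P A) * p ^ card A * (1 - p) ^ (card V - card A))"
      using assms by (simp add: Suc_diff_le)
  qed
  also have "(\<Sum>A\<in>insert z ` Pow V. ?f A) = (\<Sum>A\<in>Pow V. ?f (insert z A))"
    using assms by (subst sum.reindex) (auto simp: inj_on_def insert_eq_iff)
  also have "\<dots> = p * bern p V (\<lambda>A. P (insert z A))"
    unfolding bern_def sum_distrib_left
  proof (rule sum.cong[OF refl])
    fix A assume "A \<in> Pow V"
    then have "finite A" "z \<notin> A" using assms by (auto intro: finite_subset)
    then show "?f (insert z A) = p * (of_bool (P (insert z A)) * p ^ card A * (1 - p) ^ (card V - card A))"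
      using assms by simp
  qed
  finally show ?thesis .
qed

lemma bern_mono:
  assumes "0 \<le> p" "p \<le> 1" "\<And>A. A \<subseteq> V \<Longrightarrow> P A \<Longrightarrow> Q A"
  shows "bern p V P \<le> bern p V Q"
  unfolding bern_def using assms by (intro sum_mono mult_right_mono) auto

lemma bern_nonneg: "0 \<le> p \<Longrightarrow> p \<le> 1 \<Longrightarrow> 0 \<le> bern p V P"
  unfolding bern_def by (intro sum_nonneg mult_nonneg_nonneg) auto

lemma bern_le_one:
  assumes "finite V" "0 \<le> p" "p \<le> 1"
  shows "bern p V P \<le> 1"
  using assms(1)
proof (induction V arbitrary: P)
  case (insert z V)
  have "(1 - p) * bern p V P + p * bern p V (\<lambda>A. P (insert z A)) \<le> (1 - p) * 1 + p * 1"
    using assms by (intro add_mono mult_left_mono insert.IH) auto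
  then show ?case using insert by (simp add: bern_insert)
qed simp

text \<open>
  The lines \<open>x + t * y = exp (t - 1)\<close> with \<open>0 \<le> t \<le> 1\<close> envelop the curve \<open>x = - y * ln y\<close>, which is
  traced by the probabilities \<open>x\<close> of the value \<open>1\<close> and \<open>y\<close> of the value \<open>0\<close> of a Poisson variable. Being
  linear, the inequalities survive conditioning on a point \<open>z\<close>; only the case that \<open>z\<close> alone leaves \<open>Lw\<close>
  costs the error \<open>p\<^sup>2\<close>.
\<close>
lemma bern_tangent:
  assumes "finite V" and p: "0 \<le> p" "p \<le> 1" and t: "0 \<le> t" "t \<le> 1"
    and down: "\<And>A B. B \<subseteq> A \<Longrightarrow> A \<subseteq> V \<Longrightarrow> Lw A \<Longrightarrow> Lw B"
    and empty: "Lw {}"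
    and disj: "\<And>A. A \<subseteq> V \<Longrightarrow> Q A \<Longrightarrow> \<not> Lw A"
    and exch: "\<And>S z B. S \<subseteq> V \<Longrightarrow> z \<in> S \<Longrightarrow> B \<subseteq> S - {z} \<Longrightarrow> Q S \<Longrightarrow> Lw B \<Longrightarrow> \<not> Lw (insert z B) \<Longrightarrow> Lw (S - {z})"
  shows "bern p V Q + t * bern p V Lw \<le> exp (t - 1) + real (card V) * p\<^sup>2"
  using assms(1) t down empty disj exch
proof (induction V arbitrary: Q Lw t)
  case empty
  have "t \<le> exp (t - 1)" using exp_ge_add_one_self[of "t - 1"] by simp
  then show ?case using empty by auto
next
  case (insert z V)
  note down = insert.prems(3) and Lw0 = insert.prems(4) and disj = insert.prems(5) and exch = insert.prems(6)
  define N where "N = real (card V)"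
  have N: "real (card (insert z V)) = N + 1" using insert by (simp add: N_def)
  define x y where "x = bern p V Q" and "y = bern p V Lw"
  have y: "0 \<le> y" "y \<le> 1" using p insert by (auto simp: y_def bern_nonneg bern_le_one)
  have IH: "x + t' * y \<le> exp (t' - 1) + N * p\<^sup>2" if "0 \<le> t'" "t' \<le> 1" for t'
    unfolding x_def y_def N_def
  proof (rule insert.IH[OF that])
    show "\<And>A B. B \<subseteq> A \<Longrightarrow> A \<subseteq> V \<Longrightarrow> Lw A \<Longrightarrow> Lw B" using down by blast
    show "\<And>A. A \<subseteq> V \<Longrightarrow> Q A \<Longrightarrow> \<not> Lw A" using disj by blast
    show "\<And>S z B. S \<subseteq> V \<Longrightarrow> z \<in> S \<Longrightarrow> B \<subseteq> S - {z} \<Longrightarrow> Q S \<Longrightarrow> Lw B \<Longrightarrow> \<not> Lw (insert z B) \<Longrightarrow> Lw (S - {z})"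
      using exch by blast
  qed (rule Lw0)
  have Np: "0 \<le> N * p\<^sup>2" by (simp add: N_def)
  show ?case
  proof (cases "Lw {z}")
    case True
    define x1 y1 where "x1 = bern p V (\<lambda>A. Q (insert z A))" and "y1 = bern p V (\<lambda>A. Lw (insert z A))"
    have "x1 + t * y1 \<le> exp (t - 1) + N * p\<^sup>2"
      unfolding x1_def y1_def N_def
    proof (rule insert.IH[OF insert.prems(1,2)])
      show "\<And>A B. B \<subseteq> A \<Longrightarrow> A \<subseteq> V \<Longrightarrow> Lw (insert z A) \<Longrightarrow> Lw (insert z B)"
        by (rule down[of "insert z _" "insert z _"]) auto
      show "\<And>A. A \<subseteq> V \<Longrightarrow> Q (insert z A) \<Longrightarrow> \<not> Lw (insert z A)"
        by (rule disj) auto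
      fix S z' B
      assume a: "S \<subseteq> V" "z' \<in> S" "B \<subseteq> S - {z'}" "Q (insert z S)" "Lw (insert z B)" "\<not> Lw (insert z (insert z' B))"
      then have "z' \<noteq> z" using insert.hyps by auto
      then have "insert z S - {z'} = insert z (S - {z'})" by auto
      moreover have "Lw (insert z S - {z'})"
        by (rule exch[of _ _ "insert z B"]) (use a \<open>z' \<noteq> z\<close> in \<open>auto simp: insert_commute\<close>)
      ultimately show "Lw (insert z (S - {z'}))" by simp
    qed (use True in simp)
    then have "(1 - p) * (x + t * y) + p * (x1 + t * y1) \<le>
        (1 - p) * (exp (t - 1) + N * p\<^sup>2) + p * (exp (t - 1) + N * p\<^sup>2)"
      using p IH[OF insert.prems(1,2)] by (intro add_mono[OF mult_left_mono mult_left_mono]) auto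
    also have "\<dots> = exp (t - 1) + N * p\<^sup>2" by (simp add: algebra_simps)
    also have "\<dots> \<le> exp (t - 1) + (N + 1) * p\<^sup>2" by (simp add: algebra_simps)
    finally show ?thesis
      unfolding N bern_insert[OF insert.hyps(1,2)] x_def y_def x1_def y1_def by (simp add: algebra_simps)
  next
    case False
    have "bern p V (\<lambda>A. Lw (insert z A)) \<le> bern p V (\<lambda>A. False)"
    proof (rule bern_mono[OF p])
      fix A assume "A \<subseteq> V" "Lw (insert z A)"
      then show False using down[of "{z}" "insert z A"] False by auto
    qed
    also have "\<dots> = 0" by (simp add: bern_def)
    finally have y1: "bern p V (\<lambda>A. Lw (insert z A)) = 0"
      using bern_nonneg[OF p, of V "\<lambda>A. Lw (insert z A)"] by simp
    \<comment> \<open>As \<open>z\<close> alone already leaves \<open>Lw\<close>,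
      \<open>exch\<close> with \<open>B = {}\<close> shows that a member of \<open>Q\<close>
      containing \<open>z\<close> falls into \<open>Lw\<close> when \<open>z\<close> is
      removed.\<close>
    have x1: "bern p V (\<lambda>A. Q (insert z A)) \<le> y"
      unfolding y_def
    proof (rule bern_mono[OF p])
      fix A assume A: "A \<subseteq> V" "Q (insert z A)"
      then have "Lw (insert z A - {z})"
        using exch[of "insert z A" z "{}"] Lw0 False by auto
      moreover have "insert z A - {z} = A" using A insert.hyps by auto
      ultimately show "Lw A" by simp
    qed
    have main: "(1 - p) * x + p * y + t * ((1 - p) * y) \<le> exp (t - 1) + (N + 1) * p\<^sup>2"
    proof (cases "t + p \<le> 1")
      case True
      have "(1 - p) * exp p \<le> exp (- p) * exp p"
        using exp_ge_add_one_self[of "- p"] by (intro mult_right_mono) auto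
      then have e: "(1 - p) * exp p \<le> 1" by (simp add: exp_minus)
      \<comment> \<open>The mass \<open>p * y\<close> moved from \<open>Lw\<close> to
        \<open>Q\<close> is absorbed by the steeper line with parameter \<open>t + p\<close>. Its
        value is larger by the factor \<open>exp p\<close>, which \<open>1 - p\<close> repays; the
        rest is the error \<open>p ^ 2\<close>.\<close>
      have "(1 - p) * x + p * y + t * ((1 - p) * y) = (1 - p) * (x + (t + p) * y) + p\<^sup>2 * y"
        by (simp add: algebra_simps power2_eq_square)
      also have "\<dots> \<le> (1 - p) * (exp (t + p - 1) + N * p\<^sup>2) + p\<^sup>2 * 1"
        using p y True insert.prems IH[of "t + p"] by (intro add_mono[OF mult_left_mono mult_left_mono]) auto
      also have "\<dots> = ((1 - p) * exp p) * exp (t - 1) + (1 - p) * (N * p\<^sup>2) + p\<^sup>2"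
        by (simp add: exp_add[symmetric] algebra_simps)
      also have "\<dots> \<le> 1 * exp (t - 1) + 1 * (N * p\<^sup>2) + p\<^sup>2"
        using p e Np by (intro add_mono mult_right_mono) auto
      finally show ?thesis by (simp add: algebra_simps)
    next
      case False
      \<comment> \<open>Now \<open>t + p\<close> lies beyond the last line of the envelope, so the
        line with parameter 1 is used and \<open>c\<close> is the remaining coefficient of
        \<open>y\<close>. It may be negative, hence the maximum with 0.\<close>
      define c where "c = p - (1 - t) * (1 - p)"
      have te: "t \<le> exp (t - 1)" using exp_ge_add_one_self[of "t - 1"] by simp
      have "(1 - p) * x + p * y + t * ((1 - p) * y) = (1 - p) * (x + 1 * y) + c * y"
        by (simp add: c_def algebra_simps)
      also have "\<dots> \<le> (1 - p) * (1 + N * p\<^sup>2) + max c 0"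
      proof (rule add_mono[OF mult_left_mono])
        show "x + 1 * y \<le> 1 + N * p\<^sup>2" using IH[of 1] by simp
        have "c * y \<le> max c 0 * 1" using y by (intro mult_mono) auto
        then show "c * y \<le> max c 0" by simp
      qed (use p in simp)
      also have "\<dots> \<le> (1 - p) + N * p\<^sup>2 + max c 0"
      proof -
        have "0 \<le> p * (N * p\<^sup>2)" using p Np by simp
        then show ?thesis by (simp add: algebra_simps)
      qed
      finally have "(1 - p) * x + p * y + t * ((1 - p) * y) \<le> (1 - p) + N * p\<^sup>2 + max c 0" .
      moreover have "(1 - p) + max c 0 \<le> t + p\<^sup>2"
      proof -
        have "p * (1 - t) \<le> p * p" using False p by (intro mult_left_mono) auto
        then have "(1 - p) + c \<le> t + p\<^sup>2" by (simp add: c_def power2_eq_square algebra_simps)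
        moreover have "1 - p \<le> t + p\<^sup>2" using False zero_le_power2[of p] by linarith
        ultimately show ?thesis by (simp add: max_def)
      qed
      ultimately show ?thesis using te unfolding distrib_right[of N] by linarith
    qed
    have "bern p (insert z V) Q + t * bern p (insert z V) Lw =
        (1 - p) * x + p * bern p V (\<lambda>A. Q (insert z A)) + t * ((1 - p) * y)"
      unfolding bern_insert[OF insert.hyps(1,2)] y1 x_def y_def by simp
    also have "\<dots> \<le> (1 - p) * x + p * y + t * ((1 - p) * y)"
      using p x1 by (intro add_mono order.refl mult_left_mono) auto
    also note main
    finally show ?thesis unfolding N .
  qed
qed

text \<open>The line with parameter 0 touches the curve \<open>- y * ln y\<close> at its
  maximum.\<close>

corollary bern_le_inverse_e:
  assumes "finite V" "0 \<le> p" "p \<le> 1"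
    and "\<And>A B. B \<subseteq> A \<Longrightarrow> A \<subseteq> V \<Longrightarrow> Lw A \<Longrightarrow> Lw B"
    and "Lw {}"
    and "\<And>A. A \<subseteq> V \<Longrightarrow> Q A \<Longrightarrow> \<not> Lw A"
    and "\<And>S z B. S \<subseteq> V \<Longrightarrow> z \<in> S \<Longrightarrow> B \<subseteq> S - {z} \<Longrightarrow> Q S \<Longrightarrow> Lw B \<Longrightarrow> \<not> Lw (insert z B) \<Longrightarrow> Lw (S - {z})"
  shows "bern p V Q \<le> 1 / exp 1 + real (card V) * p\<^sup>2"
  using bern_tangent[OF assms(1-3), of 0 Lw Q] assms(4-7) by (simp add: exp_minus inverse_eq_divide)

text \<open>\<open>Lw\<close> consists of the sets without a subset in \<open>Q\<close>. If adding
  \<open>z\<close> to \<open>B\<close>, inside a member \<open>S\<close> of \<open>Q\<close>,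
  creates a subset in \<open>Q\<close>, that subset must be \<open>S\<close> itself, so
  \<open>B\<close> already is \<open>S - {z}\<close>.\<close>

corollary bern_antichain:
  assumes "finite V" "0 \<le> p" "p \<le> 1" "\<not> Q {}"
    and anti: "\<And>A B. A \<subseteq> B \<Longrightarrow> B \<subseteq> V \<Longrightarrow> Q A \<Longrightarrow> Q B \<Longrightarrow> A = B"
  shows "bern p V Q \<le> 1 / exp 1 + real (card V) * p\<^sup>2"
proof (rule bern_le_inverse_e[OF assms(1-3), where Lw = "\<lambda>A. \<forall>B\<subseteq>A. \<not> Q B"])
  fix S z B
  assume a: "S \<subseteq> V" "z \<in> S" "B \<subseteq> S - {z}" "Q S" "\<forall>B'\<subseteq>B. \<not> Q B'" "\<not> (\<forall>B'\<subseteq>insert z B. \<not> Q B')"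
  then obtain B' where "B' \<subseteq> insert z B" "Q B'" by blast
  moreover from this have "B' = S" using a by (intro anti) auto
  ultimately have "S - {z} \<subseteq> B" by auto
  then show "\<forall>B\<subseteq>S - {z}. \<not> Q B" using a by blast
qed (use assms in auto)


section \<open>Induced edges under Bernoulli sampling\<close>

lemma induced_edges_mono: "A \<subseteq> B \<Longrightarrow> induced_edges E A \<subseteq> induced_edges E B"
  by (auto simp: induced_edges_def)

text \<open>The sets inducing exactly \<open>l\<close> edges need not be an antichain, because of
  isolated vertices, but the exchange condition holds with \<open>Lw\<close> the sets inducing fewer
  than \<open>l\<close>: if adding \<open>z\<close> to a subset \<open>B\<close> of \<open>S\<close>
  reaches \<open>l\<close>, then \<open>z\<close> lies on an edge inside \<open>S\<close>, and
  removing \<open>z\<close> from \<open>S\<close> loses that edge.\<close>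

lemma bern_induced_edges:
  assumes G: "simple_graph V E" and p: "0 \<le> p" "p \<le> 1" and l: "l \<ge> 1"
  shows "bern p V (\<lambda>A. card (induced_edges E A) = l) \<le> 1 / exp 1 + real (card V) * p\<^sup>2"
proof -
  have V: "finite V" and E: "E \<subseteq> nsets V 2" using G by (auto simp: simple_graph_def)
  have "finite E" using E V by (meson finite_imp_finite_nsets finite_subset)
  then have fin: "finite (induced_edges E A)" for A by (simp add: induced_edges_def)
  show ?thesis
  proof (rule bern_le_inverse_e[OF V p, where Lw = "\<lambda>A. card (induced_edges E A) < l"])
    fix A B assume "B \<subseteq> A" "card (induced_edges E A) < l"
    then show "card (induced_edges E B) < l"
      using card_mono[OF fin induced_edges_mono, of B A] by simp
  next
    have "e \<notin> E" if "e \<subseteq> {}" for e using E that by (auto simp: nsets_def)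
    then have "induced_edges E {} = {}" unfolding induced_edges_def by blast
    then show "card (induced_edges E {}) < l" using l by simp
  next
    fix S z B
    assume a: "z \<in> S" "B \<subseteq> S - {z}" "card (induced_edges E S) = l" "card (induced_edges E B) < l"
      "\<not> card (induced_edges E (insert z B)) < l"
    then have "\<not> induced_edges E (insert z B) \<subseteq> induced_edges E B"
      using card_mono[OF fin, of "induced_edges E (insert z B)" B] by auto
    then obtain e where "e \<in> E" "e \<subseteq> insert z B" "z \<in> e" by (auto simp: induced_edges_def)
    then have "e \<in> induced_edges E S" "e \<notin> induced_edges E (S - {z})"
      using a by (auto simp: induced_edges_def)
    then have "induced_edges E (S - {z}) \<subset> induced_edges E S"
      using induced_edges_mono[of "S - {z}" S E] by auto
    then show "card (induced_edges E (S - {z})) < l"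
      using psubset_card_mono[OF fin] a by metis
  qed auto
qed

lemma bern_eq_sum_nsets:
  assumes "finite V"
  shows "bern p V P = (\<Sum>j\<le>card V. real (card {A \<in> nsets V j. P A}) * p ^ j * (1 - p) ^ (card V - j))"
proof -
  have "bern p V P = (\<Sum>j\<in>{..card V}. \<Sum>A | A \<in> Pow V \<and> card A = j. of_bool (P A) * p ^ card A * (1 - p) ^ (card V - card A))"
    unfolding bern_def using assms by (intro sum.group[symmetric]) (auto intro: card_mono)
  also have "\<dots> = (\<Sum>j\<le>card V. real (card {A \<in> nsets V j. P A}) * p ^ j * (1 - p) ^ (card V - j))"
  proof (rule sum.cong[OF refl])
    fix j
    have eq: "{A. A \<in> Pow V \<and> card A = j} = nsets V j"
      using assms by (auto simp: nsets_def intro: finite_subset)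
    have "(\<Sum>A | A \<in> Pow V \<and> card A = j. of_bool (P A) * p ^ card A * (1 - p) ^ (card V - card A)) =
      (\<Sum>A\<in>nsets V j. of_bool (P A) * (p ^ j * (1 - p) ^ (card V - j)))"
      unfolding eq by (rule sum.cong) (auto simp: nsets_def)
    also have "\<dots> = real (card {A \<in> nsets V j. P A}) * (p ^ j * (1 - p) ^ (card V - j))"
      using assms by (simp add: sum_distrib_right[symmetric] of_bool_def sum.If_cases finite_imp_finite_nsets Int_def)
    finally show "(\<Sum>A | A \<in> Pow V \<and> card A = j. of_bool (P A) * p ^ card A * (1 - p) ^ (card V - card A)) =
      real (card {A \<in> nsets V j. P A}) * p ^ j * (1 - p) ^ (card V - j)" by simp
  qed
  finally show ?thesis .
qed

section \<open>From Bernoulli samples to samples of fixed size\<close>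

definition induced_freq :: "'a set \<Rightarrow> 'a set set \<Rightarrow> nat \<Rightarrow> nat \<Rightarrow> real" where
  "induced_freq V E k l = card {A \<in> nsets V k. card (induced_edges E A) = l} / (card V choose k)"

lemma induced_freq_bounds:
  assumes "finite V"
  shows "0 \<le> induced_freq V E k l" "induced_freq V E k l \<le> 1"
proof -
  have "card {A \<in> nsets V k. card (induced_edges E A) = l} \<le> card (nsets V k)"
    using assms by (intro card_mono) (auto simp: finite_imp_finite_nsets)
  then show "induced_freq V E k l \<le> 1"
    by (cases "card V choose k = 0") (auto simp: induced_freq_def divide_le_eq_1)
qed (simp add: induced_freq_def)

text \<open>A set inducing \<open>l\<close> edges has at most \<open>2 * l\<close> non-isolated vertices; deleting any other
  vertex preserves the edge count.\<close>
lemma induced_freq_Suc_le: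
  assumes G: "simple_graph V E" and k: "k < card V"
  shows "induced_freq V E (Suc k) l - 2 * real l / real (Suc k) \<le> induced_freq V E k l"
proof -
  have V: "finite V" and E: "E \<subseteq> nsets V 2" using G by (auto simp: simple_graph_def)
  have "finite E" using E V by (meson finite_imp_finite_nsets finite_subset)
  then have fin: "finite (induced_edges E A)" for A by (simp add: induced_edges_def)
  define S where "S j = {A \<in> nsets V j. card (induced_edges E A) = l}" for j
  have finS: "finite (S j)" for j using V by (simp add: S_def finite_imp_finite_nsets)
  define c where "c A = \<Union> (induced_edges E A)" for A
  have cardc: "card (c A) \<le> 2 * l" if "A \<in> S j" for A j
  proof -
    have "card (c A) \<le> (\<Sum>e\<in>induced_edges E A. card e)"
      unfolding c_def using fin by (simp add: card_Union_le_sum_card)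
    also have "\<dots> = (\<Sum>e\<in>induced_edges E A. 2)"
      using E by (intro sum.cong) (auto simp: induced_edges_def nsets_def)
    finally show ?thesis using that by (simp add: S_def)
  qed
  let ?f = "\<lambda>(A, v). (A - {v}, v)"
  have "card (SIGMA A:S (Suc k). A - c A) \<le> card (SIGMA A:S k. V - A)"
  proof (rule card_inj_on_le[of ?f])
    show "inj_on ?f (SIGMA A:S (Suc k). A - c A)"
      by (auto simp: inj_on_def)
    show "?f ` (SIGMA A:S (Suc k). A - c A) \<subseteq> (SIGMA A:S k. V - A)"
    proof clarsimp
      fix A v assume A: "A \<in> S (Suc k)" "v \<in> A" "v \<notin> c A"
      then have "induced_edges E (A - {v}) = induced_edges E A"
        by (auto simp: induced_edges_def c_def)
      then show "A - {v} \<in> S k \<and> v \<in> V" using A by (auto simp: S_def nsets_def)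
    qed
    show "finite (SIGMA A:S k. V - A)" using finS V by auto
  qed
  moreover have "card (SIGMA A:S k. V - A) = card (S k) * (card V - k)"
  proof -
    have "card (SIGMA A:S k. V - A) = (\<Sum>A\<in>S k. card (V - A))"
      using finS V by (intro card_SigmaI) auto
    also have "\<dots> = (\<Sum>A\<in>S k. card V - k)"
      using V by (intro sum.cong) (auto simp: S_def nsets_def card_Diff_subset)
    finally show ?thesis by simp
  qed
  moreover have "card (S (Suc k)) * (Suc k - 2 * l) \<le> card (SIGMA A:S (Suc k). A - c A)"
  proof -
    have "card (S (Suc k)) * (Suc k - 2 * l) = (\<Sum>A\<in>S (Suc k). Suc k - 2 * l)" by simp
    also have "\<dots> \<le> (\<Sum>A\<in>S (Suc k). card (A - c A))"
    proof (rule sum_mono)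
      fix A assume A: "A \<in> S (Suc k)"
      then have "card A = Suc k" "finite A" by (auto simp: S_def nsets_def)
      moreover have "finite (c A)"
        using fin E by (auto simp: c_def induced_edges_def nsets_def)
      ultimately show "Suc k - 2 * l \<le> card (A - c A)"
        using cardc[OF A] diff_card_le_card_Diff[of "c A" A] by simp
    qed
    also have "\<dots> = card (SIGMA A:S (Suc k). A - c A)"
      using finS by (intro card_SigmaI[symmetric]) (auto simp: S_def nsets_def)
    finally show ?thesis .
  qed
  ultimately have "card (S (Suc k)) * (Suc k - 2 * l) \<le> card (S k) * (card V - k)" by simp
  then have "real (card (S (Suc k))) * real (Suc k - 2 * l) \<le> real (card (S k)) * real (card V - k)"
    by (simp only: of_nat_mult[symmetric] of_nat_le_iff)
  \<comment> \<open>The truncated difference dominates the real one, so the case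
    \<open>2 * l > Suc k\<close> is included.\<close>
  moreover have "real (card (S (Suc k))) * (real (Suc k) - 2 * real l) \<le> real (card (S (Suc k))) * real (Suc k - 2 * l)"
    by (intro mult_left_mono) auto
  ultimately have le: "real (card (S (Suc k))) * (real (Suc k) - 2 * real l) \<le> real (card (S k)) * real (card V - k)"
    by linarith
  have bin: "(card V - k) * (card V choose k) = Suc k * (card V choose Suc k)"
    using binomial_absorb_comp[of "card V" k] binomial_absorption[of k "card V"] by simp
  have pos: "real (card V choose Suc k) > 0" "real (card V choose k) > 0" "real (card V - k) > 0"
    using k by (auto simp: zero_less_binomial)
  have "induced_freq V E (Suc k) l - 2 * real l / real (Suc k) \<le>
      induced_freq V E (Suc k) l * (1 - 2 * real l / real (Suc k))"
  proof -
    have "induced_freq V E (Suc k) l * (2 * real l / real (Suc k)) \<le> 1 * (2 * real l / real (Suc k))"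
      using induced_freq_bounds[OF V] by (intro mult_right_mono) auto
    then show ?thesis unfolding right_diff_distrib by simp
  qed
  also have "\<dots> = real (card (S (Suc k))) * (real (Suc k) - 2 * real l) / (real (Suc k) * real (card V choose Suc k))"
    unfolding induced_freq_def S_def by (simp add: field_simps)
  also have "\<dots> \<le> real (card (S k)) * real (card V - k) / (real (Suc k) * real (card V choose Suc k))"
    using le by (intro divide_right_mono) auto
  also have "real (Suc k) * real (card V choose Suc k) = real (card V - k) * real (card V choose k)"
    by (simp only: of_nat_mult[symmetric] bin)
  also have "real (card (S k)) * real (card V - k) / (real (card V - k) * real (card V choose k)) = induced_freq V E k l"
    using pos by (simp add: induced_freq_def S_def)
  finally show ?thesis .
qed

text \<open>At least \<open>k / 2\<close> vertices remain throughout, so each of the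
  \<open>i\<close> deletions costs at most \<open>4 * l / k\<close>.\<close>

lemma induced_freq_diff_le:
  assumes G: "simple_graph V E" and k: "k \<le> card V" and i: "2 * i \<le> k"
  shows "induced_freq V E k l - 4 * real l * real i / real k \<le> induced_freq V E (k - i) l"
  using i
proof (induction i)
  case (Suc i)
  have k': "Suc (k - Suc i) = k - i" "k - Suc i < card V" using Suc.prems k by auto
  have "induced_freq V E (k - i) l - 2 * real l / real (k - i) \<le> induced_freq V E (k - Suc i) l"
    using induced_freq_Suc_le[OF G k'(2), of l] unfolding k'(1) .
  moreover have "2 * real l / real (k - i) \<le> 4 * real l / real k"
  proof -
    have "real k / 2 \<le> real (k - i)" using Suc.prems by (simp add: of_nat_diff)
    then have "2 * real l / real (k - i) \<le> 2 * real l / (real k / 2)"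
      using Suc.prems by (intro divide_left_mono) auto
    then show ?thesis by simp
  qed
  moreover have "induced_freq V E k l - 4 * real l * real i / real k \<le> induced_freq V E (k - i) l"
    using Suc by simp
  moreover have "4 * real l * real (Suc i) / real k = 4 * real l * real i / real k + 4 * real l / real k"
    by (simp add: algebra_simps add_divide_distrib)
  moreover have "P - d \<le> Z" if "Y - c \<le> Z" "c \<le> b" "P - a \<le> Y" "d = a + b" for P Y Z a b c d :: real
    using that by linarith
  ultimately show ?case by blast
qed simp

text \<open>Chebyshev's inequality for a binomial variable, whose weights are the Bernstein
  polynomials.\<close>

lemma Bernstein_tail:
  assumes p: "0 \<le> p" "p \<le> 1" and s: "s > 0"
  shows "(\<Sum>j\<le>n. of_bool (\<bar>real j - real n * p\<bar> > s) * Bernstein n j p) \<le> real n * p / s\<^sup>2"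
proof -
  have "(\<Sum>j\<le>n. of_bool (\<bar>real j - real n * p\<bar> > s) * Bernstein n j p) \<le>
      (\<Sum>j\<le>n. (real j - real n * p)\<^sup>2 / s\<^sup>2 * Bernstein n j p)"
  proof (intro sum_mono mult_right_mono)
    fix j
    show "of_bool (\<bar>real j - real n * p\<bar> > s) \<le> (real j - real n * p)\<^sup>2 / s\<^sup>2"
    proof (cases "\<bar>real j - real n * p\<bar> > s")
      case True
      then have "s\<^sup>2 \<le> \<bar>real j - real n * p\<bar>\<^sup>2" using s by (intro power_mono) auto
      then show ?thesis using True s by simp
    qed simp
  qed (use p in \<open>simp add: Bernstein_nonneg\<close>)
  also have "\<dots> = (\<Sum>j\<le>n. (real j * (real j - 1) * Bernstein n j p + (1 - 2 * (real n * p)) * (real j * Bernstein n j p)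
      + (real n * p)\<^sup>2 * Bernstein n j p)) / s\<^sup>2"
    unfolding sum_divide_distrib by (intro sum.cong) (auto simp: field_simps power2_eq_square)
  also have "\<dots> = (real n * p * (1 - p)) / s\<^sup>2"
    unfolding sum.distrib sum_distrib_left[symmetric] sum_k_Bernstein sum_kk_Bernstein sum_Bernstein
    by (simp add: power2_eq_square algebra_simps)
  also have "\<dots> \<le> real n * p / s\<^sup>2"
    using p by (intro divide_right_mono) (auto simp: mult_left_le)
  finally show ?thesis .
qed

text \<open>The frequency can be compared with that of smaller samples only, by deleting vertices.
  Hence the Bernoulli sample gets mean size \<open>k - s\<close>: its size then lies between
  \<open>k - 2 * s\<close> and \<open>k\<close> outside an event of probability at most
  \<open>k / s ^ 2\<close>, and in that window the frequency drops by at most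
  \<open>8 * l * s / k\<close>.\<close>

theorem induced_freq_le_of_small:
  assumes G: "simple_graph V E" and k: "0 < k" "k \<le> card V" and l: "l \<ge> 1"
    and s: "0 < s" "s \<le> real k / 4"
  shows "induced_freq V E k l \<le>
    1 / exp 1 + (real k)\<^sup>2 / real (card V) + 8 * real l * s / real k + real k / s\<^sup>2"
proof -
  have V: "finite V" using G by (simp add: simple_graph_def)
  define n where "n = card V"
  define p where "p = (real k - s) / real n"
  have n0: "real n > 0" using k by (simp add: n_def)
  have p: "0 \<le> p" "p \<le> 1" using s k by (auto simp: p_def n_def divide_le_eq)
  have np: "real n * p = real k - s" using n0 by (simp add: p_def)
  define u where "u = induced_freq V E k l - 8 * real l * s / real k"
  have "8 * real l * s / real k \<ge> 0" using s by simp
  then have u1: "u \<le> 1" using induced_freq_bounds[OF V, of E k l] by (simp add: u_def)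
  define B where "B j = Bernstein n j p" for j
  have B0: "0 \<le> B j" for j using p by (simp add: B_def Bernstein_nonneg)
  have "u * (1 - of_bool (\<bar>real j - real n * p\<bar> > s)) \<le> induced_freq V E j l" if "j \<le> n" for j
  proof (cases "\<bar>real j - real n * p\<bar> > s")
    case True
    then show ?thesis using induced_freq_bounds[OF V] by simp
  next
    case False
    then have "real j \<le> real k" "real k - 2 * s \<le> real j" unfolding np by linarith+
    then have j: "j \<le> k" "real (k - j) \<le> 2 * s" by (auto simp: of_nat_diff)
    then have "real (2 * (k - j)) \<le> real k" using s by linarith
    then have "2 * (k - j) \<le> k" by (simp only: of_nat_le_iff)
    from induced_freq_diff_le[OF G k(2) this, of l]
    have "induced_freq V E k l - 4 * real l * real (k - j) / real k \<le> induced_freq V E j l"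
      using j by simp
    moreover have "4 * real l * real (k - j) / real k \<le> 4 * real l * (2 * s) / real k"
      using j by (intro divide_right_mono mult_left_mono) auto
    ultimately have "u \<le> induced_freq V E j l" by (simp add: u_def)
    then show ?thesis using False by simp
  qed
  then have "(\<Sum>j\<le>n. u * (1 - of_bool (\<bar>real j - real n * p\<bar> > s)) * B j) \<le> (\<Sum>j\<le>n. induced_freq V E j l * B j)"
    using B0 by (intro sum_mono mult_right_mono) auto
  moreover have "(\<Sum>j\<le>n. induced_freq V E j l * B j) = bern p V (\<lambda>A. card (induced_edges E A) = l)"
    unfolding bern_eq_sum_nsets[OF V] n_def[symmetric]
  proof (intro sum.cong refl)
    fix j assume "j \<in> {..n}"
    then have "real (n choose j) > 0" by (simp add: zero_less_binomial)
    then show "induced_freq V E j l * B j = real (card {A \<in> nsets V j. card (induced_edges E A) = l}) * p ^ j * (1 - p) ^ (n - j)"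
      by (simp add: induced_freq_def B_def Bernstein_def n_def)
  qed
  moreover note bern_induced_edges[OF G p l]
  moreover have "u - real k / s\<^sup>2 \<le> (\<Sum>j\<le>n. u * (1 - of_bool (\<bar>real j - real n * p\<bar> > s)) * B j)"
  proof -
    define t where "t = (\<Sum>j\<le>n. of_bool (\<bar>real j - real n * p\<bar> > s) * B j)"
    have t0: "0 \<le> t" unfolding t_def using B0 by (intro sum_nonneg) auto
    have "t \<le> real n * p / s\<^sup>2" unfolding t_def B_def by (rule Bernstein_tail[OF p s(1)])
    also have "\<dots> \<le> real k / s\<^sup>2" unfolding np using s by (intro divide_right_mono) auto
    finally have t: "t \<le> real k / s\<^sup>2" .
    have "(\<Sum>j\<le>n. u * (1 - of_bool (\<bar>real j - real n * p\<bar> > s)) * B j) =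
      (\<Sum>j\<le>n. u * B j - u * (of_bool (\<bar>real j - real n * p\<bar> > s) * B j))"
      by (intro sum.cong refl) (simp add: algebra_simps)
    also have "\<dots> = u * (\<Sum>j\<le>n. B j) - u * t"
      by (simp only: t_def sum_distrib_left sum_subtractf)
    also have "(\<Sum>j\<le>n. B j) = 1" by (simp add: B_def)
    finally have "(\<Sum>j\<le>n. u * (1 - of_bool (\<bar>real j - real n * p\<bar> > s)) * B j) = u - u * t"
      by simp
    moreover have "u * t \<le> 1 * t" using u1 t0 by (intro mult_right_mono) auto
    ultimately show ?thesis using t by simp
  qed
  moreover have "real (card V) * p\<^sup>2 \<le> (real k)\<^sup>2 / real (card V)"
  proof -
    have "real n * p\<^sup>2 = (real k - s)\<^sup>2 / real n" using n0 by (simp add: p_def power2_eq_square)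
    also have "\<dots> \<le> (real k)\<^sup>2 / real n" using s by (intro divide_right_mono power_mono) auto
    finally show ?thesis by (simp add: n_def)
  qed
  ultimately show ?thesis unfolding u_def by linarith
qed

section \<open>Sampling the hubs\<close>

lemma lsum_restrict:
  fixes F :: "'a list \<Rightarrow> real"
  assumes "finite V" "W \<subseteq> V"
  shows "lsum V k (\<lambda>xs. of_bool (set xs \<subseteq> W) * F xs) = lsum W k F"
proof (induction k arbitrary: F)
  case (Suc k)
  have "lsum V k (\<lambda>xs. of_bool (set (x # xs) \<subseteq> W) * F (x # xs)) = of_bool (x \<in> W) * lsum W k (\<lambda>xs. F (x # xs))" for x
    using Suc.IH[of "\<lambda>xs. F (x # xs)"] by (cases "x \<in> W") auto
  then have "lsum V (Suc k) (\<lambda>xs. of_bool (set xs \<subseteq> W) * F xs) = (\<Sum>x\<in>V. of_bool (x \<in> W) * lsum W k (\<lambda>xs. F (x # xs)))"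
    by (simp only: lsum.simps)
  also have "\<dots> = lsum W (Suc k) F"
    unfolding lsum.simps using assms by (intro sum.mono_neutral_cong_right) auto
  finally show ?case .
qed simp

text \<open>\<open>F\<close> sees the subsequences of entries in \<open>H\<close> and in
  \<open>L\<close> but not how they interleave, which accounts for the factor
  \<open>k choose h\<close>. The induction on the first entry is Pascal's rule.\<close>

lemma lsum_filter_split:
  fixes F :: "'a list \<Rightarrow> 'a list \<Rightarrow> real"
  assumes "finite H" "finite L" "H \<inter> L = {}"
  shows "lsum (H \<union> L) k (\<lambda>xs. F (filter (\<lambda>x. x \<in> H) xs) (filter (\<lambda>x. x \<notin> H) xs)) =
    (\<Sum>h\<le>k. real (k choose h) * lsum H h (\<lambda>hs. lsum L (k - h) (\<lambda>ls. F hs ls)))"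
proof (induction k arbitrary: F)
  case (Suc k)
  define G where "G h = lsum H h (\<lambda>hs. lsum L (Suc k - h) (\<lambda>ls. F hs ls))" for h
  have "lsum (H \<union> L) (Suc k) (\<lambda>xs. F (filter (\<lambda>x. x \<in> H) xs) (filter (\<lambda>x. x \<notin> H) xs)) =
    (\<Sum>x\<in>H. lsum (H \<union> L) k (\<lambda>xs. F (filter (\<lambda>x. x \<in> H) (x # xs)) (filter (\<lambda>x. x \<notin> H) (x # xs)))) +
    (\<Sum>x\<in>L. lsum (H \<union> L) k (\<lambda>xs. F (filter (\<lambda>x. x \<in> H) (x # xs)) (filter (\<lambda>x. x \<notin> H) (x # xs))))"
    unfolding lsum.simps using assms by (rule sum.union_disjoint)
  also have "(\<Sum>x\<in>H. lsum (H \<union> L) k (\<lambda>xs. F (filter (\<lambda>x. x \<in> H) (x # xs)) (filter (\<lambda>x. x \<notin> H) (x # xs)))) =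
     (\<Sum>x\<in>H. \<Sum>h\<le>k. real (k choose h) * lsum H h (\<lambda>hs. lsum L (k - h) (\<lambda>ls. F (x # hs) ls)))"
    by (intro sum.cong refl) (simp add: Suc.IH[of "\<lambda>hs. F (_ # hs)"])
  also have "\<dots> = (\<Sum>h\<le>k. real (k choose h) * G (Suc h))"
    by (subst sum.swap) (simp add: G_def sum_distrib_left)
  also have "(\<Sum>x\<in>L. lsum (H \<union> L) k (\<lambda>xs. F (filter (\<lambda>x. x \<in> H) (x # xs)) (filter (\<lambda>x. x \<notin> H) (x # xs)))) =
     (\<Sum>x\<in>L. \<Sum>h\<le>k. real (k choose h) * lsum H h (\<lambda>hs. lsum L (k - h) (\<lambda>ls. F hs (x # ls))))"
  proof (intro sum.cong refl)
    fix x assume "x \<in> L"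
    then have "x \<notin> H" using assms by auto
    then show "lsum (H \<union> L) k (\<lambda>xs. F (filter (\<lambda>x. x \<in> H) (x # xs)) (filter (\<lambda>x. x \<notin> H) (x # xs))) =
      (\<Sum>h\<le>k. real (k choose h) * lsum H h (\<lambda>hs. lsum L (k - h) (\<lambda>ls. F hs (x # ls))))"
      by (simp add: Suc.IH[of "\<lambda>hs ls. F hs (x # ls)"])
  qed
  also have "\<dots> = (\<Sum>h\<le>k. real (k choose h) * G h)"
  proof (subst sum.swap, intro sum.cong refl)
    fix h assume "h \<in> {..k}"
    then have "Suc k - h = Suc (k - h)" by auto
    then show "(\<Sum>x\<in>L. real (k choose h) * lsum H h (\<lambda>hs. lsum L (k - h) (\<lambda>ls. F hs (x # ls)))) = real (k choose h) * G h"
      by (simp add: G_def lsum_sum sum_distrib_left)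
  qed
  also have "(\<Sum>h\<le>k. real (k choose h) * G (Suc h)) + (\<Sum>h\<le>k. real (k choose h) * G h) =
     (\<Sum>h\<le>Suc k. real (Suc k choose h) * G h)"
  proof -
    have "(\<Sum>h\<le>k. real (k choose h) * G h) = (\<Sum>h\<le>Suc k. real (k choose h) * G h)"
      by simp
    also have "\<dots> = G 0 + (\<Sum>h\<le>k. real (k choose Suc h) * G (Suc h))"
      by (subst sum.atMost_Suc_shift) simp
    finally show ?thesis
      by (subst sum.atMost_Suc_shift) (simp add: sum.distrib[symmetric] distrib_right)
  qed
  finally show ?case unfolding G_def .
qed simp

lemma lsum_distinct:
  assumes "finite H"
  shows "lsum H h (\<lambda>hs. of_bool (distinct hs \<and> Q (set hs))) = fact h * real (card {S \<in> nsets H h. Q S})"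
proof -
  define A where "A = {S \<in> nsets H h. Q S}"
  have finA: "finite A" using assms by (simp add: A_def finite_imp_finite_nsets)
  have fin: "finite {hs. set hs \<subseteq> H \<and> length hs = h}" using assms by (rule finite_lists_length_eq)
  have eq: "{hs. set hs \<subseteq> H \<and> length hs = h} \<inter> {hs. distinct hs \<and> Q (set hs)} = (\<Union>S\<in>A. permutations_of_set S)"
    by (auto simp: A_def nsets_def permutations_of_set_def distinct_card)
  have "lsum H h (\<lambda>hs. of_bool (distinct hs \<and> Q (set hs))) = real (card (\<Union>S\<in>A. permutations_of_set S))"
    unfolding lsum_eq_sum[OF assms] eq[symmetric] using fin by (simp add: of_bool_def sum.If_cases Int_def)
  also have "card (\<Union>S\<in>A. permutations_of_set S) = (\<Sum>S\<in>A. card (permutations_of_set S))"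
    using finA by (intro card_UN_disjoint) (auto dest: permutations_of_setD)
  also have "\<dots> = (\<Sum>S\<in>A. fact h)"
    by (intro sum.cong) (auto simp: A_def nsets_def)
  finally show ?thesis by (simp add: A_def)
qed

lemma lavg_not_distinct_le:
  assumes V: "finite V" "V \<noteq> {}"
  shows "lavg V k (\<lambda>xs. of_bool (\<not> distinct xs)) \<le> (real k)\<^sup>2 / real (card V)"
proof (induction k)
  case (Suc k)
  have n: "real (card V) > 0" using V by (simp add: card_gt_0_iff)
  have mem: "avg V (\<lambda>x. of_bool (x \<in> set xs)) \<le> real (length xs) / real (card V)" for xs
  proof -
    have "(\<Sum>x\<in>V. of_bool (x \<in> set xs)) = real (card (V \<inter> set xs))"
      using V by (simp add: of_bool_def sum.If_cases)
    also have "\<dots> \<le> real (length xs)"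
      by (metis card_length card_mono inf_le2 List.finite_set le_trans of_nat_le_iff)
    finally show ?thesis unfolding avg_def by (intro divide_right_mono) auto
  qed
  have "lavg V (Suc k) (\<lambda>xs. of_bool (\<not> distinct xs)) \<le>
      avg V (\<lambda>x. lavg V k (\<lambda>xs. of_bool (x \<in> set xs) + of_bool (\<not> distinct xs)))"
    unfolding lavg_Suc by (intro avg_mono lavg_mono) auto
  also have "\<dots> = lavg V k (\<lambda>xs. avg V (\<lambda>x. of_bool (x \<in> set xs))) + lavg V k (\<lambda>xs. of_bool (\<not> distinct xs))"
    by (simp only: lavg_add avg_add lavg_avg avg_const[OF V])
  also have "\<dots> \<le> real k / real (card V) + (real k)\<^sup>2 / real (card V)"
    by (intro add_mono Suc.IH lavg_le_const[OF V]) (use mem in auto)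
  also have "\<dots> \<le> (real (Suc k))\<^sup>2 / real (card V)"
    unfolding add_divide_distrib[symmetric] by (intro divide_right_mono) (auto simp: power2_eq_square algebra_simps)
  finally show ?case .
qed simp

text \<open>The set of sampled hubs is compared, one size \<open>h\<close> at a time, with a
  Bernoulli subset of \<open>H\<close> of parameter \<open>k / card V\<close>. For
  \<open>h <= hmax\<close> the weights differ at most by the exponential factor:
  \<open>(1 - \<nu>) ^ h\<close> is bounded below through \<open>hmax\<close>, and the quadratic
  term of \<open>ln (1 - p)\<close> gives the rest. For \<open>\<nu> = O(1 / k)\<close> and
  \<open>card V >= k ^ 3\<close> this factor tends to 1, and \<open>bern_antichain\<close>
  finishes.\<close>

lemma hub_antichain_le:
  assumes V: "finite V" "V \<noteq> {}" and HL: "H \<subseteq> V" "L \<subseteq> V" "H \<inter> L = {}"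
    and k: "2 * k \<le> card V" and Q0: "\<not> Q {}"
    and anti: "\<And>A B. A \<subseteq> B \<Longrightarrow> B \<subseteq> H \<Longrightarrow> Q A \<Longrightarrow> Q B \<Longrightarrow> A = B"
    and \<nu>: "real (card H) = \<nu> * real (card V)"
  shows "lavg V k (\<lambda>xs. of_bool (set xs \<subseteq> H \<union> L \<and> distinct xs \<and>
      length (filter (\<lambda>x. x \<in> H) xs) \<le> hmax \<and> Q (set (filter (\<lambda>x. x \<in> H) xs)))) \<le>
    exp (\<nu> * real hmax + 2 * \<nu> * (real k)\<^sup>2 / real (card V)) * (1 / exp 1 + \<nu> * (real k)\<^sup>2 / real (card V))"
proof -
  define n where "n = real (card V)"
  define N where "N = card H"
  have n: "n > 0" using V by (simp add: n_def card_gt_0_iff)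
  have fin: "finite H" "finite L" using HL V by (auto intro: finite_subset)
  have N: "real N = \<nu> * n" using \<nu> by (simp add: n_def N_def)
  then have \<nu>0: "\<nu> \<ge> 0" using n by (metis of_nat_0_le_iff zero_le_mult_iff not_le)
  define p where "p = real k / n"
  have p: "0 \<le> p" "p \<le> 1/2" using k n by (auto simp: p_def n_def field_simps)
  have cardL: "real (card L) \<le> n * (1 - \<nu>)"
  proof -
    have "card H + card L = card (H \<union> L)" using fin HL by (simp add: card_Un_disjoint)
    also have "\<dots> \<le> card V" using HL V by (intro card_mono) auto
    finally have "real (card H) + real (card L) \<le> real (card V)" by (simp only: of_nat_add[symmetric] of_nat_le_iff)
    then show ?thesis using \<nu> by (simp add: n_def algebra_simps)
  qed
  define X where "X = exp (\<nu> * real hmax + 2 * \<nu> * (real k)\<^sup>2 / n)"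
  define c where "c h = real (card {S \<in> nsets H h. Q S})" for h
  have c0: "0 \<le> c h" for h by (simp add: c_def)
  have "(lsum V k (\<lambda>xs. of_bool (set xs \<subseteq> H \<union> L \<and> distinct xs \<and>
      length (filter (\<lambda>x. x \<in> H) xs) \<le> hmax \<and> Q (set (filter (\<lambda>x. x \<in> H) xs)))) :: real) \<le>
    lsum V k (\<lambda>xs. of_bool (set xs \<subseteq> H \<union> L) * of_bool (distinct (filter (\<lambda>x. x \<in> H) xs) \<and>
      length (filter (\<lambda>x. x \<in> H) xs) \<le> hmax \<and> Q (set (filter (\<lambda>x. x \<in> H) xs))))"
    by (rule lsum_mono) auto
  also have "\<dots> = lsum (H \<union> L) k (\<lambda>xs. of_bool (distinct (filter (\<lambda>x. x \<in> H) xs) \<and>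
      length (filter (\<lambda>x. x \<in> H) xs) \<le> hmax \<and> Q (set (filter (\<lambda>x. x \<in> H) xs))))"
    using V HL by (intro lsum_restrict) auto
  also have "\<dots> = (\<Sum>h\<le>k. real (k choose h) * lsum H h (\<lambda>hs. lsum L (k - h) (\<lambda>ls. of_bool (distinct hs \<and> length hs \<le> hmax \<and> Q (set hs)))))"
    using lsum_filter_split[OF fin HL(3), of k "\<lambda>hs ls. of_bool (distinct hs \<and> length hs \<le> hmax \<and> Q (set hs))"] by simp
  also have "\<dots> \<le> (\<Sum>h\<le>k. n ^ k * (X * (c h * p ^ h * (1 - p) ^ (N - h))))"
  proof (rule sum_mono)
    fix h assume "h \<in> {..k}"
    then have hk: "h \<le> k" by simp
    show "real (k choose h) * lsum H h (\<lambda>hs. lsum L (k - h) (\<lambda>ls. of_bool (distinct hs \<and> length hs \<le> hmax \<and> Q (set hs))))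
      \<le> n ^ k * (X * (c h * p ^ h * (1 - p) ^ (N - h)))"
    proof (cases "h \<le> hmax")
      case False
      have "lsum H h (\<lambda>hs. lsum L (k - h) (\<lambda>ls. of_bool (distinct hs \<and> length hs \<le> hmax \<and> Q (set hs)))) = lsum H h (\<lambda>hs. 0::real)"
        by (rule lsum_cong) (use False in auto)
      then show ?thesis using n p c0 by (simp add: X_def)
    next
      case True
      have "lsum H h (\<lambda>hs. lsum L (k - h) (\<lambda>ls. of_bool (distinct hs \<and> length hs \<le> hmax \<and> Q (set hs)))) =
        lsum H h (\<lambda>hs. real (card L) ^ (k - h) * of_bool (distinct hs \<and> Q (set hs)))"
        by (rule lsum_cong) (use True in \<open>auto simp: lsum_const\<close>)
      also have "\<dots> = real (card L) ^ (k - h) * (fact h * c h)"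
        unfolding lsum_cmult lsum_distinct[OF fin(1)] c_def by simp
      finally have "real (k choose h) * lsum H h (\<lambda>hs. lsum L (k - h) (\<lambda>ls. of_bool (distinct hs \<and> length hs \<le> hmax \<and> Q (set hs)))) =
        real ((k choose h) * fact h) * c h * real (card L) ^ (k - h)" by simp
      also have "\<dots> \<le> real (k ^ h) * c h * (n * (1 - \<nu>)) ^ (k - h)"
        using binomial_fact_pow[of k h] cardL c0[of h]
        by (intro mult_mono power_mono mult_right_mono) (auto simp del: of_nat_mult of_nat_power)
      also have "\<dots> = n ^ k * (c h * p ^ h * (1 - \<nu>) ^ (k - h))"
      proof -
        have nk: "n ^ k = n ^ h * n ^ (k - h)" using hk by (simp add: power_add[symmetric])
        show ?thesis unfolding nk power_mult_distrib p_def power_divide using n by simp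
      qed
      also have "\<dots> \<le> n ^ k * (c h * p ^ h * (X * (1 - p) ^ (N - h)))"
      proof -
        have \<nu>1: "\<nu> \<le> 1"
        proof -
          have "card H \<le> card V" using HL V by (intro card_mono) auto
          then have "\<nu> * n \<le> 1 * n" using N by (simp add: n_def N_def)
          then show ?thesis using n by simp
        qed
        have "(1 - \<nu>) ^ (k - h) \<le> exp (- \<nu>) ^ (k - h)"
          using exp_ge_add_one_self[of "- \<nu>"] \<nu>1 by (intro power_mono) auto
        also have "\<dots> = exp (- \<nu> * (real k - real h))"
          using hk by (simp add: exp_of_nat_mult[symmetric] of_nat_diff mult.commute)
        also have "\<dots> \<le> exp (\<nu> * real hmax - \<nu> * real k)"
          using True \<nu>0 by (simp add: algebra_simps mult_left_mono)
        \<comment> \<open>This uses \<open>N * p = \<nu> * k\<close> and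
          \<open>N * p ^ 2 = \<nu> * k ^ 2 / n\<close>.\<close>
        also have "\<nu> * real hmax - \<nu> * real k = (\<nu> * real hmax + 2 * \<nu> * (real k)\<^sup>2 / n) + real N * (- p - 2 * p\<^sup>2)"
          using n by (simp add: N p_def power2_eq_square field_simps)
        also have "exp \<dots> = X * exp (- p - 2 * p\<^sup>2) ^ N"
          by (simp add: exp_add X_def exp_of_nat_mult[symmetric])
        also have "\<dots> \<le> X * (1 - p) ^ N"
        proof -
          have "- p - 2 * p\<^sup>2 \<le> ln (1 - p)" using ln_one_minus_pos_lower_bound[of p] p by simp
          then have "exp (- p - 2 * p\<^sup>2) \<le> exp (ln (1 - p))" by (simp only: exp_le_cancel_iff)
          also have "exp (ln (1 - p)) = 1 - p" using p by (intro exp_ln) auto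
          finally show ?thesis by (intro mult_left_mono power_mono) (auto simp: X_def)
        qed
        also have "\<dots> \<le> X * (1 - p) ^ (N - h)"
          using p by (intro mult_left_mono power_decreasing) (auto simp: X_def)
        finally show ?thesis using n p c0 by (intro mult_left_mono) auto
      qed
      finally show ?thesis by (simp add: mult_ac)
    qed
  qed
  also have "\<dots> = n ^ k * (X * (\<Sum>h\<le>k. c h * p ^ h * (1 - p) ^ (N - h)))"
    by (simp add: sum_distrib_left)
  also have "\<dots> \<le> n ^ k * (X * bern p H Q)"
  proof -
    have "c h = 0" if "h > N" for h
    proof -
      have "nsets H h = {}" using that fin unfolding N_def by (simp add: nsets_eq_empty)
      then show ?thesis by (simp add: c_def)
    qed
    then have "(\<Sum>h\<le>k. c h * p ^ h * (1 - p) ^ (N - h)) = (\<Sum>h\<in>{..k} \<inter> {..N}. c h * p ^ h * (1 - p) ^ (N - h))"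
      by (intro sum.mono_neutral_right) auto
    also have "\<dots> \<le> (\<Sum>h\<le>N. c h * p ^ h * (1 - p) ^ (N - h))"
      using p c0 by (intro sum_mono2) auto
    finally show ?thesis unfolding bern_eq_sum_nsets[OF fin(1)] N_def c_def
      using n by (intro mult_left_mono) (auto simp: X_def)
  qed
  also have "\<dots> \<le> n ^ k * (X * (1 / exp 1 + real N * p\<^sup>2))"
  proof (intro mult_left_mono)
    show "bern p H Q \<le> 1 / exp 1 + real N * p\<^sup>2"
      unfolding N_def by (rule bern_antichain) (use fin p Q0 anti in auto)
  qed (use n in \<open>auto simp: X_def\<close>)
  also have "real N * p\<^sup>2 = \<nu> * (real k)\<^sup>2 / n"
    using n by (simp add: N p_def power2_eq_square)
  finally show ?thesis
    unfolding lavg_def n_def[symmetric] X_def using n by (simp add: divide_le_eq mult.commute)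
qed

lemma ldeg_filter: "ldeg r (filter P xs) y + ldeg r (filter (\<lambda>x. \<not> P x) xs) y = ldeg r xs y"
  by (induction xs) auto

lemma ecount_filter_append:
  assumes "symp r"
  shows "ecount r (filter P xs @ filter (\<lambda>x. \<not> P x) xs) = ecount r xs"
proof (induction xs)
  case (Cons x xs)
  have mid: "ecount r (as @ x # bs) = ecount r (x # as @ bs)" for as bs
    by (simp add: ecount_append[OF assms])
  show ?case
    using Cons ldeg_filter[of r P xs x] by (cases "P x") (auto simp: mid)
qed simp

lemma ldeg_distinct: "distinct hs \<Longrightarrow> ldeg r hs y = int (card {x \<in> set hs. r y x})"
proof (induction hs)
  case (Cons x hs)
  have "{z \<in> set (x # hs). r y z} = (if r y x then insert x {z \<in> set hs. r y z} else {z \<in> set hs. r y z})"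
    by auto
  then show ?case using Cons by simp
qed simp

section \<open>Large edge counts\<close>

text \<open>Chains the two preceding results, with weights \<open>ldeg r hs\<close> in the first,
  and restores \<open>k\<close> in place of the number \<open>k - length hs\<close> of sampled
  non-hubs: the latter is at least \<open>k / 2\<close>, and \<open>m * length hs\<close> is at most
  \<open>hmax * hmax\<close>.\<close>

lemma rigid_hubs:
  fixes hmax :: nat
  assumes \<eta>: "\<eta> > 0" and \<Omega>: "\<Omega> > 0"
  obtains C2 C3 N :: real where "C2 > 0" "C3 > 0" "N > 0"
    "\<And>(L :: 'a set) r hs k l. finite L \<Longrightarrow> L \<noteq> {} \<Longrightarrow> symp r \<Longrightarrow> N \<le> real k \<Longrightarrow> length hs \<le> hmax \<Longrightarrow>
       (\<And>y. y \<in> L \<Longrightarrow> ndeg r L y \<le> \<Omega> / real k) \<Longrightarrow>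
       \<eta> \<le> lavg L (k - length hs) (\<lambda>ls. of_bool (ecount r (hs @ ls) = l)) \<Longrightarrow>
       \<exists>m. 0 \<le> m \<and> avg L (\<lambda>y. of_bool (ldeg r hs y \<noteq> m)) \<le> C2 / real k \<and>
           \<bar>real_of_int l - real_of_int m * real k\<bar> \<le> C3"
proof (rule sparse_of_bounded_degree[OF \<eta> \<Omega>, where 'a = 'a], goal_cases)
  case (1 C0 N0)
  note C0 = 1(2,3) and sparse = 1(4)
  obtain C2 C3 :: real where C23: "C2 > 0" "C3 > 0"
    and rigid: "\<And>(L :: 'a set) r hs k l. finite L \<Longrightarrow> L \<noteq> {} \<Longrightarrow> symp r \<Longrightarrow> k > 0 \<Longrightarrow> length hs \<le> hmax \<Longrightarrow>
       avg L (ndeg r L) \<le> C0 / (real k)\<^sup>2 \<Longrightarrow>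
       \<eta> \<le> lavg L k (\<lambda>ls. of_bool (ecount r (hs @ ls) = l)) \<Longrightarrow>
       \<exists>m. 0 \<le> m \<and> m \<le> int hmax \<and> avg L (\<lambda>y. of_bool (ldeg r hs y \<noteq> m)) \<le> C2 / real k \<and>
           \<bar>real_of_int l - real_of_int m * real k\<bar> \<le> C3"
    by (rule rigid_of_likely[OF \<eta> C0(1), where 'a = 'a and hmax = hmax]) blast
  define N where "N = 2 * N0 + 2 * real hmax + 1"
  show ?thesis
  proof (rule that[of "2 * C2" "C3 + real hmax * real hmax" N])
    show "2 * C2 > 0" "C3 + real hmax * real hmax > 0" "N > 0"
      using C0 C23 by (auto simp: N_def add_pos_nonneg)
    fix L :: "'a set" and r hs and k :: nat and l :: int
    assume L: "finite L" "L \<noteq> {}" and r: "symp r" and k: "N \<le> real k" and hs: "length hs \<le> hmax"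
      and deg: "\<And>y. y \<in> L \<Longrightarrow> ndeg r L y \<le> \<Omega> / real k"
      and P: "\<eta> \<le> lavg L (k - length hs) (\<lambda>ls. of_bool (ecount r (hs @ ls) = l))"
    define k' where "k' = k - length hs"
    have "real (length hs) \<le> real hmax" using hs by simp
    then have "2 * real (length hs) < real k" using k C0 unfolding N_def by linarith
    then have k': "real k' = real k - real (length hs)" "real k' \<ge> real k / 2" "k' > 0" by (auto simp: k'_def of_nat_diff)
    have k0: "real k > 0" using k C0 unfolding N_def by linarith
    have "avg L (ndeg r L) \<le> C0 / (real k')\<^sup>2"
    proof (rule sparse[OF L r])
      show "N0 \<le> real k'" using k k'(2) by (simp add: N_def)
      show "\<eta> \<le> lavg L k' (\<lambda>ls. of_bool (ecount r ls + (\<Sum>x\<leftarrow>ls. ldeg r hs x) = l - ecount r hs))"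
      proof -
        have "(ecount r (hs @ ls) = l) = (ecount r ls + (\<Sum>x\<leftarrow>ls. ldeg r hs x) = l - ecount r hs)" for ls
          by (auto simp: ecount_append[OF r])
        then show ?thesis using P by (simp add: k'_def)
      qed
      fix y assume "y \<in> L"
      then have "ndeg r L y \<le> \<Omega> / real k" by (rule deg)
      also have "\<dots> \<le> \<Omega> / real k'" using \<Omega> k0 k' by (intro divide_left_mono) auto
      finally show "ndeg r L y \<le> \<Omega> / real k'" .
    qed
    from rigid[OF L r k'(3) hs this P[folded k'_def]] obtain m
      where m: "0 \<le> m" "m \<le> int hmax" "avg L (\<lambda>y. of_bool (ldeg r hs y \<noteq> m)) \<le> C2 / real k'"
        "\<bar>real_of_int l - real_of_int m * real k'\<bar> \<le> C3" by blast
    have "C2 / real k' \<le> C2 / (real k / 2)" using C23 k0 k' by (intro divide_left_mono) auto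
    also have "\<dots> = 2 * C2 / real k" by simp
    finally have 1: "avg L (\<lambda>y. of_bool (ldeg r hs y \<noteq> m)) \<le> 2 * C2 / real k" using m(3) by (rule order.trans[rotated])
    have "real_of_int m \<le> real_of_int (int hmax)" using m(2) by (simp only: of_int_le_iff)
    then have "real_of_int m * real (length hs) \<le> real hmax * real hmax"
      using hs m(1) by (intro mult_mono) auto
    moreover have "0 \<le> real_of_int m * real (length hs)" using m(1) by simp
    ultimately have "\<bar>real_of_int l - real_of_int m * real k\<bar> \<le> C3 + real hmax * real hmax"
      using m(4) unfolding k'(1) right_diff_distrib by linarith
    then show "\<exists>m. 0 \<le> m \<and> avg L (\<lambda>y. of_bool (ldeg r hs y \<noteq> m)) \<le> 2 * C2 / real k \<and>
           \<bar>real_of_int l - real_of_int m * real k\<bar> \<le> C3 + real hmax * real hmax"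
      using m(1) 1 by blast
  qed
qed

lemma exists_small_decrement:
  fixes f :: "nat \<Rightarrow> real"
  assumes "\<And>i. 0 \<le> f i" "f 0 \<le> real T * \<delta>" "T > 0"
  obtains i where "i < T" "f i - f (Suc i) \<le> \<delta>"
proof -
  have "\<exists>i<T. f i - f (Suc i) \<le> \<delta>"
  proof (rule ccontr)
    assume "\<not> ?thesis"
    then have "(\<Sum>i<T. \<delta>) < (\<Sum>i<T. f i - f (Suc i))"
      using assms by (intro sum_strict_mono) auto
    also have "\<dots> = f 0 - f T" by (rule sum_lessThan_telescope')
    finally show False using assms(1)[of T] assms(2) by simp
  qed
  then show ?thesis using that by blast
qed

text \<open>The event is covered by five: a vertex from the gap is sampled, there are more than
  \<open>hmax\<close> hubs, a vertex repeats, the hub set is not rigid although \<open>l\<close> is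
  hit, or the hub set is rigid. Each of the first four has probability at most
  \<open>\<delta>1\<close>, and the last is an antichain event. The proof is by contradiction
  because \<open>avg_ndeg_le\<close> and \<open>hubs_rare\<close> start from a lower bound on the
  probability.\<close>

theorem lavg_ecount_le:
  assumes \<delta>: "\<delta> > (0::real)"
  obtains l0 k0 :: nat where
    "\<And>(V :: 'a set) r k l. finite V \<Longrightarrow> symp r \<Longrightarrow> k0 \<le> k \<Longrightarrow> k ^ 3 \<le> card V \<Longrightarrow> l0 \<le> l \<Longrightarrow>
       real l \<le> (real k)\<^sup>2 / 2000000 \<Longrightarrow>
       lavg V k (\<lambda>xs. of_bool (ecount r xs = int l)) \<le> 1 / exp 1 + \<delta>"
proof (rule hubs_rare[OF \<delta>, where 'a = 'a], goal_cases)
  case (1 K)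
  note K = 1(2) and hubs = 1(3)
  \<comment> \<open>Five error terms of this size are collected at the end.\<close>
  define \<delta>1 where "\<delta>1 = \<delta> / 8"
  have d1: "\<delta>1 > 0" using \<delta> by (simp add: \<delta>1_def)
  define hmax where "hmax = nat \<lceil>K / \<delta>1\<rceil> + 1"
  have "K / \<delta>1 \<le> real (nat \<lceil>K / \<delta>1\<rceil>)" by (rule real_nat_ceiling_ge)
  then have hmax: "K / \<delta>1 \<le> real hmax" "hmax > 0" by (auto simp: hmax_def)
  \<comment> \<open>Bundled as a predicate so that the constants can be chosen as functions of the
    scale, which the recursion for the scales feeds back. The factor 2 appears because the non-hubs
    make up at least half of \<open>V\<close>, so degrees relative to them at most double.\<close>
  define good where "good \<Omega> C2 C3 N \<longleftrightarrow> C2 > 0 \<and> C3 > 0 \<and> N > 0 \<and>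
    (\<forall>(L :: 'a set) r hs k l. finite L \<longrightarrow> L \<noteq> {} \<longrightarrow> symp r \<longrightarrow> N \<le> real k \<longrightarrow> length hs \<le> hmax \<longrightarrow>
       (\<forall>y\<in>L. ndeg r L y \<le> 2 * \<Omega> / real k) \<longrightarrow>
       \<delta>1 \<le> lavg L (k - length hs) (\<lambda>ls. of_bool (ecount r (hs @ ls) = l)) \<longrightarrow>
       (\<exists>m. 0 \<le> m \<and> avg L (\<lambda>y. of_bool (ldeg r hs y \<noteq> m)) \<le> C2 / real k \<and>
           \<bar>real_of_int l - real_of_int m * real k\<bar> \<le> C3))" for \<Omega> C2 C3 N :: real
  have ex: "\<exists>C2 C3 N. good \<Omega> C2 C3 N" if "\<Omega> > 0" for \<Omega> :: real
  proof -
    have "2 * \<Omega> > 0" using that by simp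
    then show ?thesis
      unfolding good_def by (rule rigid_hubs[OF d1, where 'a = 'a and hmax = hmax]) (intro exI conjI; blast)
  qed
  have "\<forall>\<Omega>. \<exists>t. \<Omega> > 0 \<longrightarrow> good \<Omega> (fst t) (fst (snd t)) (snd (snd t))"
    using ex by auto
  from choice[OF this] obtain t where
    t: "\<And>\<Omega>. \<Omega> > 0 \<Longrightarrow> good \<Omega> (fst (t \<Omega>)) (fst (snd (t \<Omega>))) (snd (snd (t \<Omega>)))" by blast
  define c2 c3 bigN where "c2 \<Omega> = fst (t \<Omega>)" and "c3 \<Omega> = fst (snd (t \<Omega>))" and "bigN \<Omega> = snd (snd (t \<Omega>))" for \<Omega>
  have good: "\<And>\<Omega>. \<Omega> > 0 \<Longrightarrow> good \<Omega> (c2 \<Omega>) (c3 \<Omega>) (bigN \<Omega>)"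
    using t by (simp add: c2_def c3_def bigN_def)
  \<comment> \<open>Increasing scales of degrees. By pigeonhole, some gap between consecutive scales contains so few
    degrees that the sample avoids it with probability close to \<open>1\<close>. Hubs above such a gap
    cannot be confused with the error terms produced by the vertices below it.\<close>
  define \<Omega> where "\<Omega> = rec_nat K (\<lambda>_ x. x + 2 * c2 x + K)"
  have \<Omega>0: "\<Omega> 0 = K" and \<Omega>S: "\<Omega> (Suc i) = \<Omega> i + 2 * c2 (\<Omega> i) + K" for i
    by (auto simp: \<Omega>_def)
  have \<Omega>K: "K \<le> \<Omega> i" for i
  proof (induction i)
    case (Suc i)
    then have "\<Omega> i > 0" using K by linarith
    then have "c2 (\<Omega> i) > 0" using good by (auto simp: good_def)
    then show ?case using Suc K by (simp add: \<Omega>S)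
  qed (simp add: \<Omega>0)
  have \<Omega>pos: "\<Omega> i > 0" for i using \<Omega>K[of i] K by linarith
  have g: "c2 (\<Omega> i) > 0" "c3 (\<Omega> i) > 0" for i using good[OF \<Omega>pos[of i]] by (auto simp: good_def)
  define T where "T = nat \<lceil>K / \<delta>1\<rceil> + 1"
  have "K / \<delta>1 \<le> real (nat \<lceil>K / \<delta>1\<rceil>)" by (rule real_nat_ceiling_ge)
  then have T: "K / \<delta>1 \<le> real T" "T > 0" by (auto simp: T_def)
  define C2 where "C2 = (\<Sum>i<T. c2 (\<Omega> i))"
  define C3 where "C3 = (\<Sum>i<T. c3 (\<Omega> i))"
  define N where "N = (\<Sum>i<T. \<bar>bigN (\<Omega> i)\<bar>)"
  have C2: "c2 (\<Omega> i) \<le> C2" if "i < T" for i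
    unfolding C2_def using that g by (intro member_le_sum) (auto intro: less_imp_le)
  have C3: "c3 (\<Omega> i) \<le> C3" if "i < T" for i
    unfolding C3_def using that g by (intro member_le_sum) (auto intro: less_imp_le)
  have N: "bigN (\<Omega> i) \<le> N" if "i < T" for i
  proof -
    have "\<bar>bigN (\<Omega> i)\<bar> \<le> N" unfolding N_def using that by (intro member_le_sum) auto
    then show ?thesis by linarith
  qed
  \<comment> \<open>Being larger than the error \<open>c3 W\<close>, \<open>l\<close> rules out
    \<open>m = 0\<close>, the only value with which the empty hub set could satisfy
    \<open>Q\<close>.\<close>
  define l0 where "l0 = nat \<lceil>C3\<rceil> + 1"
  define B where "B = K * real hmax + 2 * K"
  have "(\<lambda>k. exp (B / real k) * (1 / exp 1 + K / real k)) \<longlonglongrightarrow> exp 0 * (1 / exp 1 + 0)"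
    by (intro tendsto_intros lim_const_over_n)
  then have "eventually (\<lambda>k. exp (B / real k) * (1 / exp 1 + K / real k) < 1 / exp 1 + \<delta>1) sequentially"
    using d1 by (intro order_tendstoD(2)) auto
  then obtain k1 where k1: "\<And>k. k \<ge> k1 \<Longrightarrow> exp (B / real k) * (1 / exp 1 + K / real k) < 1 / exp 1 + \<delta>1"
    by (auto simp: eventually_sequentially)
  define k2 where "k2 = nat \<lceil>N + 2 * K + 1 / \<delta>1 + 1000000 / \<delta> + C2 + 2 * C3\<rceil> + 2"
  show ?thesis
  proof (rule that[of "max k1 k2" l0], rule ccontr)
    fix V :: "'a set" and r :: "'a \<Rightarrow> 'a \<Rightarrow> bool" and k l :: nat
    assume V: "finite V" and r: "symp r" and kk: "max k1 k2 \<le> k" and nk: "k ^ 3 \<le> card V"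
      and l: "l0 \<le> l" "real l \<le> (real k)\<^sup>2 / 2000000"
    assume "\<not> lavg V k (\<lambda>xs. of_bool (ecount r xs = int l)) \<le> 1 / exp 1 + \<delta>"
    then have P: "lavg V k (\<lambda>xs. of_bool (ecount r xs = int l)) > 1 / exp 1 + \<delta>" by simp
    have N0: "N \<ge> 0" unfolding N_def by (intro sum_nonneg) auto
    have C20: "C2 \<ge> 0" "C3 \<ge> 0" using less_imp_le[OF g(1)] less_imp_le[OF g(2)] unfolding C2_def C3_def by (simp_all add: sum_nonneg)
    have dd: "1 / \<delta>1 > 0" "1000000 / \<delta> > 0" using \<delta> d1 by auto
    have "N + 2 * K + 1 / \<delta>1 + 1000000 / \<delta> + C2 + 2 * C3 \<le> real (nat \<lceil>N + 2 * K + 1 / \<delta>1 + 1000000 / \<delta> + C2 + 2 * C3\<rceil>)"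
      by (rule real_nat_ceiling_ge)
    moreover have "real k2 \<le> real k" using kk by simp
    ultimately have big: "N + 2 * K + 1 / \<delta>1 + 1000000 / \<delta> + C2 + 2 * C3 + 2 \<le> real k"
      unfolding k2_def by linarith
    have kN: "N \<le> real k" and k2K: "2 * K \<le> real k" and kd1: "1 / \<delta>1 \<le> real k" and kd: "1000000 / \<delta> \<le> real k"
      and kC2: "C2 < real k" and kC3: "2 * C3 < real k" and k2: "2 \<le> real k"
      using big N0 K C20 dd by linarith+
    have k0: "real k > 0" using k2 by linarith
    define n where "n = real (card V)"
    have nk3: "(real k) ^ 3 \<le> n" unfolding n_def using nk by (metis of_nat_le_iff of_nat_power)
    then have n0: "n > 0" using k0 by (smt (verit) zero_less_power)
    have Vne: "V \<noteq> {}" using n0 by (auto simp: n_def)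
    have kn: "(real k)\<^sup>2 / n \<le> 1 / real k"
      using nk3 k0 n0 by (simp add: field_simps power2_eq_square power3_eq_cube)
    have Pd: "\<delta> \<le> lavg V k (\<lambda>xs. of_bool (ecount r xs = int l))"
    proof -
      have "0 < 1 / exp (1::real)" by simp
      then show ?thesis using P by linarith
    qed
    have p: "avg V (ndeg r V) \<le> 1 / 100"
    proof (rule avg_ndeg_le[OF V Vne r])
      show "2 \<le> k" using k2 by simp
      show "real_of_int (int l) \<le> (real k)\<^sup>2 / 2000000" using l by simp
      have "1000000 / real k \<le> \<delta>" using kd \<delta> k0 by (simp add: field_simps)
      moreover have "0 < 1 / exp (1::real)" by simp
      ultimately show "1000000 / real k < lavg V k (\<lambda>xs. of_bool (ecount r xs = int l))" using P by linarith
    qed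
    define f where "f x = avg V (\<lambda>z. of_bool (ndeg r V z > x / real k))" for x
    have fK: "f K \<le> K / real k"
      unfolding f_def by (rule hubs[OF V Vne r _ p Pd]) (use k2K K in linarith)
    have f0: "0 \<le> f x" for x unfolding f_def by (intro avg_nonneg) auto
    have fmono: "f x \<le> f y" if "y \<le> x" for x y
      unfolding f_def
    proof (rule avg_mono)
      fix z
      have "y / real k \<le> x / real k" using that by (intro divide_right_mono) auto
      then show "of_bool (ndeg r V z > x / real k) \<le> (of_bool (ndeg r V z > y / real k) :: real)" by auto
    qed
    obtain i where i: "i < T" "f (\<Omega> i) - f (\<Omega> (Suc i)) \<le> \<delta>1 / real k"
    proof (rule exists_small_decrement[of "\<lambda>i. f (\<Omega> i)" T "\<delta>1 / real k"])
      have "K \<le> real T * \<delta>1" using T d1 by (simp add: pos_divide_le_eq)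
      then have "K / real k \<le> real T * \<delta>1 / real k" by (intro divide_right_mono) auto
      then show "f (\<Omega> 0) \<le> real T * (\<delta>1 / real k)" using fK by (simp add: \<Omega>0)
    qed (use f0 T in auto)
    define W where "W = \<Omega> i"
    define W' where "W' = \<Omega> (Suc i)"
    have W: "K \<le> W" "W > 0" using \<Omega>K \<Omega>pos by (auto simp: W_def)
    have W': "W' = W + 2 * c2 W + K" by (simp add: W'_def W_def \<Omega>S)
    have gW: "c2 W > 0" "c3 W > 0" using g by (auto simp: W_def)
    have WW': "W \<le> W'" using gW K by (simp add: W')
    define H where "H = {y \<in> V. ndeg r V y > W' / real k}"
    define L where "L = {y \<in> V. ndeg r V y \<le> W / real k}"
    have "W / real k \<le> W' / real k" using WW' by (intro divide_right_mono) auto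
    then have HL: "H \<inter> L = {}" by (auto simp: H_def L_def)
    have sub: "H \<subseteq> V" "L \<subseteq> V" by (auto simp: H_def L_def)
    have fin: "finite H" "finite L" using V by (auto simp: H_def L_def)
    have fW: "f W \<le> K / real k" "f W' \<le> K / real k" using fmono[of K W] fmono[of K W'] fK W WW' by linarith+
    have half: "K / real k \<le> 1/2" using k2K k0 by (simp add: field_simps)
    have cardL: "real (card L) \<ge> n / 2"
    proof -
      have "real (card L) / n = avg V (\<lambda>y. of_bool (ndeg r V y \<le> W / real k))"
        unfolding avg_def L_def n_def using V by (simp add: of_bool_def sum.If_cases Int_def)
      also have "\<dots> = avg V (\<lambda>y. 1 - of_bool (ndeg r V y > W / real k))"
        by (rule avg_cong) auto
      also have "\<dots> = 1 - f W" by (simp add: avg_diff avg_const[OF V Vne] f_def)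
      finally have "1/2 \<le> real (card L) / n" using fW half by linarith
      then show ?thesis using n0 by (simp add: field_simps)
    qed
    then have Lne: "L \<noteq> {}" using n0 by auto
    have cardH: "real (card H) = f W' * real (card V)"
    proof -
      have "f W' = real (card H) / n"
        unfolding f_def avg_def H_def n_def using V by (simp add: of_bool_def sum.If_cases Int_def)
      then show ?thesis using n0 by (simp add: n_def)
    qed
    have avgL: "avg L \<phi> \<le> 2 * avg V \<phi>" if "\<And>y. y \<in> V \<Longrightarrow> 0 \<le> \<phi> y" for \<phi>
    proof -
      have s: "(\<Sum>x\<in>L. \<phi> x) \<le> (\<Sum>x\<in>V. \<phi> x)" using V sub that by (intro sum_mono2) auto
      have s0: "0 \<le> (\<Sum>x\<in>V. \<phi> x)" using that by (intro sum_nonneg) auto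
      have "avg L \<phi> \<le> (\<Sum>x\<in>V. \<phi> x) / real (card L)"
        unfolding avg_def using s by (intro divide_right_mono) auto
      also have "\<dots> \<le> (\<Sum>x\<in>V. \<phi> x) / (n / 2)"
        using s0 cardL n0 by (intro divide_left_mono mult_pos_pos) auto
      finally show ?thesis by (simp add: avg_def n_def mult.commute)
    qed
    have avgV: "avg V \<phi> \<le> avg L \<phi> + f W" if "\<And>y. y \<in> V \<Longrightarrow> 0 \<le> \<phi> y \<and> \<phi> y \<le> 1" for \<phi>
    proof -
      have "avg V \<phi> \<le> avg V (\<lambda>y. of_bool (y \<in> L) * \<phi> y + of_bool (ndeg r V y > W / real k))"
        by (rule avg_mono) (use that in \<open>auto simp: L_def\<close>)
      also have "\<dots> = avg V (\<lambda>y. of_bool (y \<in> L) * \<phi> y) + f W" by (simp add: avg_add f_def)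
      also have "avg V (\<lambda>y. of_bool (y \<in> L) * \<phi> y) = (\<Sum>y\<in>L. \<phi> y) / n"
        unfolding avg_def n_def[symmetric] using V sub
        by (intro arg_cong[where f = "\<lambda>x. x / n"] sum.mono_neutral_cong_right) auto
      also have "\<dots> \<le> avg L \<phi>"
      proof -
        have "0 < real (card L)" using cardL n0 by linarith
        moreover have "real (card L) \<le> n" unfolding n_def using V sub by (simp add: card_mono)
        moreover have "0 \<le> (\<Sum>y\<in>L. \<phi> y)" using that sub by (intro sum_nonneg) auto
        ultimately show ?thesis unfolding avg_def by (intro divide_left_mono mult_pos_pos) auto
      qed
      finally show ?thesis by simp
    qed
    define dg where "dg S y = int (card {x \<in> S. r y x})" for S y
    \<comment> \<open>The conclusion of \<open>rigid_hubs\<close>, as a property of the set of hubs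
      instead of the list.\<close>
    define Q where "Q S \<longleftrightarrow> S \<subseteq> H \<and> (\<exists>m. 0 \<le> m \<and> avg L (\<lambda>y. of_bool (dg S y \<noteq> m)) \<le> c2 W / real k \<and>
           \<bar>real l - real_of_int m * real k\<bar> \<le> c3 W)" for S
    have lC3: "real l > c3 W"
    proof -
      have "C3 \<le> real (nat \<lceil>C3\<rceil>)" by (rule real_nat_ceiling_ge)
      moreover have "real l0 \<le> real l" using l by simp
      ultimately show ?thesis using C3[OF i(1)] unfolding l0_def W_def by linarith
    qed
    have Q0: "\<not> Q {}"
    proof
      assume "Q {}"
      then obtain m where m: "avg L (\<lambda>y. of_bool (dg {} y \<noteq> m)) \<le> c2 W / real k"
        "\<bar>real l - real_of_int m * real k\<bar> \<le> c3 W" by (auto simp: Q_def)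
      show False
      proof (cases "m = 0")
        case True
        then show False using m(2) lC3 by simp
      next
        case False
        have "avg L (\<lambda>y. of_bool (dg {} y \<noteq> m)) = 1"
          using False avg_const[OF fin(2) Lne, of 1] by (simp add: dg_def)
        moreover have "c2 W / real k < 1" using C2[OF i(1)] kC2 k0 by (simp add: W_def)
        ultimately show False using m(1) by linarith
      qed
    qed
    \<comment> \<open>Both sets share the same \<open>m\<close>, since \<open>l\<close> determines
      it once \<open>k\<close> exceeds twice the error. A hub \<open>u\<close> in the difference can
      then only be adjacent to non-hubs that are exceptional for \<open>A\<close> or for
      \<open>B\<close>, so its degree is at most \<open>(2 * c2 W + K) / k\<close>, where
      \<open>K\<close> pays for the vertices outside \<open>L\<close>. This is why each scale
      exceeds the previous one by that amount.\<close>
    have anti: "A = B" if AB: "A \<subseteq> B" "B \<subseteq> H" "Q A" "Q B" for A B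
    proof (rule ccontr)
      assume "A \<noteq> B"
      then obtain u where u: "u \<in> B" "u \<notin> A" using AB by blast
      obtain m where m: "avg L (\<lambda>y. of_bool (dg A y \<noteq> m)) \<le> c2 W / real k"
        "\<bar>real l - real_of_int m * real k\<bar> \<le> c3 W" using AB by (auto simp: Q_def)
      obtain m' where m': "avg L (\<lambda>y. of_bool (dg B y \<noteq> m')) \<le> c2 W / real k"
        "\<bar>real l - real_of_int m' * real k\<bar> \<le> c3 W" using AB by (auto simp: Q_def)
      have "m = m'"
      proof (rule ccontr)
        assume "m \<noteq> m'"
        then have "1 \<le> \<bar>m - m'\<bar>" by linarith
        then have "1 \<le> \<bar>real_of_int m - real_of_int m'\<bar>" by linarith
        then have "1 * real k \<le> \<bar>real_of_int m - real_of_int m'\<bar> * real k" by (intro mult_right_mono) auto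
        also have "\<dots> = \<bar>real_of_int m * real k - real_of_int m' * real k\<bar>"
          by (simp add: abs_mult left_diff_distrib[symmetric])
        also have "\<dots> \<le> 2 * c3 W" using m(2) m'(2) by linarith
        finally show False using C3[OF i(1)] kC3 by (simp add: W_def)
      qed
      have "avg L (\<lambda>y. of_bool (r u y)) \<le> avg L (\<lambda>y. of_bool (dg A y \<noteq> m) + of_bool (dg B y \<noteq> m'))"
      proof (rule avg_mono)
        fix y
        have "dg A y < dg B y" if "r u y"
        proof -
          have "r y u" using that r by (auto dest: sympD)
          then have "{x \<in> A. r y x} \<subset> {x \<in> B. r y x}" using u AB by auto
          moreover have "finite {x \<in> B. r y x}" using AB fin by (auto intro: finite_subset)
          ultimately show ?thesis by (simp add: dg_def psubset_card_mono)
        qed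
        then show "of_bool (r u y) \<le> (of_bool (dg A y \<noteq> m) + of_bool (dg B y \<noteq> m') :: real)"
          using \<open>m = m'\<close> by auto
      qed
      also have "\<dots> \<le> c2 W / real k + c2 W / real k" unfolding avg_add by (intro add_mono m m')
      finally have "ndeg r V u \<le> c2 W / real k + c2 W / real k + K / real k"
        unfolding ndeg_def using avgV[of "\<lambda>y. of_bool (r u y)"] fW by auto
      also have "\<dots> = (2 * c2 W + K) / real k" by (simp add: add_divide_distrib)
      also have "\<dots> \<le> W' / real k" using W unfolding W' by (intro divide_right_mono) auto
      finally show False using u AB by (auto simp: H_def)
    qed
    define hs where "hs xs = filter (\<lambda>x. x \<in> H) xs" for xs
    define ls where "ls xs = filter (\<lambda>x. x \<notin> H) xs" for xs
    have gap: "lavg V k (\<lambda>xs. of_bool (\<not> set xs \<subseteq> H \<union> L)) \<le> \<delta>1"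
    proof -
      have "lavg V k (\<lambda>xs. of_bool (\<not> set xs \<subseteq> H \<union> L)) \<le> lavg V k (\<lambda>xs. \<Sum>x\<leftarrow>xs. of_bool (x \<notin> H \<union> L))"
      proof (rule lavg_mono)
        fix xs
        have nn: "0 \<le> (\<Sum>x\<leftarrow>xs. (of_bool (x \<notin> H \<union> L) :: real))" for xs by (rule sum_list_nonneg) auto
        show "of_bool (\<not> set xs \<subseteq> H \<union> L) \<le> (\<Sum>x\<leftarrow>xs. (of_bool (x \<notin> H \<union> L) :: real))"
        proof (induction xs)
          case (Cons x xs)
          have "(\<not> set (x # xs) \<subseteq> H \<union> L) = (x \<notin> H \<union> L \<or> \<not> set xs \<subseteq> H \<union> L)" by simp
          then show ?case using nn[of xs] Cons by (cases "x \<in> H \<union> L") (simp_all del: Un_iff)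
        qed simp
      qed
      also have "\<dots> = real k * avg V (\<lambda>x. of_bool (x \<notin> H \<union> L))" by (rule lavg_sum_list[OF V Vne])
      also have "avg V (\<lambda>x. of_bool (x \<notin> H \<union> L)) = f W - f W'"
        unfolding f_def avg_diff[symmetric]
        by (rule avg_cong) (use \<open>W / real k \<le> W' / real k\<close> in \<open>auto simp: H_def L_def\<close>)
      also have "real k * \<dots> \<le> real k * (\<delta>1 / real k)"
        using i(2) by (intro mult_left_mono) (auto simp: W_def W'_def)
      finally show ?thesis using k0 by simp
    qed
    have many: "lavg V k (\<lambda>xs. of_bool (\<not> length (hs xs) \<le> hmax)) \<le> \<delta>1"
    proof -
      have len: "(\<Sum>x\<leftarrow>xs. of_bool (x \<in> H)) = real (length (hs xs))" for xs
        by (induction xs) (auto simp: hs_def)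
      have "lavg V k (\<lambda>xs. of_bool (\<not> length (hs xs) \<le> hmax)) \<le> lavg V k (\<lambda>xs. of_bool (real (length (hs xs)) \<ge> real hmax))"
        by (rule lavg_mono) auto
      also have "\<dots> \<le> lavg V k (\<lambda>xs. real (length (hs xs))) / real hmax"
        by (rule lavg_markov) (use hmax in auto)
      also have "lavg V k (\<lambda>xs. real (length (hs xs))) = real k * avg V (\<lambda>x. of_bool (x \<in> H))"
        unfolding len[symmetric] by (rule lavg_sum_list[OF V Vne])
      also have "avg V (\<lambda>x. of_bool (x \<in> H)) = f W'"
        unfolding f_def by (rule avg_cong) (auto simp: H_def)
      also have "real k * f W' / real hmax \<le> K / real hmax"
        using fW k0 hmax by (intro divide_right_mono) (auto simp: field_simps)
      also have "\<dots> \<le> \<delta>1" using hmax d1 by (simp add: field_simps)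
      finally show ?thesis .
    qed
    have dist: "lavg V k (\<lambda>xs. of_bool (\<not> distinct xs)) \<le> \<delta>1"
    proof -
      have "1 / real k \<le> \<delta>1" using kd1 d1 k0 by (simp add: field_simps)
      then show ?thesis using lavg_not_distinct_le[OF V Vne, of k] kn unfolding n_def by linarith
    qed
    \<comment> \<open>Conditioned on the sampled hubs, this is the contrapositive of
      \<open>rigid_hubs\<close>: if they do not satisfy \<open>Q\<close>, the remaining entries hit
      \<open>l\<close> with probability below \<open>\<delta>1\<close>.\<close>
    have flexible: "lavg V k (\<lambda>xs. of_bool (set xs \<subseteq> H \<union> L \<and> distinct (hs xs) \<and> length (hs xs) \<le> hmax \<and>
        \<not> Q (set (hs xs)) \<and> ecount r xs = int l)) \<le> \<delta>1"
    proof -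
      define F where "F us vs = (of_bool (set us \<subseteq> H \<and> distinct us \<and> length us \<le> hmax \<and> \<not> Q (set us) \<and> ecount r (us @ vs) = int l) :: real)" for us vs
      have "lsum V k (\<lambda>xs. of_bool (set xs \<subseteq> H \<union> L \<and> distinct (hs xs) \<and> length (hs xs) \<le> hmax \<and>
        \<not> Q (set (hs xs)) \<and> ecount r xs = int l)) = lsum V k (\<lambda>xs. of_bool (set xs \<subseteq> H \<union> L) * F (hs xs) (ls xs))"
        by (rule lsum_cong) (auto simp: F_def hs_def ls_def ecount_filter_append[OF r])
      also have "\<dots> = lsum (H \<union> L) k (\<lambda>xs. F (hs xs) (ls xs))"
        using V sub by (intro lsum_restrict) auto
      also have "\<dots> = (\<Sum>h\<le>k. real (k choose h) * lsum H h (\<lambda>us. lsum L (k - h) (\<lambda>vs. F us vs)))"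
        unfolding hs_def ls_def by (rule lsum_filter_split[OF fin HL])
      also have "\<dots> \<le> (\<Sum>h\<le>k. real (k choose h) * lsum H h (\<lambda>us. \<delta>1 * real (card L) ^ (k - h)))"
      proof (intro sum_mono mult_left_mono lsum_mono)
        fix h and us :: "'a list"
        assume us: "set us \<subseteq> H" "length us = h"
        have cL: "real (card L) > 0" using cardL n0 by linarith
        show "lsum L (k - h) (\<lambda>vs. F us vs) \<le> \<delta>1 * real (card L) ^ (k - h)"
        proof (cases "distinct us \<and> length us \<le> hmax \<and> \<not> Q (set us)")
          case False
          then have "lsum L (k - h) (\<lambda>vs. F us vs) = lsum L (k - h) (\<lambda>vs. 0)"
            by (intro lsum_cong) (auto simp: F_def)
          then show ?thesis using d1 by simp
        next
          case True
          have "lavg L (k - length us) (\<lambda>vs. of_bool (ecount r (us @ vs) = int l)) < \<delta>1"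
          proof (rule ccontr)
            assume "\<not> ?thesis"
            then have ge: "\<delta>1 \<le> lavg L (k - length us) (\<lambda>vs. of_bool (ecount r (us @ vs) = int l))" by simp
            have "\<forall>y\<in>L. ndeg r L y \<le> 2 * W / real k"
            proof
              fix y assume "y \<in> L"
              then have "ndeg r V y \<le> W / real k" by (simp add: L_def)
              moreover have "ndeg r L y \<le> 2 * ndeg r V y" unfolding ndeg_def by (rule avgL) auto
              ultimately show "ndeg r L y \<le> 2 * W / real k" by simp
            qed
            moreover have "bigN W \<le> real k" using N[OF i(1)] kN by (simp add: W_def)
            ultimately have "\<exists>m. 0 \<le> m \<and> avg L (\<lambda>y. of_bool (ldeg r us y \<noteq> m)) \<le> c2 W / real k \<and>
               \<bar>real_of_int (int l) - real_of_int m * real k\<bar> \<le> c3 W"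
              using good[OF W(2)] fin Lne r True ge unfolding good_def by blast
            then have "Q (set us)" using us True by (auto simp: Q_def dg_def ldeg_distinct)
            then show False using True by simp
          qed
          moreover have "lavg L (k - h) (\<lambda>vs. F us vs) = lavg L (k - length us) (\<lambda>vs. of_bool (ecount r (us @ vs) = int l))"
            unfolding us(2) by (rule lavg_cong) (use True us in \<open>auto simp: F_def\<close>)
          ultimately have "lavg L (k - h) (\<lambda>vs. F us vs) \<le> \<delta>1" by simp
          then show ?thesis using cL by (simp add: lavg_def divide_le_eq)
        qed
      qed simp
      also have "\<dots> = \<delta>1 * (\<Sum>h\<le>k. real (k choose h) * real (card H) ^ h * real (card L) ^ (k - h))"
        by (simp add: lsum_const sum_distrib_left mult_ac)
      also have "\<dots> = \<delta>1 * (real (card H) + real (card L)) ^ k"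
        by (simp add: binomial_ring)
      also have "\<dots> \<le> \<delta>1 * n ^ k"
      proof -
        have "card H + card L = card (H \<union> L)" using fin HL by (simp add: card_Un_disjoint)
        also have "\<dots> \<le> card V" using sub V by (intro card_mono) auto
        finally have "real (card H) + real (card L) \<le> n" unfolding n_def by (simp only: of_nat_add[symmetric] of_nat_le_iff)
        then show ?thesis using d1 by (intro mult_left_mono power_mono) auto
      qed
      finally show ?thesis unfolding lavg_def n_def[symmetric] using n0 by (simp add: divide_le_eq)
    qed
    have rigid: "lavg V k (\<lambda>xs. of_bool (set xs \<subseteq> H \<union> L \<and> distinct xs \<and> length (hs xs) \<le> hmax \<and> Q (set (hs xs)))) \<le> 1 / exp 1 + \<delta>1"
    proof -
      have kn2: "2 * k \<le> card V"
      proof -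
        have "2 * real k \<le> real k * real k * real k" using mult_mono[of 2 "real k" 1 "real k"] k2 by (intro mult_right_mono) auto
        then have "2 * real k \<le> n" using nk3 by (simp add: power3_eq_cube)
        then have "real (2 * k) \<le> real (card V)" by (simp add: n_def)
        then show ?thesis by (simp only: of_nat_le_iff)
      qed
      have fk: "f W' * (real k)\<^sup>2 / n \<le> K / real k"
      proof -
        have "f W' * ((real k)\<^sup>2 / n) \<le> (K / real k) * (1 / real k)"
          using fW f0 kn n0 K by (intro mult_mono) auto
        also have "\<dots> \<le> (K / real k) * 1" using k2 K by (intro mult_left_mono) auto
        finally show ?thesis by simp
      qed
      have "lavg V k (\<lambda>xs. of_bool (set xs \<subseteq> H \<union> L \<and> distinct xs \<and> length (hs xs) \<le> hmax \<and> Q (set (hs xs)))) \<le>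
        exp (f W' * real hmax + 2 * f W' * (real k)\<^sup>2 / n) * (1 / exp 1 + f W' * (real k)\<^sup>2 / n)"
        unfolding hs_def n_def by (rule hub_antichain_le[where Q = Q, OF V Vne sub HL kn2 Q0 anti cardH])
      also have "\<dots> \<le> exp (B / real k) * (1 / exp 1 + K / real k)"
      proof (intro mult_mono add_mono order.refl fk)
        have "f W' * real hmax \<le> K / real k * real hmax" using fW by (intro mult_right_mono) auto
        moreover have "B / real k = K / real k * real hmax + 2 * (K / real k)" by (simp add: B_def add_divide_distrib)
        moreover have "2 * f W' * (real k)\<^sup>2 / n = 2 * (f W' * (real k)\<^sup>2 / n)" by simp
        ultimately have "f W' * real hmax + 2 * f W' * (real k)\<^sup>2 / n \<le> B / real k" using fk by linarith
        then show "exp (f W' * real hmax + 2 * f W' * (real k)\<^sup>2 / n) \<le> exp (B / real k)" by simp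
        show "0 \<le> 1 / exp 1 + f W' * (real k)\<^sup>2 / n" using f0[of W'] n0 by simp
      qed simp
      also have "\<dots> \<le> 1 / exp 1 + \<delta>1" using k1[of k] kk by simp
      finally show ?thesis .
    qed
    have "lavg V k (\<lambda>xs. of_bool (ecount r xs = int l)) \<le> lavg V k (\<lambda>xs.
        of_bool (\<not> set xs \<subseteq> H \<union> L) + of_bool (\<not> length (hs xs) \<le> hmax) + of_bool (\<not> distinct xs) +
        of_bool (set xs \<subseteq> H \<union> L \<and> distinct (hs xs) \<and> length (hs xs) \<le> hmax \<and> \<not> Q (set (hs xs)) \<and> ecount r xs = int l) +
        of_bool (set xs \<subseteq> H \<union> L \<and> distinct xs \<and> length (hs xs) \<le> hmax \<and> Q (set (hs xs))))"
      by (rule lavg_mono) (auto simp: hs_def)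
    also have "\<dots> \<le> \<delta>1 + \<delta>1 + \<delta>1 + \<delta>1 + (1 / exp 1 + \<delta>1)"
      unfolding lavg_add by (intro add_mono gap many dist flexible rigid)
    finally show False using P d1 unfolding \<delta>1_def by linarith
  qed
qed

section \<open>The limit\<close>

lemma ecount_eq_induced_edges:
  assumes G: "simple_graph V E" and "distinct xs"
  shows "ecount (\<lambda>x y. {x, y} \<in> E) xs = int (card (induced_edges E (set xs)))"
  using assms(2)
proof (induction xs)
  case Nil
  have "e \<notin> E" if "e \<subseteq> {}" for e using G that by (auto simp: simple_graph_def nsets_def)
  then have "induced_edges E {} = {}" unfolding induced_edges_def by blast
  then show ?case by simp
next
  case (Cons x xs)
  have E: "E \<subseteq> nsets V 2" "finite V" using G by (auto simp: simple_graph_def)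
  then have finE: "finite E" by (meson finite_imp_finite_nsets finite_subset)
  define Y where "Y = {y \<in> set xs. {x, y} \<in> E}"
  have "e \<in> (\<lambda>y. {x, y}) ` Y" if e: "e \<in> E" "e \<subseteq> insert x (set xs)" "x \<in> e" for e
  proof -
    have "card e = 2" using e E by (auto simp: nsets_def)
    then obtain y where "e = {x, y}" "y \<noteq> x" using e(3) by (auto simp: card_2_iff)
    then show ?thesis using e by (auto simp: Y_def)
  qed
  then have "induced_edges E (set (x # xs)) = induced_edges E (set xs) \<union> (\<lambda>y. {x, y}) ` Y"
    by (auto simp: induced_edges_def Y_def)
  moreover have "induced_edges E (set xs) \<inter> (\<lambda>y. {x, y}) ` Y = {}"
    using Cons.prems by (auto simp: induced_edges_def)
  ultimately have "card (induced_edges E (set (x # xs))) = card (induced_edges E (set xs)) + card ((\<lambda>y. {x, y}) ` Y)"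
    using finE by (simp add: card_Un_disjoint induced_edges_def Y_def)
  also have "card ((\<lambda>y. {x, y}) ` Y) = card Y"
    by (intro card_image) (auto simp: inj_on_def doubleton_eq_iff)
  finally show ?case using Cons by (simp add: ldeg_distinct Y_def)
qed

text \<open>Given that the entries are distinct, their set is a uniform \<open>k\<close>-subset;
  repetitions have probability at most \<open>k ^ 2 / card V\<close>.\<close>

lemma induced_freq_le_lavg:
  assumes G: "simple_graph V E" and V: "V \<noteq> {}" and k: "k \<le> card V"
  shows "induced_freq V E k l \<le>
    lavg V k (\<lambda>xs. of_bool (ecount (\<lambda>x y. {x, y} \<in> E) xs = int l)) + (real k)\<^sup>2 / real (card V)"
proof -
  have fin: "finite V" using G by (simp add: simple_graph_def)
  define d where "d = lavg V k (\<lambda>xs. of_bool (distinct xs))"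
  define P where "P = lavg V k (\<lambda>xs. of_bool (ecount (\<lambda>x y. {x, y} \<in> E) xs = int l))"
  have "lavg V k (\<lambda>xs. of_bool (distinct xs) + of_bool (\<not> distinct xs)) = lavg V k (\<lambda>_. 1)"
    by (rule lavg_cong) auto
  then have "d + lavg V k (\<lambda>xs. of_bool (\<not> distinct xs)) = 1"
    unfolding lavg_add d_def lavg_const[OF fin V] .
  then have d: "1 - (real k)\<^sup>2 / real (card V) \<le> d"
    using lavg_not_distinct_le[OF fin V, of k] by linarith
  have d1: "d \<le> 1" unfolding d_def by (rule lavg_le_const[OF fin V]) auto
  have "lavg V k (\<lambda>xs. of_bool (distinct xs \<and> card (induced_edges E (set xs)) = l)) = induced_freq V E k l * d"
    using k lsum_distinct[OF fin, of k "\<lambda>_. True"] lsum_distinct[OF fin, of k "\<lambda>A. card (induced_edges E A) = l"]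
    by (simp add: lavg_def d_def induced_freq_def)
  moreover have "lavg V k (\<lambda>xs. of_bool (distinct xs \<and> card (induced_edges E (set xs)) = l)) \<le> P"
    unfolding P_def by (rule lavg_mono) (auto simp: ecount_eq_induced_edges[OF G])
  ultimately have "induced_freq V E k l * d \<le> P" by simp
  moreover have "induced_freq V E k l * (1 - d) \<le> 1 * (1 - d)"
    using induced_freq_bounds[OF fin] d1 by (intro mult_right_mono) auto
  ultimately show ?thesis using d unfolding P_def[symmetric] right_diff_distrib by linarith
qed

text \<open>Only large \<open>n\<close> matter for the limit, so \<open>k ^ 3 <= n\<close> may be
  assumed; this makes the repetition error \<open>k ^ 2 / n\<close> at most
  \<open>1 / k\<close>.\<close>

lemma edge_inducibility_le:
  assumes "\<And>(V :: nat set) E. simple_graph V E \<Longrightarrow> k ^ 3 \<le> card V \<Longrightarrow> k \<le> card V \<Longrightarrow> induced_freq V E k l \<le> c"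
  shows "edge_inducibility k l \<le> c"
proof (rule LIMSEQ_le_const2[OF max_induced_prob_LIMSEQ], intro exI allI impI)
  fix n assume n: "max k (k ^ 3) \<le> n"
  then have kn: "k \<le> n" by simp
  obtain V :: "nat set" and E where G: "simple_graph V E" "card V = n"
    and m: "max_induced_prob n k l = pmf (induced_edge_count_pmf V E k) l"
    using max_induced_prob_attained[OF kn] by metis
  have "pmf (induced_edge_count_pmf V E k) l = induced_freq V E k l"
    unfolding induced_freq_def using G kn by (intro pmf_induced_edge_count) (auto simp: simple_graph_def)
  then show "max_induced_prob n k l \<le> c" using m assms[OF G(1)] G(2) n by simp
qed

theorem theorem1p4:
  fixes l :: "nat \<Rightarrow> nat"
  assumes "\<And>k. k \<ge> 1 \<Longrightarrow> l k \<ge> 1"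
    and "(\<lambda>k. real (l k) / real k powr (6 / 5)) \<longlonglongrightarrow> 0"
  shows "\<exists>\<epsilon> :: nat \<Rightarrow> real. \<epsilon> \<longlonglongrightarrow> 0 \<and>
           (\<forall>k\<ge>1. edge_inducibility k (l k) \<le> 1 / exp 1 + \<epsilon> k)"
proof -
  have bound: "eventually (\<lambda>k. edge_inducibility k (l k) \<le> 1 / exp 1 + \<delta>) sequentially" if \<delta>: "\<delta> > 0" for \<delta> :: real
  proof -
    have "\<delta> / 2 > 0" using \<delta> by simp
    then obtain l0 k0 :: nat where large:
      "\<And>(V :: nat set) r k l. finite V \<Longrightarrow> symp r \<Longrightarrow> k0 \<le> k \<Longrightarrow> k ^ 3 \<le> card V \<Longrightarrow> l0 \<le> l \<Longrightarrow>
       real l \<le> (real k)\<^sup>2 / 2000000 \<Longrightarrow>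
       lavg V k (\<lambda>xs. of_bool (ecount r xs = int l)) \<le> 1 / exp 1 + \<delta> / 2"
      by (rule lavg_ecount_le[where 'a = nat]) blast
    \<comment> \<open>For \<open>l k < l0\<close> the sample size is shifted by
      \<open>s = c * k\<close>. The bound \<open>1/4\<close> is required by
      \<open>induced_freq_le_of_small\<close>, and the other one makes the deletion error at most
      \<open>\<delta> / 4\<close>; the Chebyshev error \<open>1 / (c ^ 2 * k)\<close> is left to
      large \<open>k\<close>.\<close>
    define c where "c = min (1 / 4) (\<delta> / (32 * (real l0 + 1)))"
    have c: "0 < c" "c \<le> 1 / 4" "c \<le> \<delta> / (32 * (real l0 + 1))"
      unfolding c_def using \<delta> by (simp, intro min.cobounded1, intro min.cobounded2)
    have c': "8 * real l0 * c \<le> \<delta> / 4"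
    proof -
      have "8 * real l0 * c \<le> 8 * (real l0 + 1) * (\<delta> / (32 * (real l0 + 1)))"
        using c by (intro mult_mono) auto
      moreover have "8 * x * (\<delta> / (32 * x)) = \<delta> / 4" if "x > 0" for x
        using that by (simp add: field_simps)
      from this[of "real l0 + 1"]
      have "8 * (real l0 + 1) * (\<delta> / (32 * (real l0 + 1))) = \<delta> / 4"
        using of_nat_0_le_iff[of l0] by linarith
      ultimately show ?thesis by linarith
    qed
    define k1 where "k1 = nat \<lceil>4 / \<delta> + 4 / (c\<^sup>2 * \<delta>)\<rceil> + 1"
    have "eventually (\<lambda>k. real (l k) / real k powr (6 / 5) < 1 / 2000000) sequentially"
      using assms(2) by (rule order_tendstoD(2)) simp
    moreover have "eventually (\<lambda>k. max k0 k1 \<le> k) sequentially" by (rule eventually_ge_at_top)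
    ultimately show ?thesis
    proof eventually_elim
      case (elim k)
      have "4 / \<delta> + 4 / (c\<^sup>2 * \<delta>) \<le> real (nat \<lceil>4 / \<delta> + 4 / (c\<^sup>2 * \<delta>)\<rceil>)" by (rule real_nat_ceiling_ge)
      moreover have "real k1 \<le> real k" using elim by simp
      moreover have "4 / \<delta> > 0" "4 / (c\<^sup>2 * \<delta>) > 0" using \<delta> c by auto
      ultimately have k: "4 / \<delta> \<le> real k" "4 / (c\<^sup>2 * \<delta>) \<le> real k" "1 \<le> real k"
        unfolding k1_def by linarith+
      have kd: "1 / real k \<le> \<delta> / 4" using k \<delta> by (simp add: field_simps)
      have cd: "1 / (c\<^sup>2 * real k) \<le> \<delta> / 4" using k \<delta> c by (simp add: field_simps)
      \<comment> \<open>The growth hypothesis enters here, through the bound that excludes dense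
        graphs in \<open>avg_ndeg_le\<close>.\<close>
      have lk: "real (l k) \<le> (real k)\<^sup>2 / 2000000"
      proof -
        have "real (l k) < 1 / 2000000 * real k powr (6 / 5)"
          using elim k by (simp add: pos_divide_less_eq)
        also have "real k powr (6 / 5) \<le> real k powr 2" using k by (intro powr_mono) auto
        also have "real k powr 2 = (real k)\<^sup>2" using k by simp
        finally show ?thesis by simp
      qed
      show "edge_inducibility k (l k) \<le> 1 / exp 1 + \<delta>"
      proof (rule edge_inducibility_le)
        fix V :: "nat set" and E
        assume G: "simple_graph V E" and n: "k ^ 3 \<le> card V" "k \<le> card V"
        have fin: "finite V" using G by (simp add: simple_graph_def)
        have "real k ^ 3 \<le> real (card V)" using n by (metis of_nat_le_iff of_nat_power)
        then have "(real k)\<^sup>2 / real (card V) \<le> (real k)\<^sup>2 / real k ^ 3"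
          using k n by (intro divide_left_mono) auto
        also have "\<dots> = 1 / real k" by (simp add: power2_eq_square power3_eq_cube)
        finally have kn: "(real k)\<^sup>2 / real (card V) \<le> \<delta> / 4" using kd by linarith
        show "induced_freq V E k (l k) \<le> 1 / exp 1 + \<delta>"
        proof (cases "l0 \<le> l k")
          case True
          have "symp (\<lambda>x y. {x, y} \<in> E)" by (auto simp: symp_def insert_commute)
          then have "lavg V k (\<lambda>xs. of_bool (ecount (\<lambda>x y. {x, y} \<in> E) xs = int (l k))) \<le> 1 / exp 1 + \<delta> / 2"
            using elim n True lk by (intro large[OF fin]) auto
          moreover have "V \<noteq> {}" using n k by auto
          ultimately show ?thesis using induced_freq_le_lavg[OF G _ n(2), of "l k"] kn \<delta> by linarith
        next
          case False
          have "induced_freq V E k (l k) \<le> 1 / exp 1 + (real k)\<^sup>2 / real (card V) +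
              8 * real (l k) * (c * real k) / real k + real k / (c * real k)\<^sup>2"
            by (rule induced_freq_le_of_small[OF G]) (use k n c assms(1)[of k] in auto)
          moreover have "8 * real (l k) * (c * real k) / real k \<le> \<delta> / 4"
          proof -
            have "8 * real (l k) * (c * real k) / real k = 8 * real (l k) * c" using k by simp
            also have "\<dots> \<le> 8 * real l0 * c" using False c by (intro mult_right_mono) auto
            finally show ?thesis using c' by linarith
          qed
          moreover have "real k / (c * real k)\<^sup>2 = 1 / (c\<^sup>2 * real k)"
            using k c by (simp add: power2_eq_square)
          ultimately show ?thesis using kn cd \<delta> by linarith
        qed
      qed
    qed
  qed
  \<comment> \<open>The positive part of the excess over \<open>1 / exp 1\<close>: nonnegative by
    construction, so the eventual upper bounds alone give convergence to 0.\<close>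
  define \<epsilon> where "\<epsilon> k = max 0 (edge_inducibility k (l k) - 1 / exp 1)" for k
  have "\<epsilon> \<longlonglongrightarrow> 0"
  proof (rule order_tendstoI)
    fix a :: real assume "a < 0"
    then show "eventually (\<lambda>k. a < \<epsilon> k) sequentially"
      by (intro always_eventually allI) (simp add: \<epsilon>_def less_max_iff_disj)
  next
    fix a :: real assume a: "0 < a"
    show "eventually (\<lambda>k. \<epsilon> k < a) sequentially"
      using bound[OF half_gt_zero[OF a]] by eventually_elim (use a in \<open>auto simp: \<epsilon>_def\<close>)
  qed
  moreover have "edge_inducibility k (l k) \<le> 1 / exp 1 + \<epsilon> k" for k
    by (auto simp: \<epsilon>_def max_def)
  ultimately show ?thesis by blast
qed

end
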